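(* Let $H\in(0,1)$ with $H>\frac16$, let $B=(B_t)_{t\in[0,1]}$ be a fractional Brownian motion with Hurst parameter $H$, and let $f:\mathbb{R}\to\mathbb{R}$ be of class $\mathscr{C}^{12}$ and such that, for any $p\in(0,\infty)$ and any $0\le i\le 12$, $\sup_{t\in[0,1]}E\{|f^{(i)}(B_t)|^p\}<\infty$. Then the limit in probability, as $n\to\infty$, of the symmetric Riemann sums $$\frac12\sum_{k=1}^{2^n}\big(f'(B_{k2^{-n}})+f'(B_{(k-1)2^{-n}})\big)\,\Delta B_{k2^{-n}}$$ exists and is given by $f(B_1)-f(0)$.
   Context: $B=(B_t)_{t\in[0,1]}$ is a centered Gaussian process with covariance $E(B_tB_s)=\frac12(s^{2H}+t^{2H}-|t-s|^{2H})$, and $\Delta B_{k2^{-n}}=B_{k2^{-n}}-B_{(k-1)2^{-n}}$. *)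

theory Defs
  imports "HOL-Probability.Probability"
begin

definition continuously_differentiable :: "nat \<Rightarrow> (real \<Rightarrow> real) \<Rightarrow> bool" where
  "continuously_differentiable m f \<longleftrightarrow>
     (\<forall>i<m. \<forall>x. (deriv ^^ i) f differentiable (at x)) \<and>
     continuous_on UNIV ((deriv ^^ m) f)"

(* The second disjunct is the degenerate Gaussian law of variance 0, which has no density.
   It is needed, for instance, for fractional Brownian motion at time 0. *)
definition gaussian_variable :: "'a measure \<Rightarrow> ('a \<Rightarrow> real) \<Rightarrow> bool" where
  "gaussian_variable M X \<longleftrightarrow>
     (\<exists>\<mu> \<sigma>. \<sigma> > 0 \<and> distributed M lborel X (normal_density \<mu> \<sigma>)) \<or>
     (X \<in> borel_measurable M \<and> (\<exists>\<mu>. AE \<omega> in M. X \<omega> = \<mu>))"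

definition gaussian_process :: "'a measure \<Rightarrow> 't set \<Rightarrow> ('t \<Rightarrow> 'a \<Rightarrow> real) \<Rightarrow> bool" where
  "gaussian_process M T X \<longleftrightarrow>
     (\<forall>J c. finite J \<and> J \<subseteq> T \<longrightarrow> gaussian_variable M (\<lambda>\<omega>. \<Sum>t\<in>J. c t * X t \<omega>))"

definition centered_process :: "'a measure \<Rightarrow> 't set \<Rightarrow> ('t \<Rightarrow> 'a \<Rightarrow> real) \<Rightarrow> bool" where
  "centered_process M T X \<longleftrightarrow>
     (\<forall>t\<in>T. integrable M (X t) \<and> integral\<^sup>L M (X t) = 0)"

(* Continuity of the sample paths is not part of the definition. Values of B at times outside
   the unit interval are irrelevant. *)
definition fractional_brownian_motion ::
    "'a measure \<Rightarrow> real \<Rightarrow> (real \<Rightarrow> 'a \<Rightarrow> real) \<Rightarrow> bool" where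
  "fractional_brownian_motion M H B \<longleftrightarrow>
     gaussian_process M {0..1} B \<and>
     centered_process M {0..1} B \<and>
     (\<forall>s\<in>{0..1}. \<forall>t\<in>{0..1}.
        integrable M (\<lambda>\<omega>. B t \<omega> * B s \<omega>) \<and>
        integral\<^sup>L M (\<lambda>\<omega>. B t \<omega> * B s \<omega>) =
          1/2 * (s powr (2*H) + t powr (2*H) - \<bar>t - s\<bar> powr (2*H)))"

definition dyadic_increment :: "(real \<Rightarrow> 'a \<Rightarrow> real) \<Rightarrow> nat \<Rightarrow> nat \<Rightarrow> 'a \<Rightarrow> real" where
  "dyadic_increment B n k \<omega> = B (real k / 2^n) \<omega> - B ((real k - 1) / 2^n) \<omega>"

(* Measurability is required explicitly because measure M sends non-measurable sets to 0. *)
definition tendsto_in_probability ::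
    "'a measure \<Rightarrow> (nat \<Rightarrow> 'a \<Rightarrow> real) \<Rightarrow> ('a \<Rightarrow> real) \<Rightarrow> bool" where
  "tendsto_in_probability M X Y \<longleftrightarrow>
     (\<forall>n. X n \<in> borel_measurable M) \<and> Y \<in> borel_measurable M \<and>
     (\<forall>\<epsilon>>0. (\<lambda>n. measure M {\<omega> \<in> space M. \<bar>X n \<omega> - Y \<omega>\<bar> > \<epsilon>}) \<longlonglongrightarrow> 0)"

end

theory Submission
  imports Defs
begin

text \<open>
  The error of the trapezoidal rule is linear in \<open>f\<close>, so it suffices to control it for the
  functions \<open>cos (l x)\<close> and \<open>sin (l x)\<close>, with polynomial dependence on \<open>l\<close>: with high probability,
  uniformly in \<open>n\<close>, all values of \<open>B\<close> at dyadic points lie in a fixed interval (chaining), and there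
  \<open>f\<close> agrees with a Fourier series whose coefficients decay like \<open>l\<^sup>-\<^sup>8\<close>.

  For a trigonometric function the error over one step is \<open>cos (l m)\<close> or \<open>sin (l m)\<close> times an odd
  function \<open>\<phi> (h) = l h cos (l h / 2) - 2 sin (l h / 2)\<close> of the increment \<open>h\<close>, where \<open>m\<close> is the
  mean of the two end values. Its second moment is a double sum of expectations
  \<open>E (cos (l (m\<^sub>j - m\<^sub>k)) \<phi> (h\<^sub>j) \<phi> (h\<^sub>k))\<close>, which are explicit for Gaussian vectors. As \<open>\<phi>\<close> is odd and
  of third order at 0, they are at most of the order of
  \<open>2^(- 4 H n) (\<bar>E (h\<^sub>j h\<^sub>k)\<bar> + \<bar>E ((m\<^sub>j - m\<^sub>k) h\<^sub>j) E ((m\<^sub>j - m\<^sub>k) h\<^sub>k)\<bar>)\<close>. Since the values are averaged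
  symmetrically, the last two covariances are equal central differences of \<open>\<bar>t\<bar> powr (2 H)\<close>, and the
  double sum is of the order of \<open>2^((1 - 6 H) n)\<close> when \<open>H \<le> 1/3\<close>. For \<open>H > 1/3\<close> absolute bounds suffice.
\<close>

section \<open>Fourier series\<close>

text \<open>Trigonometric functions are chosen because expectations of exponentials of a Gaussian
  vector are explicit, so correlations can be exploited without Gaussian integration by parts. The
  price is uniformity in the frequency. This is the origin of the degree 12 in \<open>l\<close> of
  the second moment. First absolute moments then grow like the sixth power of \<open>l\<close>, and
  against coefficients of order -8 a summable inverse square remains.

  The split at 1/3 comes from the absolute bound over all \<open>4^n\<close> pairs, which needs
  \<open>2 - 6 * H < 0\<close>. Below the split \<open>2 * H \<le> 1\<close>, so the power is
  concave and its differences telescope.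

  The error involves \<open>f\<close> and its derivative only at values of \<open>B\<close> on the
  grid. Hence a pathwise expansion on a bounded interval is enough, and the series over all
  frequencies is controlled by one nonnegative random majorant.\<close>

definition dirichlet :: "nat \<Rightarrow> real \<Rightarrow> real" where
  "dirichlet N t = 1/2 + (\<Sum>n=1..N. cos (real n * t))"

lemma dirichlet_mult_sin: "dirichlet N t * (2 * sin (t / 2)) = sin ((real N + 1/2) * t)"
proof (induction N)
  case (Suc N)
  have "2 * (cos (real (Suc N) * t) * sin (t / 2)) = sin (real (Suc N) * t + t/2) - sin (real (Suc N) * t - t/2)"
    by (simp add: sin_add sin_diff)
  moreover have "real (Suc N) * t - t/2 = (real N + 1/2) * t" "real (Suc N) * t + t/2 = (real (Suc N) + 1/2) * t"
    by (simp_all add: algebra_simps)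
  ultimately show ?case using Suc by (simp add: dirichlet_def algebra_simps)
qed (simp add: dirichlet_def)

lemma has_integral_cos_period:
  assumes "m \<noteq> (0::int)"
  shows "((\<lambda>y. cos (real_of_int m * (y - x))) has_integral 0) {-pi..pi}"
proof -
  have "((\<lambda>y. cos (real_of_int m * (y - x))) has_integral
      (sin (real_of_int m * (pi - x)) / m - sin (real_of_int m * (-pi - x)) / m)) {-pi..pi}"
    using assms
    by (intro fundamental_theorem_of_calculus)
       (auto intro!: derivative_eq_intros simp flip: has_real_derivative_iff_has_vector_derivative)
  moreover have "sin (real_of_int m * (pi - x)) = sin (real_of_int m * (-pi - x) + (2 * pi) * of_int m)"
    by (simp add: algebra_simps)
  moreover have "\<dots> = sin (real_of_int m * (-pi - x))"
    by (simp add: sin_add sin_int_2pin cos_int_2pin)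
  ultimately show ?thesis by simp
qed

lemma integral_dirichlet: "((\<lambda>y. dirichlet N (y - x)) has_integral pi) {-pi..pi}"
proof -
  have "((\<lambda>y. 1/2 + (\<Sum>n=1..N. cos (real n * (y - x)))) has_integral
      (measure lborel {-pi..pi} *\<^sub>R (1/2) + (\<Sum>n=1..N. 0))) {-pi..pi}"
  proof (intro has_integral_add has_integral_sum)
    show "((\<lambda>y. 1/2 :: real) has_integral (measure lborel {-pi..pi} *\<^sub>R (1/2))) {-pi..pi}"
      by (rule has_integral_const_real)
    fix n assume "n \<in> {1..N}"
    then show "((\<lambda>y. cos (real n * (y - x))) has_integral 0) {-pi..pi}"
      using has_integral_cos_period[of "int n" x] by auto
  qed simp
  then show ?thesis by (simp add: dirichlet_def)
qed

text \<open>The frequencies are not integers, but a product of two such sines is a combination of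
  cosines with the integer frequencies \<open>m - n\<close> and \<open>m + n + 1\<close>. The second
  is never 0, and the phase \<open>x\<close> drops out over a full period.\<close>

lemma integral_half_integer_sines:
  "integral {-pi..pi} (\<lambda>y. sin ((real m + 1/2) * (y - x)) * sin ((real n + 1/2) * (y - x))) = (if m = n then pi else 0)"
proof -
  have "sin ((real m + 1/2) * t) * sin ((real n + 1/2) * t)
     = (cos (real_of_int (int m - int n) * t) - cos (real_of_int (int m + int n + 1) * t)) / 2" for t
  proof -
    have "sin a * sin b = (cos (a - b) - cos (a + b)) / 2" for a b :: real
      by (simp add: cos_diff cos_add)
    from this[of "(real m + 1/2) * t" "(real n + 1/2) * t"] show ?thesis by (simp add: algebra_simps)
  qed
  then have e: "(\<lambda>y. sin ((real m + 1/2) * (y - x)) * sin ((real n + 1/2) * (y - x)))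
    = (\<lambda>y. (cos (real_of_int (int m - int n) * (y - x)) - cos (real_of_int (int m + int n + 1) * (y - x))) / 2)"
    by (simp only:)
  have h1: "((\<lambda>y. cos (real_of_int (int m + int n + 1) * (y - x))) has_integral 0) {-pi..pi}"
    by (rule has_integral_cos_period) auto
  have h2: "((\<lambda>y. cos (real_of_int (int m - int n) * (y - x))) has_integral (if m = n then 2 * pi else 0)) {-pi..pi}"
  proof (cases "m = n")
    case True
    then show ?thesis using has_integral_const_real[of "1::real" "-pi" pi] by simp
  next
    case False
    then show ?thesis using has_integral_cos_period[of "int m - int n" x] by simp
  qed
  have i: "((\<lambda>y. (cos (real_of_int (int m - int n) * (y - x)) - cos (real_of_int (int m + int n + 1) * (y - x))) / 2)
     has_integral ((if m = n then 2 * pi else 0) - 0) / 2) {-pi..pi}"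
    by (intro has_integral_divide has_integral_diff h1 h2)
  show ?thesis unfolding e integral_unique[OF i] by simp
qed

text \<open>A Riemann-Lebesgue lemma for exactly the frequencies that the Dirichlet kernel produces.
  Since the shifted sines are orthogonal, the squares of the coefficients are summable, and no
  approximation of \<open>h\<close> by smoother functions is involved.\<close>

lemma half_integer_sine_coefficients_tendsto_0:
  assumes h: "continuous_on {-pi..pi} h"
  shows "(\<lambda>n. integral {-pi..pi} (\<lambda>y. h y * sin ((real n + 1/2) * (y - x)))) \<longlonglongrightarrow> 0"
proof -
  define e where "e = (\<lambda>n y. sin ((real n + 1/2) * (y - x)))"
  define c where "c = (\<lambda>n. integral {-pi..pi} (\<lambda>y. h y * e n y))"
  have e: "continuous_on {-pi..pi} (e n)" for n unfolding e_def by (intro continuous_intros)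
  have int: "f integrable_on {-pi..pi}" if "continuous_on {-pi..pi} f" for f :: "real \<Rightarrow> real"
    using integrable_continuous_interval[OF that] .
  \<comment> \<open>Bessel's inequality for the functions \<open>e n\<close>, which are orthogonal over a period\<close>
  have bessel: "(\<Sum>n<N. (c n)^2) \<le> pi * integral {-pi..pi} (\<lambda>y. (h y)^2)" for N
  proof -
    define S where "S = (\<lambda>y. \<Sum>n<N. c n * e n y)"
    have S: "continuous_on {-pi..pi} S" unfolding S_def by (intro continuous_intros e)
    have hS: "integral {-pi..pi} (\<lambda>y. h y * S y) = (\<Sum>n<N. (c n)^2)"
    proof -
      have "integral {-pi..pi} (\<lambda>y. h y * S y) = integral {-pi..pi} (\<lambda>y. \<Sum>n<N. c n * (h y * e n y))"
        by (simp add: S_def sum_distrib_left mult.left_commute)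
      also have "\<dots> = (\<Sum>n<N. integral {-pi..pi} (\<lambda>y. c n * (h y * e n y)))"
        by (intro integral_sum int continuous_intros h e) auto
      also have "\<dots> = (\<Sum>n<N. (c n)^2)" by (simp add: c_def power2_eq_square)
      finally show ?thesis .
    qed
    have eS: "integral {-pi..pi} (\<lambda>y. e m y * S y) = c m * pi" if "m < N" for m
    proof -
      have "integral {-pi..pi} (\<lambda>y. e m y * S y) = integral {-pi..pi} (\<lambda>y. \<Sum>n<N. c n * (e m y * e n y))"
        by (simp add: S_def sum_distrib_left mult.left_commute)
      also have "\<dots> = (\<Sum>n<N. integral {-pi..pi} (\<lambda>y. c n * (e m y * e n y)))"
        by (intro integral_sum int continuous_intros e) auto
      also have "\<dots> = (\<Sum>n<N. if m = n then c n * pi else 0)"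
        unfolding e_def integral_mult_right integral_half_integer_sines by (intro sum.cong) auto
      also have "\<dots> = c m * pi" using that by simp
      finally show ?thesis .
    qed
    have SS: "integral {-pi..pi} (\<lambda>y. S y * S y) = pi * (\<Sum>n<N. (c n)^2)"
    proof -
      have "integral {-pi..pi} (\<lambda>y. S y * S y) = integral {-pi..pi} (\<lambda>y. \<Sum>n<N. c n * (e n y * S y))"
        by (simp add: S_def sum_distrib_right mult.assoc)
      also have "\<dots> = (\<Sum>n<N. integral {-pi..pi} (\<lambda>y. c n * (e n y * S y)))"
        by (intro integral_sum int continuous_intros e S) auto
      also have "\<dots> = (\<Sum>n<N. c n * (c n * pi))" by (intro sum.cong) (auto simp: eS)
      finally show ?thesis by (simp add: sum_distrib_left power2_eq_square mult_ac)
    qed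
    \<comment> \<open>The functions \<open>e n\<close> have squared norm \<open>pi\<close>, so the
      orthogonal projection of \<open>h\<close> is \<open>S / pi\<close>; multiplying by
      \<open>pi\<close> clears the denominators.\<close>
    have "0 \<le> integral {-pi..pi} (\<lambda>y. (pi * h y - S y)^2)"
      by (intro integral_nonneg int continuous_intros h S) auto
    also have "(\<lambda>y. (pi * h y - S y)^2) = (\<lambda>y. pi^2 * (h y)^2 - 2 * pi * (h y * S y) + S y * S y)"
      by (simp add: power2_eq_square algebra_simps)
    also have "integral {-pi..pi} \<dots> = pi^2 * integral {-pi..pi} (\<lambda>y. (h y)^2)
        - 2 * pi * integral {-pi..pi} (\<lambda>y. h y * S y) + integral {-pi..pi} (\<lambda>y. S y * S y)"
    proof -
      have i: "(\<lambda>y. pi^2 * (h y)^2) integrable_on {-pi..pi}" "(\<lambda>y. 2 * pi * (h y * S y)) integrable_on {-pi..pi}"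
        "(\<lambda>y. pi^2 * (h y)^2 - 2 * pi * (h y * S y)) integrable_on {-pi..pi}" "(\<lambda>y. S y * S y) integrable_on {-pi..pi}"
        by (intro int continuous_intros h S)+
      show ?thesis unfolding integral_add[OF i(3,4)] integral_diff[OF i(1,2)] by simp
    qed
    also have "\<dots> = pi * (pi * integral {-pi..pi} (\<lambda>y. (h y)^2) - (\<Sum>n<N. (c n)^2))"
      unfolding hS SS by (simp add: power2_eq_square algebra_simps)
    finally show ?thesis using pi_gt_zero by (auto simp: zero_le_mult_iff)
  qed
  have "summable (\<lambda>n. (c n)^2)"
    by (rule summableI_nonneg_bounded[OF _ bessel]) simp
  then have "(\<lambda>n. (c n)^2) \<longlonglongrightarrow> 0" by (rule summable_LIMSEQ_zero)
  then have "(\<lambda>n. sqrt ((c n)^2)) \<longlonglongrightarrow> sqrt 0" by (rule tendsto_real_sqrt)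
  then have "c \<longlonglongrightarrow> 0" by (simp add: tendsto_rabs_zero_iff)
  then show ?thesis by (simp add: c_def e_def)
qed

definition fourier_cos :: "(real \<Rightarrow> real) \<Rightarrow> nat \<Rightarrow> real" where
  "fourier_cos g n = integral {-pi..pi} (\<lambda>y. g y * cos (real n * y)) / pi"

definition fourier_sin :: "(real \<Rightarrow> real) \<Rightarrow> nat \<Rightarrow> real" where
  "fourier_sin g n = integral {-pi..pi} (\<lambda>y. g y * sin (real n * y)) / pi"

lemma fourier_partial_sum:
  assumes g: "continuous_on {-pi..pi} g"
  shows "fourier_cos g 0 / 2 + (\<Sum>n=1..N. fourier_cos g n * cos (real n * x) + fourier_sin g n * sin (real n * x))
    = integral {-pi..pi} (\<lambda>y. g y * dirichlet N (y - x)) / pi"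
proof -
  have int: "f integrable_on {-pi..pi}" if "continuous_on {-pi..pi} f" for f :: "real \<Rightarrow> real"
    using integrable_continuous_interval[OF that] .
  have harmonic: "integral {-pi..pi} (\<lambda>y. g y * cos (real n * (y - x))) / pi
      = fourier_cos g n * cos (real n * x) + fourier_sin g n * sin (real n * x)" for n
  proof -
    have e: "(\<lambda>y. g y * cos (real n * (y - x))) = (\<lambda>y. (g y * cos (real n * y)) * cos (real n * x) + (g y * sin (real n * y)) * sin (real n * x))"
      by (simp add: right_diff_distrib cos_diff algebra_simps)
    have "integral {-pi..pi} (\<lambda>y. g y * cos (real n * (y - x))) = integral {-pi..pi} (\<lambda>y. g y * cos (real n * y)) * cos (real n * x)
       + integral {-pi..pi} (\<lambda>y. g y * sin (real n * y)) * sin (real n * x)"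
      unfolding e by (subst integral_add) (auto intro!: int continuous_intros g)
    then show ?thesis by (simp add: fourier_cos_def fourier_sin_def add_divide_distrib)
  qed
  have "integral {-pi..pi} (\<lambda>y. g y * dirichlet N (y - x))
    = integral {-pi..pi} (\<lambda>y. g y / 2 + (\<Sum>n=1..N. g y * cos (real n * (y - x))))"
    by (simp add: dirichlet_def distrib_left sum_distrib_left)
  also have "\<dots> = integral {-pi..pi} g / 2 + (\<Sum>n=1..N. integral {-pi..pi} (\<lambda>y. g y * cos (real n * (y - x))))"
  proof -
    have i: "(\<lambda>y. g y / 2) integrable_on {-pi..pi}" "(\<lambda>y. g y * cos (real n * (y - x))) integrable_on {-pi..pi}"
      "(\<lambda>y. \<Sum>n=1..N. g y * cos (real n * (y - x))) integrable_on {-pi..pi}" for n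
      by (intro int continuous_intros g; simp)+
    show ?thesis unfolding integral_add[OF i(1,3)] integral_sum[OF finite_atLeastAtMost i(2)] by simp
  qed
  finally have e: "integral {-pi..pi} (\<lambda>y. g y * dirichlet N (y - x))
    = integral {-pi..pi} g / 2 + (\<Sum>n=1..N. integral {-pi..pi} (\<lambda>y. g y * cos (real n * (y - x))))" .
  show ?thesis
    unfolding harmonic[symmetric] e by (simp add: fourier_cos_def add_divide_distrib sum_divide_distrib mult.commute)
qed

text \<open>Subtracting \<open>g x\<close> times the integral of the kernel leaves a half-integer
  sine coefficient of a difference quotient. Differentiability at \<open>x\<close> makes this
  quotient continuous, and \<open>\<bar>x\<bar> < pi\<close> ensures that its denominator vanishes
  only at \<open>x\<close>.\<close>

lemma fourier_series_converges:
  assumes g: "continuous_on {-pi..pi} g" and D: "(g has_real_derivative D) (at x)" and x: "\<bar>x\<bar> < pi"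
  shows "(\<lambda>N. fourier_cos g 0 / 2 + (\<Sum>n=1..N. fourier_cos g n * cos (real n * x) + fourier_sin g n * sin (real n * x))) \<longlonglongrightarrow> g x"
proof -
  \<comment> \<open>The value \<open>D\<close> removes the singularity, since
    \<open>2 * sin ((y - x) / 2)\<close> is asymptotic to \<open>y - x\<close>.\<close>
  define h where "h = (\<lambda>y. if y = x then D else (g y - g x) / (2 * sin ((y - x) / 2)))"
  have s: "sin ((y - x) / 2) \<noteq> 0" if "y \<in> {-pi..pi}" "y \<noteq> x" for y
  proof -
    have "0 < sin (\<bar>y - x\<bar> / 2)" using that x by (intro sin_gt_zero) auto
    then show ?thesis by (auto simp: abs_if split: if_splits) (metis minus_diff_eq minus_divide_left neg_equal_0_iff_equal order_less_irrefl sin_minus)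
  qed
  have "continuous_on {-pi..pi} h"
    unfolding continuous_on_eq_continuous_within
  proof
    fix y assume y: "y \<in> {-pi..pi}"
    show "continuous (at y within {-pi..pi}) h"
    proof (cases "y = x")
      case True
      have l1: "((\<lambda>y. (g y - g x) / (y - x)) \<longlongrightarrow> D) (at x)"
        using D by (simp add: has_field_derivative_iff)
      have "((\<lambda>y. 2 * sin ((y - x) / 2)) has_real_derivative 1) (at x)"
        by (auto intro!: derivative_eq_intros)
      then have l2: "((\<lambda>y. 2 * sin ((y - x) / 2) / (y - x)) \<longlongrightarrow> 1) (at x)"
        by (simp add: has_field_derivative_iff)
      have "((\<lambda>y. ((g y - g x) / (y - x)) / (2 * sin ((y - x) / 2) / (y - x))) \<longlongrightarrow> D / 1) (at x)"
        by (intro tendsto_divide l1 l2) simp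
      then have "(h \<longlongrightarrow> D / 1) (at x)"
        by (rule Lim_transform_eventually) (auto simp: eventually_at_filter h_def)
      then show ?thesis
        unfolding True continuous_within by (simp add: h_def tendsto_within_subset[OF _ subset_UNIV])
    next
      case False
      have "continuous (at y within {-pi..pi}) (\<lambda>y. (g y - g x) / (2 * sin ((y - x) / 2)))"
        using g y s[OF y False] by (intro continuous_intros) (auto simp: continuous_on_eq_continuous_within)
      moreover have "eventually (\<lambda>z. (g z - g x) / (2 * sin ((z - x) / 2)) = h z) (at y within {-pi..pi})"
        using False by (intro eventually_mono[OF tendsto_imp_eventually_ne[OF tendsto_ident_at]]) (auto simp: h_def)
      ultimately show ?thesis
        using False unfolding continuous_within by (auto simp: h_def elim: Lim_transform_eventually)
    qed
  qed
  then have "(\<lambda>N. integral {-pi..pi} (\<lambda>y. h y * sin ((real N + 1/2) * (y - x))) / pi + g x) \<longlonglongrightarrow> 0 / pi + g x"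
    by (intro tendsto_intros half_integer_sine_coefficients_tendsto_0) auto
  moreover have "integral {-pi..pi} (\<lambda>y. h y * sin ((real N + 1/2) * (y - x))) / pi + g x
     = integral {-pi..pi} (\<lambda>y. g y * dirichlet N (y - x)) / pi" for N
  proof -
    have int: "f integrable_on {-pi..pi}" if "continuous_on {-pi..pi} f" for f :: "real \<Rightarrow> real"
      using integrable_continuous_interval[OF that] .
    have dc: "continuous_on {-pi..pi} (\<lambda>y. dirichlet N (y - x))"
      unfolding dirichlet_def by (intro continuous_intros)
    have "integral {-pi..pi} (\<lambda>y. h y * sin ((real N + 1/2) * (y - x)))
      = integral {-pi..pi} (\<lambda>y. g y * dirichlet N (y - x) - g x * dirichlet N (y - x))"
    proof (intro integral_cong)
      fix y assume y: "y \<in> {-pi..pi}"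
      show "h y * sin ((real N + 1/2) * (y - x)) = g y * dirichlet N (y - x) - g x * dirichlet N (y - x)"
        using s[OF y] unfolding dirichlet_mult_sin[symmetric] by (auto simp: h_def field_simps)
    qed
    also have "\<dots> = integral {-pi..pi} (\<lambda>y. g y * dirichlet N (y - x)) - g x * pi"
      by (subst integral_diff) (auto intro!: int continuous_intros g dc simp: integral_unique[OF integral_dirichlet])
    finally show ?thesis by (simp add: field_simps)
  qed
  ultimately show ?thesis unfolding fourier_partial_sum[OF g] by simp
qed


section \<open>Functions of class C^m and smooth cutoffs\<close>

text \<open>With an existentially quantified derivative, each closure property follows from one
  differentiation and the induction hypothesis, without formulas for iterated derivatives.\<close>

fun Ck :: "nat \<Rightarrow> (real \<Rightarrow> real) \<Rightarrow> bool" where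
  "Ck 0 g \<longleftrightarrow> continuous_on UNIV g"
| "Ck (Suc m) g \<longleftrightarrow> (\<exists>g'. (\<forall>x. (g has_real_derivative g' x) (at x)) \<and> Ck m g')"

lemma Ck_SucI: "(\<And>x. (g has_real_derivative g' x) (at x)) \<Longrightarrow> Ck m g' \<Longrightarrow> Ck (Suc m) g"
  by auto

lemma Ck_continuous: "Ck m g \<Longrightarrow> continuous_on UNIV g"
  by (cases m) (auto intro: DERIV_isCont continuous_at_imp_continuous_on)

lemma Ck_SucD: "Ck (Suc m) g \<Longrightarrow> Ck m g"
proof (induction m arbitrary: g)
  case 0
  then show ?case using Ck_continuous[of 1 g] by simp
next
  case (Suc m)
  then show ?case by (metis Ck.simps(2))
qed

lemma Ck_mono: "Ck n g \<Longrightarrow> m \<le> n \<Longrightarrow> Ck m g"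
  by (induction n) (auto simp: le_Suc_eq simp del: Ck.simps dest: Ck_SucD)

lemma Ck_add: "Ck m f \<Longrightarrow> Ck m g \<Longrightarrow> Ck m (\<lambda>x. f x + g x)"
proof (induction m arbitrary: f g)
  case (Suc m)
  then obtain f' g' where "\<And>x. (f has_real_derivative f' x) (at x)" "Ck m f'"
    "\<And>x. (g has_real_derivative g' x) (at x)" "Ck m g'" by auto
  then show ?case
    using Suc.IH[of f' g'] by (intro Ck_SucI[of _ "\<lambda>x. f' x + g' x"] derivative_intros) auto
qed (auto intro: continuous_intros)

lemma Ck_mult: "Ck m f \<Longrightarrow> Ck m g \<Longrightarrow> Ck m (\<lambda>x. f x * g x)"
proof (induction m arbitrary: f g)
  case (Suc m)
  then obtain f' g' where d: "\<And>x. (f has_real_derivative f' x) (at x)" "Ck m f'"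
    "\<And>x. (g has_real_derivative g' x) (at x)" "Ck m g'" by auto
  have "((\<lambda>x. f x * g x) has_real_derivative (f' x * g x + f x * g' x)) (at x)" for x
    by (auto intro!: derivative_eq_intros d)
  moreover have "Ck m (\<lambda>x. f' x * g x + f x * g' x)"
    using Suc.prems d by (intro Ck_add Suc.IH) (auto dest: Ck_SucD simp del: Ck.simps)
  ultimately show ?case by (rule Ck_SucI)
qed (auto intro: continuous_intros)

lemma Ck_const: "Ck m (\<lambda>x. c)"
  by (induction m arbitrary: c) (auto intro!: exI[of _ "\<lambda>_. 0"])

lemma Ck_affine: "Ck m g \<Longrightarrow> Ck m (\<lambda>x. g (a * x + b))"
proof (induction m arbitrary: g)
  case 0
  then show ?case by (auto intro!: continuous_intros elim: continuous_on_compose2)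
next
  case (Suc m)
  then obtain g' where d: "\<And>x. (g has_real_derivative g' x) (at x)" "Ck m g'" by auto
  have "((\<lambda>x. g (a * x + b)) has_real_derivative (a * g' (a * x + b))) (at x)" for x
  proof -
    have "((\<lambda>x. a * x + b) has_real_derivative a) (at x)" by (auto intro!: derivative_eq_intros)
    from DERIV_chain2[OF d(1) this] show ?thesis by (simp add: mult.commute)
  qed
  moreover have "Ck m (\<lambda>x. a * g' (a * x + b))"
    using Suc.IH[OF d(2)] by (intro Ck_mult Ck_const)
  ultimately show ?case by (rule Ck_SucI)
qed

lemma Ck_inverse:
  assumes "\<And>x. g x \<noteq> 0"
  shows "Ck m g \<Longrightarrow> Ck m (\<lambda>x. inverse (g x))"
proof (induction m)
  case (Suc m)
  then obtain g' where d: "\<And>x. (g has_real_derivative g' x) (at x)" "Ck m g'" by auto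
  have "((\<lambda>x. inverse (g x)) has_real_derivative - 1 * (inverse (g x) * g' x * inverse (g x))) (at x)" for x
    using DERIV_inverse'[OF d(1)[of x] assms] by simp
  moreover have "Ck m (\<lambda>x. - 1 * (inverse (g x) * g' x * inverse (g x)))"
    using Suc.IH Ck_SucD[OF Suc.prems] by (intro Ck_mult Ck_const d)
  ultimately show ?case by (rule Ck_SucI)
qed (use assms in \<open>auto intro: continuous_intros\<close>)

text \<open>Finite smoothness is all that the cutoff has to provide, so a power of the positive part
  takes the place of \<open>exp (- 1 / x)\<close>. Differentiation lowers the exponent by one, and
  only at 0 is the difference quotient examined directly.\<close>

lemma Ck_pos_part_power: "Ck m (\<lambda>x. (max 0 x) ^ Suc m)"
proof (induction m)
  case 0
  then show ?case by (auto intro!: continuous_intros)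
next
  case (Suc m)
  have "((\<lambda>x. (max 0 x) ^ Suc (Suc m)) has_real_derivative (real (Suc (Suc m)) * (max 0 x) ^ Suc m)) (at x)" for x :: real
  proof (cases x "0::real" rule: linorder_cases)
    case less
    have "((\<lambda>x. 0) has_real_derivative (real (Suc (Suc m)) * (max 0 x) ^ Suc m)) (at x)"
      using less by simp
    then show ?thesis
      by (rule has_field_derivative_transform_within_open[where S="{..<0}"]) (use less in auto)
  next
    case equal
    have "((\<lambda>h. (max 0 h) ^ Suc (Suc m) / h) \<longlongrightarrow> 0) (at (0::real))"
    proof (rule Lim_null_comparison)
      show "\<forall>\<^sub>F h in at 0. norm ((max 0 h) ^ Suc (Suc m) / h) \<le> \<bar>h\<bar> ^ Suc m"
        unfolding eventually_at_filter
      proof (intro always_eventually allI impI)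
        fix h :: real assume h: "h \<noteq> 0"
        show "norm ((max 0 h) ^ Suc (Suc m) / h) \<le> \<bar>h\<bar> ^ Suc m"
        proof (cases "0 < h")
          case False
          then have "(max 0 h) ^ Suc (Suc m) / h = 0" by (simp add: max_absorb1)
          then show ?thesis by (simp only: norm_zero zero_le_power abs_ge_zero)
        qed (simp add: max_absorb2)
      qed
      show "((\<lambda>h. \<bar>h\<bar> ^ Suc m) \<longlongrightarrow> 0) (at (0::real))"
        by (rule tendsto_eq_intros refl | simp)+
    qed
    then show ?thesis using equal by (simp add: DERIV_def)
  next
    case greater
    have "((\<lambda>x. x ^ Suc (Suc m)) has_real_derivative (real (Suc (Suc m)) * (max 0 x) ^ Suc m)) (at x)"
      using DERIV_pow[of "Suc (Suc m)" x] greater by (simp add: max_absorb2)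
    then show ?thesis
      by (rule has_field_derivative_transform_within_open[where S="{0<..}"]) (use greater in \<open>auto simp: max_def\<close>)
  qed
  moreover have "Ck m (\<lambda>x. real (Suc (Suc m)) * (max 0 x) ^ Suc m)"
    by (intro Ck_mult Ck_const Suc)
  ultimately show ?case by (rule Ck_SucI)
qed

text \<open>The quotient \<open>s\<close> climbs from 0 (left of 0) to 1 (right of 1); its
  denominator is positive because \<open>x\<close> and \<open>1 - x\<close> are never both
  nonpositive. The cutoff is the product of two such steps, one of them reflected.\<close>

lemma Ck_cutoff:
  "\<exists>u. Ck m u \<and> (\<forall>x. \<bar>x\<bar> \<le> 1 \<longrightarrow> u x = 1) \<and> (\<forall>x. 2 < \<bar>x\<bar> \<longrightarrow> u x = 0)"
proof -
  define p where "p = (\<lambda>x::real. (max 0 x) ^ Suc m)"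
  \<comment> \<open>The reflected argument is written in the form \<open>a * x + b\<close> so that
    \<open>Ck_affine\<close> applies.\<close>
  define d where "d = (\<lambda>x. p x + p (- 1 * x + 1))"
  define s where "s = (\<lambda>x. p x * inverse (d x))"
  have p: "Ck m p" unfolding p_def by (rule Ck_pos_part_power)
  have "0 < d x" for x
  proof (cases "0 < x")
    case True
    then show ?thesis unfolding d_def p_def by (intro add_pos_nonneg) auto
  next
    case False
    then show ?thesis unfolding d_def p_def by (intro add_nonneg_pos) auto
  qed
  then have d: "d x \<noteq> 0" for x by (metis less_irrefl)
  have s: "Ck m s"
    unfolding s_def by (intro Ck_mult Ck_inverse d p) (unfold d_def, intro Ck_add Ck_affine p)
  have s1: "s x = 1" if "1 \<le> x" for x
  proof -
    have "d x = p x" using that by (simp add: d_def p_def max_def)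
    then show ?thesis using d[of x] by (simp add: s_def)
  qed
  have s0: "s x = 0" if "x \<le> 0" for x using that by (simp add: s_def p_def max_def)
  show ?thesis
  proof (intro exI[of _ "\<lambda>x. s (1 * x + 2) * s (- 1 * x + 2)"] conjI allI impI)
    show "Ck m (\<lambda>x. s (1 * x + 2) * s (- 1 * x + 2))" by (intro Ck_mult Ck_affine s)
  qed (auto simp: s1 abs_if s0 split: if_splits)
qed

section \<open>Decay of Fourier coefficients and the local expansion\<close>

lemma fourier_coeff_deriv:
  assumes D: "\<And>x. (g has_real_derivative g' x) (at x)" and g': "continuous_on UNIV g'"
    and 0: "g pi = 0" "g (- pi) = 0"
  shows "fourier_cos g' n = real n * fourier_sin g n" "fourier_sin g' n = - (real n * fourier_cos g n)"
proof -
  have g: "continuous_on {-pi..pi} g"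
    using D by (auto intro!: DERIV_isCont continuous_at_imp_continuous_on)
  have g': "continuous_on {-pi..pi} g'" using g' continuous_on_subset by blast
  have int: "f integrable_on {-pi..pi}" if "continuous_on {-pi..pi} f" for f :: "real \<Rightarrow> real"
    using integrable_continuous_interval[OF that] .
  have "((\<lambda>y. g' y * cos (real n * y) - real n * (g y * sin (real n * y))) has_integral
      (g pi * cos (real n * pi) - g (-pi) * cos (real n * (-pi)))) {-pi..pi}"
    by (intro fundamental_theorem_of_calculus)
       (auto intro!: derivative_eq_intros DERIV_subset[OF D] simp flip: has_real_derivative_iff_has_vector_derivative)
  then have "integral {-pi..pi} (\<lambda>y. g' y * cos (real n * y) - real n * (g y * sin (real n * y))) = 0"
    using 0 by (simp add: integral_unique)
  also have "integral {-pi..pi} (\<lambda>y. g' y * cos (real n * y) - real n * (g y * sin (real n * y)))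
     = integral {-pi..pi} (\<lambda>y. g' y * cos (real n * y)) - real n * integral {-pi..pi} (\<lambda>y. g y * sin (real n * y))"
    by (subst integral_diff) (auto intro!: int continuous_intros g g')
  finally show "fourier_cos g' n = real n * fourier_sin g n" by (simp add: fourier_cos_def fourier_sin_def)
  have "((\<lambda>y. g' y * sin (real n * y) + real n * (g y * cos (real n * y))) has_integral
      (g pi * sin (real n * pi) - g (-pi) * sin (real n * (-pi)))) {-pi..pi}"
    by (intro fundamental_theorem_of_calculus)
       (auto intro!: derivative_eq_intros DERIV_subset[OF D] simp flip: has_real_derivative_iff_has_vector_derivative)
  then have "integral {-pi..pi} (\<lambda>y. g' y * sin (real n * y) + real n * (g y * cos (real n * y))) = 0"
    using 0 by (simp add: integral_unique)
  also have "integral {-pi..pi} (\<lambda>y. g' y * sin (real n * y) + real n * (g y * cos (real n * y)))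
     = integral {-pi..pi} (\<lambda>y. g' y * sin (real n * y)) + real n * integral {-pi..pi} (\<lambda>y. g y * cos (real n * y))"
    by (subst integral_add) (auto intro!: int continuous_intros g g')
  finally have "integral {-pi..pi} (\<lambda>y. g' y * sin (real n * y)) = - (real n * integral {-pi..pi} (\<lambda>y. g y * cos (real n * y)))"
    by linarith
  then show "fourier_sin g' n = - (real n * fourier_cos g n)" by (simp add: fourier_cos_def fourier_sin_def)
qed

lemma derivative_outside_support:
  assumes "\<And>x. (g has_real_derivative g' x) (at x)" "\<And>x. c < \<bar>x\<bar> \<Longrightarrow> g x = 0" "c < \<bar>x\<bar>"
  shows "g' x = (0::real)"
proof -
  have "((\<lambda>x. 0) has_real_derivative g' x) (at x)"
    by (rule has_field_derivative_transform_within_open[OF assms(1), where S="{x. c < \<bar>x\<bar>}"])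
       (use assms in \<open>auto intro!: open_Collect_less continuous_intros\<close>)
  then show ?thesis using DERIV_unique DERIV_const by blast
qed

text \<open>Each integration by parts exchanges the two kinds of coefficients and gains a factor
  \<open>real n\<close>. No boundary terms arise: the support lies strictly inside the period
  because 2 < \<open>pi\<close>, and derivatives inherit it. The multiplicative form also makes
  sense at frequency 0.\<close>

lemma fourier_coeff_decay:
  assumes "Ck m g" "\<And>x. 2 < \<bar>x\<bar> \<Longrightarrow> g x = 0"
  shows "\<exists>C. \<forall>n. real n ^ m * \<bar>fourier_cos g n\<bar> \<le> C \<and> real n ^ m * \<bar>fourier_sin g n\<bar> \<le> C"
  using assms
proof (induction m arbitrary: g)
  case 0
  then have g: "continuous_on {-pi..pi} g" by (auto intro: continuous_on_subset)
  have "\<bar>integral {-pi..pi} (\<lambda>y. g y * w (real n * y))\<bar> / pi \<le> integral {-pi..pi} (\<lambda>y. \<bar>g y\<bar>) / pi"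
    if w: "continuous_on UNIV w" "\<And>t. \<bar>w t\<bar> \<le> 1" for w :: "real \<Rightarrow> real" and n
  proof (intro divide_right_mono)
    have "continuous_on {-pi..pi} (\<lambda>y. w (real n * y))"
      by (rule continuous_on_compose2[OF w(1)]) (auto intro!: continuous_intros)
    then have "norm (integral {-pi..pi} (\<lambda>y. g y * w (real n * y))) \<le> integral {-pi..pi} (\<lambda>y. \<bar>g y\<bar>)"
      using w(2) by (intro integral_norm_bound_integral integrable_continuous_interval continuous_intros g)
        (auto simp: abs_mult mult_left_le)
    then show "\<bar>integral {-pi..pi} (\<lambda>y. g y * w (real n * y))\<bar> \<le> integral {-pi..pi} (\<lambda>y. \<bar>g y\<bar>)" by simp
  qed simp
  from this[of cos] this[of sin] show ?case
    by (intro exI[of _ "integral {-pi..pi} (\<lambda>y. \<bar>g y\<bar>) / pi"])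
       (auto simp: fourier_cos_def fourier_sin_def continuous_on_cos continuous_on_sin continuous_on_id)
next
  case (Suc m)
  then obtain g' where d: "\<And>x. (g has_real_derivative g' x) (at x)" "Ck m g'" by auto
  have g'0: "g' x = 0" if "2 < \<bar>x\<bar>" for x
    using derivative_outside_support[OF d(1) Suc.prems(2) that] by auto
  have 0: "g pi = 0" "g (-pi) = 0" using Suc.prems(2)[of pi] Suc.prems(2)[of "-pi"] pi_gt3 by auto
  obtain C where C: "\<And>n. real n ^ m * \<bar>fourier_cos g' n\<bar> \<le> C" "\<And>n. real n ^ m * \<bar>fourier_sin g' n\<bar> \<le> C"
    using Suc.IH[OF d(2) g'0] by auto
  have "real n ^ Suc m * \<bar>fourier_cos g n\<bar> \<le> C \<and> real n ^ Suc m * \<bar>fourier_sin g n\<bar> \<le> C" for n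
    using C[of n] unfolding fourier_coeff_deriv[OF d(1) Ck_continuous[OF d(2)] 0] by (simp add: abs_mult mult_ac)
  then show ?case by blast
qed

text \<open>The convergence theorem is applied to a rescaled and cut off copy of \<open>f\<close>,
  which is unchanged on the unit interval around 0. The series for \<open>deriv f\<close> is not
  differentiated termwise: it is the Fourier series of \<open>g'\<close>, to which the theorem is
  applied a second time. This is why \<open>g'\<close> has to be differentiable as well, hence
  \<open>2 \<le> m\<close>.\<close>

lemma local_trigonometric_expansion:
  assumes f: "Ck m f" and m: "2 \<le> m" and K: "0 < K"
  shows "\<exists>a b C. (\<forall>n. real n ^ m * \<bar>a n\<bar> \<le> C \<and> real n ^ m * \<bar>b n\<bar> \<le> C) \<and>
    (\<forall>x. \<bar>x\<bar> < K \<longrightarrow>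
      (\<lambda>n. a n * cos (real n / K * x) + b n * sin (real n / K * x)) sums f x \<and>
      (\<lambda>n. real n / K * (b n * cos (real n / K * x) - a n * sin (real n / K * x))) sums deriv f x)"
proof -
  obtain u where u: "Ck m u" "\<And>x. \<bar>x\<bar> \<le> 1 \<Longrightarrow> u x = 1" "\<And>x. 2 < \<bar>x\<bar> \<Longrightarrow> u x = 0"
    using Ck_cutoff[of m] by auto
  define g where "g = (\<lambda>x. f (K * x + 0) * u x)"
  have g: "Ck m g" unfolding g_def by (intro Ck_mult Ck_affine f u)
  have gs: "g x = 0" if "2 < \<bar>x\<bar>" for x using u(3)[OF that] by (simp add: g_def)
  have "Ck (Suc (Suc 0)) g" using g m Ck_mono[of m g 2] by (simp add: numeral_2_eq_2 del: Ck.simps)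
  then obtain g' g'' where d: "\<And>x. (g has_real_derivative g' x) (at x)" "\<And>x. (g' has_real_derivative g'' x) (at x)"
    by auto
  have cont: "continuous_on {-pi..pi} g" "continuous_on {-pi..pi} g'" "continuous_on UNIV g'"
    using d by (auto intro!: DERIV_isCont continuous_at_imp_continuous_on)
  have 0: "g pi = 0" "g (-pi) = 0" using gs[of pi] gs[of "-pi"] pi_gt3 by auto
  note coeff = fourier_coeff_deriv[OF d(1) cont(3) 0]
  have f1: "(f has_real_derivative deriv f x) (at x)" for x
  proof -
    have "Ck (Suc 0) f" using Ck_mono[OF f] m by (simp del: Ck.simps)
    then obtain f' where "(f has_real_derivative f' x) (at x)" by auto
    then show ?thesis by (simp add: DERIV_imp_deriv)
  qed
  \<comment> \<open>The halved constant term of the Fourier series is absorbed into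
    \<open>a 0\<close>.\<close>
  define a where "a = (\<lambda>n. if n = 0 then fourier_cos g 0 / 2 else fourier_cos g n)"
  define b where "b = fourier_sin g"
  have b0: "b 0 = 0" by (simp add: b_def fourier_sin_def)
  have split: "(\<Sum>n=0..N. v n) = v 0 + (\<Sum>n=1..N. v n)" for v :: "nat \<Rightarrow> real" and N
    by (simp add: sum.atLeast_Suc_atMost)
  have series: "(\<lambda>n. a n * cos (real n / K * x) + b n * sin (real n / K * x)) sums f x \<and>
      (\<lambda>n. real n / K * (b n * cos (real n / K * x) - a n * sin (real n / K * x))) sums deriv f x"
    if x: "\<bar>x\<bar> < K" for x
  proof
    define y where "y = x / K"
    have "\<bar>y\<bar> < 1" using x K by (simp add: y_def abs_divide)
    then have y: "\<bar>y\<bar> < 1" "\<bar>y\<bar> < pi" using pi_gt3 by linarith+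
    have e: "real n / K * x = real n * y" for n by (simp add: y_def)
    have gy: "g y = f x" using y K by (simp add: g_def u(2) y_def)
    show "(\<lambda>n. a n * cos (real n / K * x) + b n * sin (real n / K * x)) sums f x"
      using fourier_series_converges[OF cont(1) d(1) y(2)]
      unfolding sums_def' e split gy by (simp add: a_def b_def cong: sum.cong_simp)
    have "((\<lambda>y. f (K * y)) has_real_derivative (deriv f (K * y) * K)) (at y)"
      by (intro DERIV_chain2[OF f1]) (auto intro!: derivative_eq_intros)
    then have "(g has_real_derivative (deriv f (K * y) * K)) (at y)"
      by (rule has_field_derivative_transform_within_open[where S="{-1<..<1}"])
         (use y in \<open>auto simp: g_def u(2)\<close>)
    then have g'y: "g' y = deriv f x * K" using DERIV_unique[OF d(1)] K by (simp add: y_def)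
    \<comment> \<open>The constant term of this series is 0, because \<open>coeff\<close> at
      frequency 0 carries the factor 0.\<close>
    have "(\<lambda>N. (\<Sum>n=1..N. fourier_cos g' n * cos (real n * y) + fourier_sin g' n * sin (real n * y))) \<longlonglongrightarrow> deriv f x * K"
      using fourier_series_converges[OF cont(2) d(2) y(2)] unfolding g'y by (simp add: coeff(1)[of 0])
    then have "(\<lambda>N. (\<Sum>n=1..N. fourier_cos g' n * cos (real n * y) + fourier_sin g' n * sin (real n * y)) / K) \<longlonglongrightarrow> deriv f x * K / K"
      using K by (intro tendsto_divide tendsto_const) auto
    moreover have "(\<Sum>n=1..N. fourier_cos g' n * cos (real n * y) + fourier_sin g' n * sin (real n * y)) / K
      = (\<Sum>n=1..N. real n / K * (b n * cos (real n * y) - a n * sin (real n * y)))" for N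
      unfolding sum_divide_distrib coeff
      by (intro sum.cong refl) (auto simp: a_def b_def field_simps)
    ultimately show "(\<lambda>n. real n / K * (b n * cos (real n / K * x) - a n * sin (real n / K * x))) sums deriv f x"
      unfolding sums_def' e split using K by simp
  qed
  obtain C where C: "\<And>n. real n ^ m * \<bar>fourier_cos g n\<bar> \<le> C" "\<And>n. real n ^ m * \<bar>fourier_sin g n\<bar> \<le> C"
    using fourier_coeff_decay[OF g gs] by auto
  have C0: "0 \<le> C" by (rule order_trans[OF _ C(1)[of 1]]) simp
  have "real n ^ m * \<bar>a n\<bar> \<le> C \<and> real n ^ m * \<bar>b n\<bar> \<le> C" for n
    using C[of n] m C0 by (auto simp: a_def b_def)
  with series show ?thesis by blast
qed

lemma continuously_differentiable_Ck: "continuously_differentiable m f \<Longrightarrow> Ck m f"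
proof (induction m arbitrary: f)
  case 0
  then show ?case by (simp add: continuously_differentiable_def)
next
  case (Suc m)
  have "(f has_real_derivative deriv f x) (at x)" for x
    using Suc.prems by (auto simp: continuously_differentiable_def real_differentiable_def DERIV_imp_deriv
      dest!: spec[of _ 0] spec[of _ x])
  moreover have "continuously_differentiable m (deriv f)"
  proof -
    have e: "(deriv ^^ i) (deriv f) = (deriv ^^ Suc i) f" for i
      by (simp add: funpow_Suc_right del: funpow.simps)
    show ?thesis using Suc.prems unfolding continuously_differentiable_def e by auto
  qed
  ultimately show ?case using Suc.IH by auto
qed

section \<open>The covariance of two sines of correlated Gaussians\<close>

lemma abs_sinh_le: "\<bar>sinh z\<bar> \<le> \<bar>z\<bar> * cosh (z::real)"
proof -
  have *: "sinh z \<le> z * cosh z" if "0 \<le> z" for z :: real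
  proof -
    have "(\<lambda>z. z * cosh z - sinh z) 0 \<le> (\<lambda>z. z * cosh z - sinh z) z"
      by (rule DERIV_nonneg_imp_nondecreasing[OF that])
         (auto intro!: derivative_eq_intros exI mult_nonneg_nonneg)
    then show ?thesis by simp
  qed
  show ?thesis using *[of z] *[of "-z"] by (cases "0 \<le> z") (auto simp: abs_if)
qed

lemma abs_mult_cosh_minus_sinh_le: "\<bar>z * cosh z - sinh z\<bar> \<le> \<bar>z\<bar>^3 * cosh (z::real)"
proof -
  have *: "z * cosh z - sinh z \<le> z^3 * cosh z \<and> 0 \<le> z * cosh z - sinh z" if "0 \<le> z" for z :: real
  proof 
    have "(\<lambda>z. z^3 * cosh z - (z * cosh z - sinh z)) 0 \<le> (\<lambda>z. z^3 * cosh z - (z * cosh z - sinh z)) z"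
    proof (rule DERIV_nonneg_imp_nondecreasing[OF that], intro exI conjI)
      fix t :: real assume t: "0 \<le> t"
      show "((\<lambda>z. z^3 * cosh z - (z * cosh z - sinh z)) has_real_derivative
          3 * t^2 * cosh t + t^3 * sinh t - t * sinh t) (at t)"
        by (auto intro!: derivative_eq_intros)
      have "t * sinh t \<le> t * (t * cosh t)" using abs_sinh_le[of t] t
        by (intro mult_left_mono) auto
      also have "\<dots> \<le> 3 * t^2 * cosh t"
        using mult_nonneg_nonneg[of "t^2" "cosh t"] by (simp add: power2_eq_square algebra_simps)
      finally show "0 \<le> 3 * t^2 * cosh t + t^3 * sinh t - t * sinh t"
        using mult_nonneg_nonneg[OF zero_le_power[OF t, of 3] sinh_real_nonneg_iff[THEN iffD2, OF t]] by linarith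
    qed
    then show "z * cosh z - sinh z \<le> z^3 * cosh z" by simp
    show "0 \<le> z * cosh z - sinh z" using abs_sinh_le[of z] that by auto
  qed
  show ?thesis using *[of z] *[of "-z"] by (cases "0 \<le> z") (auto simp: abs_if)
qed

lemma cosh_le_2: "\<bar>z\<bar> \<le> 1/4 \<Longrightarrow> cosh (z::real) \<le> 2"
proof -
  assume z: "\<bar>z\<bar> \<le> 1/4"
  have "exp w \<le> 2" if "\<bar>w\<bar> \<le> 1/4" for w :: real
  proof -
    have "exp w \<le> exp (1/4)" using that by simp
    also have "exp (1/4::real) \<le> 1 + 1/4 + (1/4)^2" by (rule exp_bound) auto
    also have "\<dots> \<le> 2" by (simp add: power2_eq_square)
    finally show ?thesis .
  qed
  from this[of z] this[of "-z"] z show ?thesis by (simp add: cosh_field_def)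
qed

text \<open>For a centered Gaussian vector \<open>(U, X, Y)\<close> with \<open>E X\<^sup>2 = E Y\<^sup>2 = v\<close>, \<open>a = l E (U X)\<close>, \<open>b = l E (U Y)\<close>
  and \<open>c = E (X Y)\<close>, this is \<open>E (cos (l U) sin (x X) sin (y Y))\<close> up to the factor \<open>exp (- l\<^sup>2 E U\<^sup>2 / 2)\<close>.\<close>

definition sine_cov :: "real \<Rightarrow> real \<Rightarrow> real \<Rightarrow> real \<Rightarrow> real \<Rightarrow> real \<Rightarrow> real" where
  "sine_cov v a b c x y = exp (- ((x^2 + y^2) * v / 2)) *
     (cosh (a*x) * cosh (b*y) * sinh (c*x*y) - sinh (a*x) * sinh (b*y) * cosh (c*x*y))"

text \<open>The derivative of \<open>sine_cov\<close> in \<open>y\<close>. Under the expectation it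
  replaces \<open>sin (y Y)\<close> by \<open>Y cos (y Y)\<close>.\<close>

definition sine_cov_y :: "real \<Rightarrow> real \<Rightarrow> real \<Rightarrow> real \<Rightarrow> real \<Rightarrow> real \<Rightarrow> real" where
  "sine_cov_y v a b c x y = exp (- ((x^2 + y^2) * v / 2)) *
     (- y * v * (cosh (a*x) * cosh (b*y) * sinh (c*x*y) - sinh (a*x) * sinh (b*y) * cosh (c*x*y))
      + b * cosh (a*x) * sinh (b*y) * sinh (c*x*y) + c * x * cosh (a*x) * cosh (b*y) * cosh (c*x*y)
      - b * sinh (a*x) * cosh (b*y) * cosh (c*x*y) - c * x * sinh (a*x) * sinh (b*y) * sinh (c*x*y))"

text \<open>The mixed second derivative of \<open>sine_cov\<close>, in which both sines have been
  replaced.\<close>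

definition sine_cov_xy :: "real \<Rightarrow> real \<Rightarrow> real \<Rightarrow> real \<Rightarrow> real \<Rightarrow> real \<Rightarrow> real" where
  "sine_cov_xy v a b c x y = exp (- ((x^2 + y^2) * v / 2)) *
     (- x * v * (- y * v * (cosh (a*x) * cosh (b*y) * sinh (c*x*y) - sinh (a*x) * sinh (b*y) * cosh (c*x*y))
      + b * cosh (a*x) * sinh (b*y) * sinh (c*x*y) + c * x * cosh (a*x) * cosh (b*y) * cosh (c*x*y)
      - b * sinh (a*x) * cosh (b*y) * cosh (c*x*y) - c * x * sinh (a*x) * sinh (b*y) * sinh (c*x*y))
      - y * v * (a * sinh (a*x) * cosh (b*y) * sinh (c*x*y) + c * y * cosh (a*x) * cosh (b*y) * cosh (c*x*y)
         - a * cosh (a*x) * sinh (b*y) * cosh (c*x*y) - c * y * sinh (a*x) * sinh (b*y) * sinh (c*x*y))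
      + a * b * sinh (a*x) * sinh (b*y) * sinh (c*x*y) + b * c * y * cosh (a*x) * sinh (b*y) * cosh (c*x*y)
      + c * cosh (a*x) * cosh (b*y) * cosh (c*x*y) + c * x * a * sinh (a*x) * cosh (b*y) * cosh (c*x*y)
      + c * x * c * y * cosh (a*x) * cosh (b*y) * sinh (c*x*y)
      - a * b * cosh (a*x) * cosh (b*y) * cosh (c*x*y) - b * c * y * sinh (a*x) * cosh (b*y) * sinh (c*x*y)
      - c * sinh (a*x) * sinh (b*y) * sinh (c*x*y) - c * x * a * cosh (a*x) * sinh (b*y) * sinh (c*x*y)
      - c * x * c * y * sinh (a*x) * sinh (b*y) * cosh (c*x*y))"

lemma DERIV_sgen_y: "((\<lambda>y. sine_cov v a b c x y) has_real_derivative sine_cov_y v a b c x y) (at y)"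
  unfolding sine_cov_def sine_cov_y_def
  by (rule derivative_eq_intros refl | simp)+ (simp add: algebra_simps)

lemma DERIV_sgen_xy: "((\<lambda>x. sine_cov_y v a b c x y) has_real_derivative sine_cov_xy v a b c x y) (at x)"
  unfolding sine_cov_y_def sine_cov_xy_def
  by (rule derivative_eq_intros refl | simp)+ (simp add: algebra_simps)

text \<open>The operator \<open>(x \<partial>\<^sub>x - 1) (y \<partial>\<^sub>y - 1)\<close> turns \<open>sin (x X) sin (y Y)\<close> into the product of the defects
  \<open>x X cos (x X) - sin (x X)\<close> and \<open>y Y cos (y Y) - sin (y Y)\<close>. The result is grouped so that each term
  is visibly of the order of \<open>c\<close> or of \<open>a b\<close>, times two further small factors.\<close>

lemma sine_cov_combination:
  fixes a b c v x y :: real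
  defines "A \<equiv> - (x^2 * v) * cosh (a*x) + a*x * sinh (a*x)"
    and "B \<equiv> - (y^2 * v) * cosh (b*y) + b*y * sinh (b*y)"
    and "A' \<equiv> - (x^2 * v) * sinh (a*x) + (a*x * cosh (a*x) - sinh (a*x))"
    and "B' \<equiv> - (y^2 * v) * sinh (b*y) + (b*y * cosh (b*y) - sinh (b*y))"
    and "r \<equiv> c*x*y"
  shows "x * y * sine_cov_xy v a b c x y - x * sine_cov_y v b a c y x - y * sine_cov_y v a b c x y + sine_cov v a b c x y
    = exp (- ((x^2 + y^2) * v / 2)) *
      ((A * B * sinh r + (A * cosh (b*y) + cosh (a*x) * B) * (r * cosh r - sinh r)
         + cosh (a*x) * cosh (b*y) * (r^2 * sinh r - (r * cosh r - sinh r)))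
       - (A' * B' * cosh r + (A' * sinh (b*y) + sinh (a*x) * B') * (r * sinh r)
         + sinh (a*x) * sinh (b*y) * (r * sinh r + r^2 * cosh r)))"
proof -
  \<comment> \<open>The derivative in \<open>x\<close> enters as \<open>sine_cov_y\<close> with the
    two variables exchanged; these identities undo the exchange in the arguments.\<close>
  have e: "c * y * x = r" "c * x * y = r" "y^2 + x^2 = x^2 + y^2" unfolding r_def by auto
  show ?thesis
    unfolding sine_cov_def sine_cov_xy_def sine_cov_y_def e A_def B_def A'_def B'_def
    unfolding r_def
    by (simp add: algebra_simps power2_eq_square)
qed


lemma abs_triple_le:
  fixes p q k :: real
  shows "\<bar>a * b * s + (a * q + p * b) * d + p * q * e\<bar>
    \<le> \<bar>a\<bar> * \<bar>b\<bar> * \<bar>s\<bar> + (\<bar>a\<bar> * \<bar>q\<bar> + \<bar>p\<bar> * \<bar>b\<bar>) * \<bar>d\<bar> + \<bar>p\<bar> * \<bar>q\<bar> * \<bar>e\<bar>"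
proof -
  have "\<bar>a * q + p * b\<bar> * \<bar>d\<bar> \<le> (\<bar>a * q\<bar> + \<bar>p * b\<bar>) * \<bar>d\<bar>"
    by (intro mult_right_mono abs_triangle_ineq) simp
  then show ?thesis
    using abs_triangle_ineq[of "a * b * s + (a * q + p * b) * d" "p * q * e"]
      abs_triangle_ineq[of "a * b * s" "(a * q + p * b) * d"]
    unfolding abs_mult by linarith
qed

text \<open>In terms of \<open>w = x^2 * v\<close> all hyperbolic arguments are at most
  \<open>w \<le> 1/4\<close>, so each \<open>cosh\<close> is at most 2 and only orders of vanishing
  matter. Every term of \<open>?T1\<close> contains \<open>c\<close>, every term of
  \<open>?T2\<close> contains both \<open>a\<close> and \<open>b\<close>, and in either case a
  factor \<open>w^2\<close> is left. The constant 64 disappears when \<open>x\<close> is specialised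
  to \<open>l / 2\<close>.\<close>

lemma sine_cov_combination_bound:
  fixes a b c v x :: real
  assumes v: "0 \<le> v" "x^2 * v \<le> 1/4" and a: "\<bar>a\<bar> \<le> \<bar>x\<bar> * v" and b: "\<bar>b\<bar> \<le> \<bar>x\<bar> * v" and c: "\<bar>c\<bar> \<le> v"
  shows "\<bar>x * x * sine_cov_xy v a b c x x - x * sine_cov_y v b a c x x - x * sine_cov_y v a b c x x + sine_cov v a b c x x\<bar>
    \<le> 64 * x^6 * v^2 * (\<bar>c\<bar> + \<bar>a * b\<bar>)"
proof -
  define w where "w = x^2 * v"
  have w: "0 \<le> w" "w \<le> 1/4" using v by (auto simp: w_def)
  define r where "r = c*x*x"
  have arg: "\<bar>a' * x\<bar> \<le> w" if "\<bar>a'\<bar> \<le> \<bar>x\<bar> * v" for a'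
    using mult_right_mono[OF that, of "\<bar>x\<bar>"] by (simp add: w_def abs_mult power2_eq_square mult.commute mult.left_commute)
  have r: "\<bar>r\<bar> \<le> w" "\<bar>r\<bar> \<le> 1/4"
    using mult_right_mono[OF c, of "x^2"] w unfolding r_def w_def
    by (auto simp: abs_mult power2_eq_square mult_ac)
  have bd: "\<bar>sinh z\<bar> \<le> 2 * \<bar>z\<bar>" "\<bar>z * cosh z - sinh z\<bar> \<le> 2 * \<bar>z\<bar>^3" "\<bar>cosh z\<bar> \<le> 2"
    if "\<bar>z\<bar> \<le> w" for z :: real
  proof -
    have C: "cosh z \<le> 2" using that w by (intro cosh_le_2) auto
    show "\<bar>sinh z\<bar> \<le> 2 * \<bar>z\<bar>" using abs_sinh_le[of z] mult_left_mono[OF C, of "\<bar>z\<bar>"] by simp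
    show "\<bar>z * cosh z - sinh z\<bar> \<le> 2 * \<bar>z\<bar>^3"
      using abs_mult_cosh_minus_sinh_le[of z] mult_left_mono[OF C, of "\<bar>z\<bar>^3"] by simp
    show "\<bar>cosh z\<bar> \<le> 2" using C by (simp add: cosh_real_nonneg)
  qed
  define A where "A = (\<lambda>z. - w * cosh z + z * sinh z)"
  define A' where "A' = (\<lambda>z. - w * sinh z + (z * cosh z - sinh z))"
  \<comment> \<open>The extra factor \<open>\<bar>z\<bar>\<close> for \<open>A'\<close> is available
    because \<open>z * cosh z - sinh z\<close> is of third order and
    \<open>\<bar>z\<bar> * \<bar>z\<bar> \<le> w / 4\<close>.\<close>
  have A: "\<bar>A z\<bar> \<le> 4 * w" and A': "\<bar>A' z\<bar> \<le> 4 * w * \<bar>z\<bar>" if z: "\<bar>z\<bar> \<le> w" for z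
  proof -
    have zz: "\<bar>z\<bar> * \<bar>z\<bar> \<le> w * (1/4)" using z w by (intro mult_mono) auto
    have "\<bar>A z\<bar> \<le> w * \<bar>cosh z\<bar> + \<bar>z\<bar> * \<bar>sinh z\<bar>"
      unfolding A_def using abs_triangle_ineq[of "- w * cosh z" "z * sinh z"] w by (simp add: abs_mult)
    also have "\<dots> \<le> w * 2 + \<bar>z\<bar> * (2 * \<bar>z\<bar>)"
      using bd[OF z] w by (intro add_mono mult_left_mono) auto
    also have "\<dots> \<le> 4 * w" using zz w by simp
    finally show "\<bar>A z\<bar> \<le> 4 * w" .
    have "\<bar>A' z\<bar> \<le> w * \<bar>sinh z\<bar> + \<bar>z * cosh z - sinh z\<bar>"
      unfolding A'_def using abs_triangle_ineq[of "- w * sinh z" "z * cosh z - sinh z"] w by (simp add: abs_mult)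
    also have "\<dots> \<le> w * (2 * \<bar>z\<bar>) + 2 * \<bar>z\<bar>^3"
      using bd[OF z] w by (intro add_mono mult_left_mono) auto
    also have "\<bar>z\<bar>^3 = \<bar>z\<bar> * \<bar>z\<bar> * \<bar>z\<bar>" by (simp add: power3_eq_cube)
    also have "w * (2 * \<bar>z\<bar>) + 2 * (\<bar>z\<bar> * \<bar>z\<bar> * \<bar>z\<bar>) \<le> w * (2 * \<bar>z\<bar>) + 2 * (w * (1/4) * \<bar>z\<bar>)"
      using zz by (intro add_left_mono mult_left_mono mult_right_mono) auto
    also have "\<dots> \<le> 4 * w * \<bar>z\<bar>" using w by (simp add: mult_right_mono)
    finally show "\<bar>A' z\<bar> \<le> 4 * w * \<bar>z\<bar>" .
  qed
  let ?p = "a * x" and ?q = "b * x"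
  have p: "\<bar>?p\<bar> \<le> w" and q: "\<bar>?q\<bar> \<le> w" using arg a b by auto
  define E where "E = exp (- ((x^2 + x^2) * v / 2))"
  have E: "0 \<le> E" "E \<le> 1" using v by (auto simp: E_def)
  define R where "R = \<bar>r\<bar>"
  have R: "0 \<le> R" "R \<le> w" using r by (auto simp: R_def)
  have RR: "R * R \<le> w * w" using R w by (intro mult_mono) auto
  define PQ where "PQ = \<bar>?p\<bar> * \<bar>?q\<bar>"
  have PQ: "0 \<le> PQ" by (simp add: PQ_def)
  have r3: "\<bar>r\<bar>^3 \<le> w * w * R"
    using mult_right_mono[OF RR R(1)] by (simp add: R_def power3_eq_cube)
  have w4: "w * z \<le> z / 4" if "0 \<le> z" for z using mult_right_mono[OF w(2) that] by simp
  let ?T1 = "A ?p * A ?q * sinh r + (A ?p * cosh ?q + cosh ?p * A ?q) * (r * cosh r - sinh r)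
         + cosh ?p * cosh ?q * (r^2 * sinh r - (r * cosh r - sinh r))"
  let ?T2 = "A' ?p * A' ?q * cosh r + (A' ?p * sinh ?q + sinh ?p * A' ?q) * (r * sinh r)
         + sinh ?p * sinh ?q * (r * sinh r + r^2 * cosh r)"
  have 1: "\<bar>?T1\<bar> \<le> 64 * w^2 * R"
  proof -
    have e: "\<bar>r^2 * sinh r - (r * cosh r - sinh r)\<bar> \<le> (w*w) * (2 * R) + 2 * (w*w*R)"
    proof -
      have "\<bar>r^2 * sinh r\<bar> \<le> (w*w) * (2*R)" unfolding abs_mult using bd(1)[OF r(1)] RR
        by (intro mult_mono) (auto simp: R_def power2_eq_square)
      then show ?thesis using bd(2)[OF r(1)] r3 abs_triangle_ineq4[of "r^2 * sinh r" "r * cosh r - sinh r"] by linarith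
    qed
    have d: "\<bar>r * cosh r - sinh r\<bar> \<le> 2 * (w*w*R)" using bd(2)[OF r(1)] r3 by linarith
    have s: "\<bar>sinh r\<bar> \<le> 2 * R" using bd(1)[OF r(1)] by (simp add: R_def)
    have "\<bar>?T1\<bar> \<le> \<bar>A ?p\<bar> * \<bar>A ?q\<bar> * \<bar>sinh r\<bar>
        + (\<bar>A ?p\<bar> * \<bar>cosh ?q\<bar> + \<bar>cosh ?p\<bar> * \<bar>A ?q\<bar>) * \<bar>r * cosh r - sinh r\<bar>
        + \<bar>cosh ?p\<bar> * \<bar>cosh ?q\<bar> * \<bar>r^2 * sinh r - (r * cosh r - sinh r)\<bar>"
      by (rule abs_triple_le)
    also have "\<dots> \<le> (4*w) * (4*w) * (2*R) + ((4*w)*2 + 2*(4*w)) * (2 * (w*w*R)) + 2 * 2 * ((w*w) * (2 * R) + 2 * (w*w*R))"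
      by (intro add_mono mult_mono' A[OF p] A[OF q] bd(3)[OF p] bd(3)[OF q] d e s; simp)
    \<comment> \<open>The middle term is smaller by another factor \<open>w \<le> 1/4\<close>, so 48
      + 32/4 is what has to fit below 64.\<close>
    also have "\<dots> = 48 * w^2 * R + 32 * (w * (w^2 * R))" by (simp add: power2_eq_square)
    also have "\<dots> \<le> 64 * w^2 * R" using w4[of "w^2 * R"] mult_nonneg_nonneg[OF zero_le_power2[of w] R(1)] by linarith
    finally show ?thesis .
  qed
  have 2: "\<bar>?T2\<bar> \<le> 64 * w^2 * PQ"
  proof -
    have d: "\<bar>r * sinh r\<bar> \<le> R * (2*R)"
      unfolding abs_mult using bd(1)[OF r(1)] by (intro mult_mono) (auto simp: R_def)
    have e: "\<bar>r * sinh r + r^2 * cosh r\<bar> \<le> R * (2*R) + R^2 * 2"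
    proof -
      have "\<bar>r^2 * cosh r\<bar> \<le> R^2 * 2" unfolding abs_mult using bd(3)[OF r(1)]
        by (intro mult_mono) (auto simp: R_def)
      then show ?thesis using d abs_triangle_ineq[of "r * sinh r" "r^2 * cosh r"] by linarith
    qed
    have "\<bar>?T2\<bar> \<le> \<bar>A' ?p\<bar> * \<bar>A' ?q\<bar> * \<bar>cosh r\<bar>
        + (\<bar>A' ?p\<bar> * \<bar>sinh ?q\<bar> + \<bar>sinh ?p\<bar> * \<bar>A' ?q\<bar>) * \<bar>r * sinh r\<bar>
        + \<bar>sinh ?p\<bar> * \<bar>sinh ?q\<bar> * \<bar>r * sinh r + r^2 * cosh r\<bar>"
      by (rule abs_triple_le)
    also have "\<dots> \<le> (4*w*\<bar>?p\<bar>) * (4*w*\<bar>?q\<bar>) * 2 + ((4*w*\<bar>?p\<bar>)*(2*\<bar>?q\<bar>) + (2*\<bar>?p\<bar>)*(4*w*\<bar>?q\<bar>)) * (R * (2*R))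
        + (2*\<bar>?p\<bar>) * (2*\<bar>?q\<bar>) * (R * (2*R) + R^2 * 2)"
      by (intro add_mono mult_mono' A'[OF p] A'[OF q] bd(1)[OF p] bd(1)[OF q] bd(3)[OF r(1)] d e; simp)
    also have "\<dots> = 32 * w^2 * PQ + 32 * (w * (PQ * (R * R))) + 16 * (PQ * (R * R))"
      by (simp add: power2_eq_square PQ_def algebra_simps)
    also have "\<dots> \<le> 32 * w^2 * PQ + 24 * (PQ * (R * R))" using w4[of "PQ * (R*R)"] mult_nonneg_nonneg[OF PQ mult_nonneg_nonneg[OF R(1) R(1)]] by linarith
    also have "\<dots> \<le> 32 * w^2 * PQ + 24 * (PQ * (w * w))" using RR PQ by (intro add_left_mono mult_left_mono) auto
    also have "\<dots> \<le> 64 * w^2 * PQ" using PQ by (simp add: power2_eq_square algebra_simps zero_le_mult_iff)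
    finally show ?thesis .
  qed
  have "x * x * sine_cov_xy v a b c x x - x * sine_cov_y v b a c x x - x * sine_cov_y v a b c x x + sine_cov v a b c x x
     = E * (?T1 - ?T2)"
    using sine_cov_combination[of x x v a b c] unfolding A_def A'_def w_def r_def E_def .
  also have "\<bar>E * (?T1 - ?T2)\<bar> \<le> 1 * (64 * w^2 * R + 64 * w^2 * PQ)"
    unfolding abs_mult using E 1 2 by (intro mult_mono order_trans[OF abs_triangle_ineq4] add_mono) auto
  also have "\<dots> = 64 * x^6 * v^2 * (\<bar>c\<bar> + \<bar>a * b\<bar>)"
    by (simp add: w_def R_def PQ_def r_def abs_mult power_mult_distrib algebra_simps)
       (simp add: eval_nat_numeral algebra_simps abs_mult_self_eq flip: abs_mult)
  finally show ?thesis .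
qed

section \<open>Centered Gaussian variables and differentiation of expectations\<close>

text \<open>Indexed by the variance and including variance 0, so that the formulas for moments and
  for the expectation of \<open>cos\<close> also cover degenerate combinations, such as the
  difference of a midpoint with itself.\<close>

definition centered_gaussian :: "'a measure \<Rightarrow> ('a \<Rightarrow> real) \<Rightarrow> real \<Rightarrow> bool" where
  "centered_gaussian M X v \<longleftrightarrow>
     (v > 0 \<and> distributed M lborel X (normal_density 0 (sqrt v))) \<or>
     (v = 0 \<and> X \<in> borel_measurable M \<and> (AE \<omega> in M. X \<omega> = 0))"

context prob_space
begin

lemma centered_gaussian_measurable:
  "centered_gaussian M X v \<Longrightarrow> X \<in> borel_measurable M"
  unfolding centered_gaussian_def by (auto dest: distributed_measurable)

lemma centered_gaussian_nonneg: "centered_gaussian M X v \<Longrightarrow> 0 \<le> v"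
  unfolding centered_gaussian_def by auto

lemma centered_gaussian_standardize:
  assumes "centered_gaussian M X v" "v > 0"
  shows "(\<lambda>\<omega>. X \<omega> / sqrt v) \<in> borel_measurable M"
    "distr M lborel (\<lambda>\<omega>. X \<omega> / sqrt v) = std_normal_distribution"
proof -
  have "distributed M lborel X (normal_density 0 (sqrt v))"
    using assms by (auto simp: centered_gaussian_def)
  then have "distributed M lborel (\<lambda>\<omega>. X \<omega> / sqrt v) std_normal_density"
    using assms(2) normal_standard_normal_convert[of "sqrt v" X 0] by simp
  then show "(\<lambda>\<omega>. X \<omega> / sqrt v) \<in> borel_measurable M"
    "distr M lborel (\<lambda>\<omega>. X \<omega> / sqrt v) = std_normal_distribution"
    by (auto simp: distributed_def)
qed

lemma centered_gaussian_integral: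
  assumes "centered_gaussian M X v" "v > 0" and [measurable]: "g \<in> borel_measurable borel"
  shows "integrable M (\<lambda>\<omega>. g (X \<omega>) :: 'b :: {banach, second_countable_topology})
      \<longleftrightarrow> integrable std_normal_distribution (\<lambda>z. g (sqrt v * z))"
    and "integral\<^sup>L M (\<lambda>\<omega>. g (X \<omega>)) = integral\<^sup>L std_normal_distribution (\<lambda>z. g (sqrt v * z))"
proof -
  note Z [measurable] = centered_gaussian_standardize[OF assms(1,2)]
  have [measurable]: "(\<lambda>\<omega>. X \<omega> / sqrt v) \<in> measurable M lborel" using Z(1) by simp
  have [measurable]: "(\<lambda>z. g (sqrt v * z)) \<in> borel_measurable lborel" by simp
  show "integrable M (\<lambda>\<omega>. g (X \<omega>)) \<longleftrightarrow> integrable std_normal_distribution (\<lambda>z. g (sqrt v * z))"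
    unfolding Z(2)[symmetric] by (subst integrable_distr_eq) (use assms(2) in auto)
  show "integral\<^sup>L M (\<lambda>\<omega>. g (X \<omega>)) = integral\<^sup>L std_normal_distribution (\<lambda>z. g (sqrt v * z))"
    unfolding Z(2)[symmetric] by (subst integral_distr) (use assms(2) in auto)
qed

lemma centered_gaussian_moments:
  assumes "centered_gaussian M X v"
  shows "integrable M (\<lambda>\<omega>. X \<omega> ^ k)"
    and "integral\<^sup>L M (\<lambda>\<omega>. X \<omega> ^ (2 * k)) = fact (2 * k) / (2^k * fact k) * v^k"
proof -
  have *: "integrable M (\<lambda>\<omega>. X \<omega> ^ k) \<and>
    integral\<^sup>L M (\<lambda>\<omega>. X \<omega> ^ (2 * k)) = fact (2 * k) / (2^k * fact k) * v^k"
  proof (cases "v > 0")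
    case True
    have "integral\<^sup>L std_normal_distribution (\<lambda>z. (sqrt v * z) ^ (2 * k))
        = sqrt v ^ (2*k) * (fact (2 * k) / (2^k * fact k))"
      by (simp add: power_mult_distrib std_normal_distribution_even_moments)
    moreover have "sqrt v ^ (2*k) = v^k" using True by (simp add: power_mult)
    moreover have "integrable std_normal_distribution (\<lambda>z. (sqrt v * z) ^ k)"
      by (simp add: power_mult_distrib integrable_std_normal_distribution_moment)
    ultimately show ?thesis
      using centered_gaussian_integral[OF assms True, of "\<lambda>x. x^k"]
        centered_gaussian_integral[OF assms True, of "\<lambda>x. x^(2*k)"] by (simp add: mult.commute)
  next
    case False
    then have 0: "v = 0" "AE \<omega> in M. X \<omega> = 0" and [measurable]: "X \<in> borel_measurable M"
      using assms by (auto simp: centered_gaussian_def)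
    have "integrable M (\<lambda>\<omega>. X \<omega> ^ k) \<longleftrightarrow> integrable M (\<lambda>\<omega>. 0 ^ k :: real)"
      using 0(2) by (intro integrable_cong_AE) auto
    moreover have "integral\<^sup>L M (\<lambda>\<omega>. X \<omega> ^ (2*k)) = integral\<^sup>L M (\<lambda>\<omega>. 0 ^ (2*k) :: real)"
      using 0(2) by (intro integral_cong_AE) auto
    ultimately show ?thesis using 0(1) by (cases k) (auto simp: prob_space)
  qed
  then show "integrable M (\<lambda>\<omega>. X \<omega> ^ k)"
    "integral\<^sup>L M (\<lambda>\<omega>. X \<omega> ^ (2 * k)) = fact (2 * k) / (2^k * fact k) * v^k" by auto
qed

lemma centered_gaussian_cos:
  assumes "centered_gaussian M X v"
  shows "integral\<^sup>L M (\<lambda>\<omega>. cos (X \<omega>)) = exp (- v / 2)"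
proof (cases "v > 0")
  case True
  interpret N: real_distribution std_normal_distribution by (rule real_dist_normal_dist)
  have "Re (char std_normal_distribution (sqrt v)) = (LINT z|std_normal_distribution. Re (iexp (sqrt v * z)))"
    unfolding char_def by (intro integral_Re[symmetric] N.integrable_iexp) auto
  then show ?thesis
    using centered_gaussian_integral(2)[OF assms True, of cos] True
    by (simp add: char_std_normal_distribution Re_exp)
next
  case False
  then have 0: "v = 0" "AE \<omega> in M. X \<omega> = 0" and [measurable]: "X \<in> borel_measurable M"
    using assms by (auto simp: centered_gaussian_def)
  have "integral\<^sup>L M (\<lambda>\<omega>. cos (X \<omega>)) = integral\<^sup>L M (\<lambda>\<omega>. 1)"
    using 0(2) by (intro integral_cong_AE) auto
  then show ?thesis using 0(1) by (simp add: prob_space)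
qed

lemma centered_gaussianI:
  assumes "gaussian_variable M X" "integrable M X" "integral\<^sup>L M X = 0"
  shows "centered_gaussian M X (integral\<^sup>L M (\<lambda>\<omega>. (X \<omega>)^2))"
  using assms(1) unfolding gaussian_variable_def
proof (elim disjE exE conjE)
  fix m s assume s: "s > 0" and D: "distributed M lborel X (normal_density m s)"
  have "m = 0" using normal_distributed_expectation[OF s D] assms(3) by simp
  moreover have "integral\<^sup>L M (\<lambda>\<omega>. (X \<omega>)^2) = s^2"
    using normal_distributed_variance[OF s D] assms(3) by simp
  ultimately show ?thesis using s D by (simp add: centered_gaussian_def)
next
  fix m assume X [measurable]: "X \<in> borel_measurable M" and A: "AE \<omega> in M. X \<omega> = m"
  have "integral\<^sup>L M X = integral\<^sup>L M (\<lambda>_. m)" using A by (intro integral_cong_AE) auto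
  then have "m = 0" using assms(3) by (simp add: prob_space)
  moreover have "integral\<^sup>L M (\<lambda>\<omega>. (X \<omega>)^2) = integral\<^sup>L M (\<lambda>\<omega>. m^2)"
    using A by (intro integral_cong_AE) auto
  ultimately show ?thesis using A by (simp add: centered_gaussian_def)
qed

end

lemma abs_sin_taylor1_le: "\<bar>sin (s + t) - sin s - t * cos s\<bar> \<le> t^2 / (2::real)"
proof -
  have "sin (s + t) - sin s - t * cos s = Im (iexp s * (iexp t - (1 + \<i> * t)))"
    by (simp add: Re_exp Im_exp sin_add algebra_simps)
  also have "\<bar>\<dots>\<bar> \<le> cmod (iexp s * (iexp t - (1 + \<i> * t)))" by (rule abs_Im_le_cmod)
  also have "\<dots> = cmod (iexp t - (1 + \<i> * t))" by (simp add: norm_mult)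
  also have "\<dots> \<le> t^2 / 2" using iexp_approx1[of t 1] by (simp add: power2_eq_square)
  finally show ?thesis .
qed

lemma has_real_derivative_quadratic_remainder:
  fixes f :: "real \<Rightarrow> real"
  assumes "\<And>h. \<bar>f (x + h) - f x - h * D\<bar> \<le> h^2 * K"
  shows "(f has_real_derivative D) (at x)"
  unfolding DERIV_def
proof (rule LIM_zero_cancel, rule Lim_null_comparison)
  show "((\<lambda>h. \<bar>h\<bar> * K) \<longlongrightarrow> 0) (at (0::real))"
    by (rule tendsto_eq_intros refl | simp)+
  show "\<forall>\<^sub>F h in at 0. norm ((f (x + h) - f x) / h - D) \<le> \<bar>h\<bar> * K"
    unfolding eventually_at_filter
  proof (intro always_eventually allI impI)
    fix h :: real assume h: "h \<noteq> 0"
    have "norm ((f (x + h) - f x) / h - D) = \<bar>f (x + h) - f x - h * D\<bar> / \<bar>h\<bar>"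
      using h by (simp add: field_simps flip: abs_divide)
    also have "\<dots> \<le> h^2 * K / \<bar>h\<bar>" by (intro divide_right_mono assms) simp
    also have "\<dots> = \<bar>h\<bar> * K" using h by (simp add: field_simps power2_eq_square)
    finally show "norm ((f (x + h) - f x) / h - D) \<le> \<bar>h\<bar> * K" .
  qed
qed

text \<open>By Taylor's formula the remainder of order two is at most \<open>h^2\<close> times
  \<open>\<bar>Z * X^2\<bar>\<close>. Integrability of the latter thus gives the derivative with an
  explicit error, in place of dominated convergence.\<close>

lemma DERIV_integral_mult_sin:
  fixes X Z :: "'a \<Rightarrow> real"
  assumes [measurable]: "X \<in> borel_measurable M" "Z \<in> borel_measurable M"
    and Z: "integrable M Z" and ZX: "integrable M (\<lambda>\<omega>. Z \<omega> * X \<omega>)"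
    and ZXX: "integrable M (\<lambda>\<omega>. Z \<omega> * (X \<omega>)^2)"
  shows "((\<lambda>x. integral\<^sup>L M (\<lambda>\<omega>. Z \<omega> * sin (x * X \<omega>))) has_real_derivative
     integral\<^sup>L M (\<lambda>\<omega>. Z \<omega> * (X \<omega> * cos (x * X \<omega>)))) (at x)"
proof (rule has_real_derivative_quadratic_remainder)
  fix h :: real
  have i1: "integrable M (\<lambda>\<omega>. Z \<omega> * sin (t * X \<omega>))" for t
    by (rule Bochner_Integration.integrable_bound[OF Z])
       (auto simp: abs_mult intro!: mult_left_le)
  have i2: "integrable M (\<lambda>\<omega>. Z \<omega> * (X \<omega> * cos (x * X \<omega>)))"
    by (rule Bochner_Integration.integrable_bound[OF ZX])
       (auto simp: abs_mult intro!: mult_left_le mult_left_mono)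
  have "\<bar>integral\<^sup>L M (\<lambda>\<omega>. Z \<omega> * sin ((x + h) * X \<omega>)) - integral\<^sup>L M (\<lambda>\<omega>. Z \<omega> * sin (x * X \<omega>))
      - h * integral\<^sup>L M (\<lambda>\<omega>. Z \<omega> * (X \<omega> * cos (x * X \<omega>)))\<bar>
    = \<bar>integral\<^sup>L M (\<lambda>\<omega>. Z \<omega> * (sin ((x + h) * X \<omega>) - sin (x * X \<omega>) - (h * X \<omega>) * cos (x * X \<omega>)))\<bar>"
  proof -
    have "integral\<^sup>L M (\<lambda>\<omega>. Z \<omega> * (sin ((x + h) * X \<omega>) - sin (x * X \<omega>) - (h * X \<omega>) * cos (x * X \<omega>)))
      = integral\<^sup>L M (\<lambda>\<omega>. Z \<omega> * sin ((x + h) * X \<omega>) - Z \<omega> * sin (x * X \<omega>) - h * (Z \<omega> * (X \<omega> * cos (x * X \<omega>))))"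
      by (simp only: right_diff_distrib mult_ac)
    also have "\<dots> = integral\<^sup>L M (\<lambda>\<omega>. Z \<omega> * sin ((x + h) * X \<omega>)) - integral\<^sup>L M (\<lambda>\<omega>. Z \<omega> * sin (x * X \<omega>))
      - h * integral\<^sup>L M (\<lambda>\<omega>. Z \<omega> * (X \<omega> * cos (x * X \<omega>)))"
      using i1[of "x+h"] i1[of x] i2 by simp
    finally show ?thesis by simp
  qed
  also have "\<dots> \<le> integral\<^sup>L M (\<lambda>\<omega>. h^2 * \<bar>Z \<omega> * (X \<omega>)^2\<bar>)"
    unfolding real_norm_def[symmetric, of "integral\<^sup>L M _"]
  proof (rule order_trans[OF integral_norm_bound integral_mono])
    show "integrable M (\<lambda>\<omega>. norm (Z \<omega> * (sin ((x + h) * X \<omega>) - sin (x * X \<omega>) - (h * X \<omega>) * cos (x * X \<omega>))))"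
      apply (rule integrable_norm)
      using Bochner_Integration.integrable_diff[OF Bochner_Integration.integrable_diff[OF i1[of "x+h"] i1[of x]]
          integrable_mult_right[OF i2, of h]]
      by (simp only: right_diff_distrib mult_ac)
    show "integrable M (\<lambda>\<omega>. h^2 * \<bar>Z \<omega> * (X \<omega>)^2\<bar>)" using ZXX by auto
    fix \<omega>
    have "\<bar>sin ((x + h) * X \<omega>) - sin (x * X \<omega>) - (h * X \<omega>) * cos (x * X \<omega>)\<bar> \<le> (h * X \<omega>)^2 / 2"
      using abs_sin_taylor1_le[of "x * X \<omega>" "h * X \<omega>"] by (simp add: distrib_right)
    also have "\<dots> \<le> h^2 * (X \<omega>)^2" by (simp add: power_mult_distrib)
    finally show "norm (Z \<omega> * (sin ((x + h) * X \<omega>) - sin (x * X \<omega>) - (h * X \<omega>) * cos (x * X \<omega>)))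
       \<le> h^2 * \<bar>Z \<omega> * (X \<omega>)^2\<bar>"
      by (simp add: abs_mult mult_left_mono mult.left_commute)
  qed
  finally show "\<bar>integral\<^sup>L M (\<lambda>\<omega>. Z \<omega> * sin ((x + h) * X \<omega>)) - integral\<^sup>L M (\<lambda>\<omega>. Z \<omega> * sin (x * X \<omega>))
      - h * integral\<^sup>L M (\<lambda>\<omega>. Z \<omega> * (X \<omega> * cos (x * X \<omega>)))\<bar> \<le> h^2 * integral\<^sup>L M (\<lambda>\<omega>. \<bar>Z \<omega> * (X \<omega>)^2\<bar>)"
    by simp
qed


section \<open>Expectations for Gaussian triples\<close>

text \<open>Joint Gaussianity is stated through all linear combinations with their variances, which
  is exactly what the evaluation of characteristic functions consumes. Only \<open>X\<close> and
  \<open>Y\<close> are given a common variance; they will be two increments of the same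
  level.\<close>

locale gaussian_triple = prob_space M for M :: "'a measure" +
  fixes U X Y :: "'a \<Rightarrow> real" and u v a b c :: real
  assumes gaussian: "\<And>p q r. centered_gaussian M (\<lambda>\<omega>. p * U \<omega> + q * X \<omega> + r * Y \<omega>)
      (p^2 * u + q^2 * v + r^2 * v + 2*p*q*a + 2*p*r*b + 2*q*r*c)"
begin

lemma swap: "gaussian_triple M U Y X u v b a c"
proof unfold_locales
  fix p q r
  show "centered_gaussian M (\<lambda>\<omega>. p * U \<omega> + q * Y \<omega> + r * X \<omega>)
      (p^2 * u + q^2 * v + r^2 * v + 2*p*q*b + 2*p*r*a + 2*q*r*c)"
    using gaussian[of p r q] by (simp add: algebra_simps)
qed

lemma expectation_cos_sin_sin:
  "expectation (\<lambda>\<omega>. cos (l * U \<omega>) * sin (x * X \<omega>) * sin (y * Y \<omega>))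
    = exp (- (l^2 * u / 2)) * sine_cov v (l*a) (l*b) c x y"
proof -
  let ?C = "\<lambda>q r \<omega>. cos (l * U \<omega> + q * X \<omega> + r * Y \<omega>)"
  define E where "E = exp (- (l^2 * u / 2)) * exp (- ((x^2 + y^2) * v / 2))"
  define A B r where "A = l*a*x" and "B = l*b*y" and "r = c*x*y"
  have meas: "(\<lambda>\<omega>. l * U \<omega> + q * X \<omega> + r * Y \<omega>) \<in> borel_measurable M" for q r
    using gaussian[of l q r] by (rule centered_gaussian_measurable)
  have i: "integrable M (?C q r)" for q r
    by (rule integrable_const_bound[of _ 1]) (use meas in auto)
  have v: "integral\<^sup>L M (?C q r) = exp (- (l^2 * u + q^2 * v + r^2 * v + 2*l*q*a + 2*l*r*b + 2*q*r*c) / 2)" for q r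
    by (rule centered_gaussian_cos[OF gaussian])
  \<comment> \<open>The product formula for three factors leaves four cosines of linear
    combinations, one for each choice of signs of \<open>x\<close> and \<open>y\<close>.\<close>
  have "integral\<^sup>L M (\<lambda>\<omega>. cos (l * U \<omega>) * sin (x * X \<omega>) * sin (y * Y \<omega>))
    = integral\<^sup>L M (\<lambda>\<omega>. (?C x (-y) \<omega> + ?C (-x) y \<omega> - ?C x y \<omega> - ?C (-x) (-y) \<omega>) / 4)"
    by (intro Bochner_Integration.integral_cong refl)
       (simp add: cos_add sin_add cos_diff sin_diff algebra_simps)
  also have "\<dots> = (integral\<^sup>L M (?C x (-y)) + integral\<^sup>L M (?C (-x) y)
       - integral\<^sup>L M (?C x y) - integral\<^sup>L M (?C (-x) (-y))) / 4"
    by (simp only: integral_divide_zero Bochner_Integration.integral_diff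
      Bochner_Integration.integral_add Bochner_Integration.integrable_add Bochner_Integration.integrable_diff i)
  also have "\<dots> = (E * exp (- A + B + r) + E * exp (A - B + r) - E * exp (- A - B - r) - E * exp (A + B - r)) / 4"
    unfolding v E_def A_def B_def r_def exp_add[symmetric]
    by (simp add: algebra_simps add_divide_distrib diff_divide_distrib)
  also have "\<dots> = E * (cosh A * cosh B * sinh r - sinh A * sinh B * cosh r)"
    by (simp add: cosh_field_def sinh_field_def exp_add exp_diff exp_minus field_simps)
  finally show ?thesis by (simp add: sine_cov_def E_def A_def B_def r_def mult.assoc)
qed

lemma gaussian_each:
  "centered_gaussian M U u" "centered_gaussian M X v" "centered_gaussian M Y v"
  using gaussian[of 1 0 0] gaussian[of 0 1 0] gaussian[of 0 0 1] by simp_all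

lemma measurable_each [measurable]:
  "U \<in> borel_measurable M" "X \<in> borel_measurable M" "Y \<in> borel_measurable M"
  using gaussian_each by (auto dest: centered_gaussian_measurable)

lemma integrable_powers:
  "integrable M (\<lambda>\<omega>. \<bar>X \<omega>\<bar> ^ k)" "integrable M (\<lambda>\<omega>. \<bar>Y \<omega>\<bar> ^ k)"
  using gaussian_each(2,3)[THEN centered_gaussian_moments(1), of k]
  by (auto simp flip: power_abs intro: integrable_abs)

lemma integrable_powers_bound:
  assumes [measurable]: "g \<in> borel_measurable M"
    and g: "\<And>\<omega>. \<bar>g \<omega>\<bar> \<le> \<bar>X \<omega>\<bar>^j * \<bar>Y \<omega>\<bar>^k"
  shows "integrable M g"
proof (rule Bochner_Integration.integrable_bound)
  show "integrable M (\<lambda>\<omega>. \<bar>X \<omega>\<bar>^(2*j) + \<bar>Y \<omega>\<bar>^(2*k))"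
    by (intro Bochner_Integration.integrable_add integrable_powers)
  have "norm (g \<omega>) \<le> norm (\<bar>X \<omega>\<bar>^(2*j) + \<bar>Y \<omega>\<bar>^(2*k))" for \<omega>
  proof -
    have "2 * (\<bar>X \<omega>\<bar>^j * \<bar>Y \<omega>\<bar>^k) \<le> (\<bar>X \<omega>\<bar>^j)^2 + (\<bar>Y \<omega>\<bar>^k)^2"
      using sum_squares_bound[of "\<bar>X \<omega>\<bar>^j" "\<bar>Y \<omega>\<bar>^k"] by (simp add: mult.assoc)
    moreover have "0 \<le> \<bar>X \<omega>\<bar>^j * \<bar>Y \<omega>\<bar>^k" by simp
    ultimately have "\<bar>g \<omega>\<bar> \<le> (\<bar>X \<omega>\<bar>^j)^2 + (\<bar>Y \<omega>\<bar>^k)^2"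
      using g[of \<omega>] by linarith
    then show ?thesis by (simp add: power_mult[symmetric] mult.commute)
  qed
  then show "AE \<omega> in M. norm (g \<omega>) \<le> norm (\<bar>X \<omega>\<bar>^(2*j) + \<bar>Y \<omega>\<bar>^(2*k))" by simp
qed simp

text \<open>Both sides are derivatives in \<open>y\<close> of the same function: one under the
  expectation, the other of its closed form.\<close>

lemma expectation_cos_sin_times_cos:
  "expectation (\<lambda>\<omega>. cos (l * U \<omega>) * sin (x * X \<omega>) * (Y \<omega> * cos (y * Y \<omega>)))
    = exp (- (l^2 * u / 2)) * sine_cov_y v (l*a) (l*b) c x y"
proof (rule DERIV_unique)
  let ?Z = "\<lambda>\<omega>. cos (l * U \<omega>) * sin (x * X \<omega>)"
  have Z: "integrable M (\<lambda>\<omega>. ?Z \<omega> * Y \<omega> ^ k)" for k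
    by (rule integrable_powers_bound[of _ 0 k])
       (auto simp: abs_mult power_abs intro!: mult_left_le_one_le mult_le_one)
  show "((\<lambda>y. expectation (\<lambda>\<omega>. ?Z \<omega> * sin (y * Y \<omega>))) has_real_derivative
      expectation (\<lambda>\<omega>. ?Z \<omega> * (Y \<omega> * cos (y * Y \<omega>)))) (at y)"
    using Z[of 0] Z[of 1] Z[of 2] by (intro DERIV_integral_mult_sin) auto
  show "((\<lambda>y. expectation (\<lambda>\<omega>. ?Z \<omega> * sin (y * Y \<omega>))) has_real_derivative
      exp (- (l^2 * u / 2)) * sine_cov_y v (l*a) (l*b) c x y) (at y)"
    unfolding expectation_cos_sin_sin by (rule DERIV_cmult[OF DERIV_sgen_y])
qed

lemma expectation_cos_times_cos_times_cos:
  "expectation (\<lambda>\<omega>. cos (l * U \<omega>) * (X \<omega> * cos (x * X \<omega>)) * (Y \<omega> * cos (y * Y \<omega>)))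
    = exp (- (l^2 * u / 2)) * sine_cov_xy v (l*a) (l*b) c x y"
proof (rule DERIV_unique)
  let ?Z = "\<lambda>\<omega>. cos (l * U \<omega>) * (Y \<omega> * cos (y * Y \<omega>))"
  have Z: "integrable M (\<lambda>\<omega>. ?Z \<omega> * X \<omega> ^ k)" for k
  proof (rule integrable_powers_bound[of _ k 1])
    fix \<omega>
    have "\<bar>?Z \<omega> * X \<omega> ^ k\<bar> = (\<bar>cos (l * U \<omega>)\<bar> * \<bar>cos (y * Y \<omega>)\<bar>) * (\<bar>X \<omega>\<bar>^k * \<bar>Y \<omega>\<bar>^1)"
      by (simp add: abs_mult power_abs mult_ac)
    also have "\<dots> \<le> 1 * (\<bar>X \<omega>\<bar>^k * \<bar>Y \<omega>\<bar>^1)"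
      by (intro mult_right_mono mult_le_one) auto
    finally show "\<bar>?Z \<omega> * X \<omega> ^ k\<bar> \<le> \<bar>X \<omega>\<bar>^k * \<bar>Y \<omega>\<bar>^1" by simp
  qed simp
  have "((\<lambda>x. expectation (\<lambda>\<omega>. ?Z \<omega> * sin (x * X \<omega>))) has_real_derivative
      expectation (\<lambda>\<omega>. ?Z \<omega> * (X \<omega> * cos (x * X \<omega>)))) (at x)"
    using Z[of 0] Z[of 1] Z[of 2] by (intro DERIV_integral_mult_sin) auto
  then show "((\<lambda>x. expectation (\<lambda>\<omega>. cos (l * U \<omega>) * sin (x * X \<omega>) * (Y \<omega> * cos (y * Y \<omega>)))) has_real_derivative
      expectation (\<lambda>\<omega>. cos (l * U \<omega>) * (X \<omega> * cos (x * X \<omega>)) * (Y \<omega> * cos (y * Y \<omega>)))) (at x)"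
    by (simp only: mult_ac)
  show "((\<lambda>x. expectation (\<lambda>\<omega>. cos (l * U \<omega>) * sin (x * X \<omega>) * (Y \<omega> * cos (y * Y \<omega>)))) has_real_derivative
      exp (- (l^2 * u / 2)) * sine_cov_xy v (l*a) (l*b) c x y) (at x)"
    unfolding expectation_cos_sin_times_cos by (rule DERIV_cmult[OF DERIV_sgen_xy])
qed

text \<open>Expanding the two defects gives four explicit expectations, which recombine into the
  expression bounded before. The common exponential factor is at most 1, so the variance of
  \<open>U\<close> leaves no trace in the bound. The substitution \<open>x = l / 2\<close> turns
  \<open>64 * x^6\<close> into \<open>l^6\<close> and explains the halves in the hypotheses.\<close>

lemma trapezoid_pair_bound:
  assumes l: "l^2 * v \<le> 1" and ab: "\<bar>a\<bar> \<le> v / 2" "\<bar>b\<bar> \<le> v / 2" and c: "\<bar>c\<bar> \<le> v"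
  shows "\<bar>expectation (\<lambda>\<omega>. cos (l * U \<omega>) * (l/2 * X \<omega> * cos (l/2 * X \<omega>) - sin (l/2 * X \<omega>))
      * (l/2 * Y \<omega> * cos (l/2 * Y \<omega>) - sin (l/2 * Y \<omega>)))\<bar>
    \<le> l^6 * v^2 * (\<bar>c\<bar> + l^2 * \<bar>a * b\<bar>)"
proof -
  define x where "x = l / 2"
  interpret S: gaussian_triple M U Y X u v b a c by (rule swap)
  let ?W = "\<lambda>\<omega>. cos (l * U \<omega>)"
  let ?K = "exp (- (l^2 * u / 2))"
  have i: "integrable M (\<lambda>\<omega>. ?W \<omega> * (X \<omega> ^ j * f (x * X \<omega>)) * (Y \<omega> ^ k * g (x * Y \<omega>)))"
    if [measurable]: "f \<in> borel_measurable borel" "g \<in> borel_measurable borel"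
      and f: "\<And>t. \<bar>f t\<bar> \<le> 1" and g: "\<And>t. \<bar>g t\<bar> \<le> 1" for f g :: "real \<Rightarrow> real" and j k
  proof (rule integrable_powers_bound[of _ j k])
    fix \<omega>
    have "\<bar>?W \<omega> * (X \<omega> ^ j * f (x * X \<omega>)) * (Y \<omega> ^ k * g (x * Y \<omega>))\<bar>
       = (\<bar>?W \<omega>\<bar> * (\<bar>f (x * X \<omega>)\<bar> * \<bar>g (x * Y \<omega>)\<bar>)) * (\<bar>X \<omega>\<bar>^j * \<bar>Y \<omega>\<bar>^k)"
      by (simp add: abs_mult power_abs mult_ac)
    also have "\<dots> \<le> 1 * (\<bar>X \<omega>\<bar>^j * \<bar>Y \<omega>\<bar>^k)"
      by (intro mult_right_mono mult_le_one f g) auto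
    finally show "\<bar>?W \<omega> * (X \<omega> ^ j * f (x * X \<omega>)) * (Y \<omega> ^ k * g (x * Y \<omega>))\<bar> \<le> \<bar>X \<omega>\<bar>^j * \<bar>Y \<omega>\<bar>^k"
      by simp
  qed simp
  have i1: "integrable M (\<lambda>\<omega>. ?W \<omega> * (X \<omega> * cos (x * X \<omega>)) * (Y \<omega> * cos (x * Y \<omega>)))"
    using i[of cos cos 1 1] by simp
  have i2: "integrable M (\<lambda>\<omega>. ?W \<omega> * sin (x * X \<omega>) * (Y \<omega> * cos (x * Y \<omega>)))"
    using i[of sin cos 0 1] by simp
  have i3: "integrable M (\<lambda>\<omega>. ?W \<omega> * sin (x * Y \<omega>) * (X \<omega> * cos (x * X \<omega>)))"
    using i[of cos sin 1 0] by (simp add: mult_ac)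
  have i4: "integrable M (\<lambda>\<omega>. ?W \<omega> * sin (x * X \<omega>) * sin (x * Y \<omega>))"
    using i[of sin sin 0 0] by simp
  have "expectation (\<lambda>\<omega>. ?W \<omega> * (x * X \<omega> * cos (x * X \<omega>) - sin (x * X \<omega>)) * (x * Y \<omega> * cos (x * Y \<omega>) - sin (x * Y \<omega>)))
    = expectation (\<lambda>\<omega>. x * x * (?W \<omega> * (X \<omega> * cos (x * X \<omega>)) * (Y \<omega> * cos (x * Y \<omega>)))
       - x * (?W \<omega> * sin (x * Y \<omega>) * (X \<omega> * cos (x * X \<omega>)))
       - x * (?W \<omega> * sin (x * X \<omega>) * (Y \<omega> * cos (x * Y \<omega>)))
       + ?W \<omega> * sin (x * X \<omega>) * sin (x * Y \<omega>))"
    by (intro Bochner_Integration.integral_cong refl) (simp add: algebra_simps)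
  also have "\<dots> = x * x * (?K * sine_cov_xy v (l*a) (l*b) c x x) - x * (?K * sine_cov_y v (l*b) (l*a) c x x)
      - x * (?K * sine_cov_y v (l*a) (l*b) c x x) + ?K * sine_cov v (l*a) (l*b) c x x"
    using i1 i2 i3 i4
    by (simp only: integral_mult_right_zero Bochner_Integration.integral_diff Bochner_Integration.integral_add
      Bochner_Integration.integrable_diff Bochner_Integration.integrable_add integrable_mult_right
      expectation_cos_sin_sin expectation_cos_sin_times_cos S.expectation_cos_sin_times_cos
      expectation_cos_times_cos_times_cos)
  also have "\<dots> = ?K * (x * x * sine_cov_xy v (l*a) (l*b) c x x - x * sine_cov_y v (l*b) (l*a) c x x
      - x * sine_cov_y v (l*a) (l*b) c x x + sine_cov v (l*a) (l*b) c x x)"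
    by (simp add: algebra_simps)
  also have "\<bar>\<dots>\<bar> \<le> 1 * (64 * x^6 * v^2 * (\<bar>c\<bar> + \<bar>(l*a) * (l*b)\<bar>))"
    unfolding abs_mult[of ?K]
  proof (intro mult_mono sine_cov_combination_bound)
    show v: "0 \<le> v" using gaussian_each(2) by (rule centered_gaussian_nonneg)
    show "x^2 * v \<le> 1/4" using l by (simp add: x_def power_divide)
    show "\<bar>l * a\<bar> \<le> \<bar>x\<bar> * v" "\<bar>l * b\<bar> \<le> \<bar>x\<bar> * v"
      using mult_left_mono[OF ab(1), of "\<bar>l\<bar>"] mult_left_mono[OF ab(2), of "\<bar>l\<bar>"]
      by (auto simp: abs_mult x_def)
    show "\<bar>exp (- (l^2 * u / 2))\<bar> \<le> 1" using centered_gaussian_nonneg[OF gaussian_each(1)] by simp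
  qed (use c in auto)
  also have "\<dots> = l^6 * v^2 * (\<bar>c\<bar> + l^2 * \<bar>a * b\<bar>)"
    by (simp add: x_def power_divide abs_mult power2_eq_square abs_mult_self_eq algebra_simps)
  finally show ?thesis by (simp only: x_def mult.assoc)
qed

end

section \<open>Differences of a concave power\<close>

text \<open>Bernoulli's inequality for exponents up to 1, read off from convexity of
  \<open>exp\<close> between 0 and \<open>ln u\<close>.\<close>

lemma powr_le_affine:
  fixes u a :: real
  assumes "0 \<le> u" "0 < a" "a \<le> 1"
  shows "u powr a \<le> 1 + a * (u - 1)"
proof (cases "u = 0")
  case False
  then have "exp ((1 - a) *\<^sub>R 0 + a *\<^sub>R ln u) \<le> (1 - a) * exp 0 + a * exp (ln u)"
    using assms by (intro convex_onD[OF exp_convex]) auto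
  then show ?thesis using False assms by (simp add: powr_def algebra_simps)
qed (use assms in simp)

lemma powr_midpoint_concave:
  fixes e a :: real
  assumes "1 \<le> e" "0 < a" "a \<le> 1"
  shows "(e + 1) powr a + (e - 1) powr a \<le> 2 * e powr a"
proof -
  have "(e + s) powr a = e powr a * (1 + s / e) powr a" if "\<bar>s\<bar> \<le> 1" for s
  proof -
    have "e + s = e * (1 + s / e)" using assms by (simp add: field_simps)
    moreover have "0 \<le> 1 + s / e" using assms that by (simp add: field_simps)
    ultimately show ?thesis using assms by (simp add: powr_mult)
  qed
  from this[of 1] this[of "-1"]
  have "(e + 1) powr a + (e - 1) powr a = e powr a * ((1 + 1/e) powr a + (1 - 1/e) powr a)"
    by (simp add: algebra_simps)
  also have "\<dots> \<le> e powr a * 2"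
    using powr_le_affine[of "1 + 1/e" a] powr_le_affine[of "1 - 1/e" a] assms
    by (intro mult_left_mono) auto
  finally show ?thesis by simp
qed

text \<open>The growth of the power over one unit interval, of interest for
  \<open>e \<ge> 1\<close>. Second and central differences are the difference and the sum of
  consecutive gaps.\<close>

definition powr_gap :: "real \<Rightarrow> nat \<Rightarrow> real" where
  "powr_gap a e = real e powr a - (real e - 1) powr a"

context
  fixes a :: real
  assumes a: "0 < a" "a \<le> 1"
begin

lemma powr_gap_decreasing: "1 \<le> e \<Longrightarrow> powr_gap a (Suc e) \<le> powr_gap a e"
  using powr_midpoint_concave[of "real e" a] a by (simp add: powr_gap_def add.commute)

lemma powr_gap_nonneg: "1 \<le> e \<Longrightarrow> 0 \<le> powr_gap a e"
  using a by (simp add: powr_gap_def powr_mono2)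

lemma powr_gap_le_1: "1 \<le> e \<Longrightarrow> powr_gap a e \<le> 1"
proof (induction e rule: dec_induct)
  case (step e)
  then show ?case using powr_gap_decreasing[of e] by simp
qed (simp add: powr_gap_def)

lemma powr_second_difference:
  "\<bar>\<bar>real e + 1\<bar> powr a + \<bar>real e - 1\<bar> powr a - 2 * real e powr a\<bar>
    = (if e = 0 then 2 else powr_gap a e - powr_gap a (Suc e))"
  using powr_gap_decreasing[of e] by (auto simp: powr_gap_def add.commute abs_if)

lemma powr_central_difference:
  "\<bar>real e + 1\<bar> powr a - \<bar>real e - 1\<bar> powr a = (if e = 0 then 0 else powr_gap a e + powr_gap a (Suc e))"
  by (auto simp: powr_gap_def add.commute abs_if)

text \<open>Concavity gives all second differences with \<open>e \<ge> 1\<close> the same sign, so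
  their absolute values telescope and the bound does not depend on \<open>N\<close>.\<close>

lemma sum_powr_second_difference_le:
  "(\<Sum>e=1..N. \<bar>\<bar>real e + 1\<bar> powr a + \<bar>real e - 1\<bar> powr a - 2 * real e powr a\<bar>) \<le> 1"
proof -
  have "(\<Sum>e=1..N. \<bar>\<bar>real e + 1\<bar> powr a + \<bar>real e - 1\<bar> powr a - 2 * real e powr a\<bar>)
    = powr_gap a 1 - powr_gap a (Suc N)"
    unfolding powr_second_difference by (induction N) auto
  also have "\<dots> \<le> 1" using powr_gap_nonneg[of "Suc N"] by (simp add: powr_gap_def)
  finally show ?thesis .
qed

text \<open>Gaps lie between 0 and 1, so the square of a sum of two is at most twice the sum, which
  telescopes. With \<open>a = 2 * H\<close> and \<open>N = 2^n\<close> the bound is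
  \<open>8 / step_var n\<close>: it uses up exactly the one surplus variance factor that a product
  of two covariances has over a single one.\<close>

lemma sum_powr_central_difference_square_le:
  assumes "1 \<le> N"
  shows "(\<Sum>e=1..N. (\<bar>real e + 1\<bar> powr a - \<bar>real e - 1\<bar> powr a)^2) \<le> 8 * real N powr a"
proof -
  have gap: "(powr_gap a e + powr_gap a (Suc e))^2 \<le> 2 * (powr_gap a e + powr_gap a (Suc e))" if "1 \<le> e" for e
    unfolding power2_eq_square
    using powr_gap_nonneg[of e] powr_gap_nonneg[of "Suc e"] powr_gap_le_1[of e] powr_gap_le_1[of "Suc e"] that
    by (intro mult_right_mono) auto
  have "(\<Sum>e=1..N. (\<bar>real e + 1\<bar> powr a - \<bar>real e - 1\<bar> powr a)^2)
    \<le> (\<Sum>e=1..N. 2 * (powr_gap a e + powr_gap a (Suc e)))"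
    unfolding powr_central_difference by (intro sum_mono) (use gap in auto)
  also have "\<dots> = 2 * (real N powr a + (real N + 1) powr a - 1)"
    using a by (induction N) (auto simp: powr_gap_def add.commute)
  also have "(real N + 1) powr a \<le> real N powr a + 1"
    using powr_gap_le_1[of "Suc N"] by (simp add: powr_gap_def add.commute)
  also have "2 * (real N powr a + (real N powr a + 1) - 1) \<le> 8 * real N powr a" by simp
  finally show ?thesis by simp
qed

end

text \<open>A positive distance from \<open>k\<close> is attained at most twice. This makes row sums
  of a Toeplitz array bounded uniformly in the row.\<close>

lemma sum_distance_le:
  fixes F :: "nat \<Rightarrow> real"
  assumes F: "\<And>e. 0 \<le> F e" and k: "k \<le> N"
  shows "(\<Sum>j=1..N. F (nat \<bar>int j - int k\<bar>)) \<le> F 0 + 2 * (\<Sum>e=1..N. F e)"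
proof -
  \<comment> \<open>The intersection takes care of \<open>k = 0\<close>, which lies outside the
    range of summation.\<close>
  have eq: "{1..N} = {1..<k} \<union> ({k} \<inter> {1..N}) \<union> {k<..N}" using k by auto
  have "(\<Sum>j=1..N. F (nat \<bar>int j - int k\<bar>))
    = (\<Sum>j\<in>{1..<k}. F (nat \<bar>int j - int k\<bar>)) + (\<Sum>j\<in>{k} \<inter> {1..N}. F (nat \<bar>int j - int k\<bar>))
     + (\<Sum>j\<in>{k<..N}. F (nat \<bar>int j - int k\<bar>))"
    by (subst eq, subst sum.union_disjoint; (subst sum.union_disjoint)?) auto
  moreover have "(\<Sum>j\<in>{1..<k}. F (nat \<bar>int j - int k\<bar>)) = (\<Sum>e\<in>{1..<k}. F e)"
    by (rule sum.reindex_bij_witness[of _ "\<lambda>e. k - e" "\<lambda>j. k - j"]) (auto simp: nat_diff_distrib)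
  moreover have "(\<Sum>e\<in>{1..<k}. F e) \<le> (\<Sum>e=1..N. F e)"
    using k F by (intro sum_mono2) auto
  moreover have "(\<Sum>j\<in>{k} \<inter> {1..N}. F (nat \<bar>int j - int k\<bar>)) \<le> (\<Sum>j\<in>{k}. F (nat \<bar>int j - int k\<bar>))"
    using F by (intro sum_mono2) auto
  moreover have "(\<Sum>j\<in>{k<..N}. F (nat \<bar>int j - int k\<bar>)) = (\<Sum>e\<in>{1..N-k}. F e)"
    by (rule sum.reindex_bij_witness[of _ "\<lambda>e. k + e" "\<lambda>j. j - k"])
       (auto simp: of_nat_diff[symmetric] simp del: of_nat_diff)
  moreover have "(\<Sum>e\<in>{1..N-k}. F e) \<le> (\<Sum>e=1..N. F e)"
    using F by (intro sum_mono2) auto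
  ultimately show ?thesis by simp
qed

section \<open>Fractional Brownian motion\<close>

locale fbm = prob_space M for M :: "'a measure" +
  fixes H :: real and B :: "real \<Rightarrow> 'a \<Rightarrow> real"
  assumes fbm: "fractional_brownian_motion M H B" and H: "0 < H" "H < 1"
begin

text \<open>Membership of averages and differences follows from the introduction rules; explicit
  coefficients over a finite set of times are recovered only once, to invoke the Gaussian
  property.\<close>

inductive_set gaussian_span :: "('a \<Rightarrow> real) set" where
  base: "t \<in> {0..1} \<Longrightarrow> B t \<in> gaussian_span"
| add: "X \<in> gaussian_span \<Longrightarrow> Y \<in> gaussian_span \<Longrightarrow> (\<lambda>\<omega>. X \<omega> + Y \<omega>) \<in> gaussian_span"
| scale: "X \<in> gaussian_span \<Longrightarrow> (\<lambda>\<omega>. r * X \<omega>) \<in> gaussian_span"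

lemma gaussian_span_diff: "X \<in> gaussian_span \<Longrightarrow> Y \<in> gaussian_span \<Longrightarrow> (\<lambda>\<omega>. X \<omega> - Y \<omega>) \<in> gaussian_span"
  using add[of X "\<lambda>\<omega>. - 1 * Y \<omega>"] scale[of Y "-1"] by simp

lemma gaussian_span_sum:
  assumes "X \<in> gaussian_span"
  shows "\<exists>J c. finite J \<and> J \<subseteq> {0..1} \<and> X = (\<lambda>\<omega>. \<Sum>t\<in>J. c t * B t \<omega>)"
  using assms
proof induction
  case (base t)
  then show ?case by (intro exI[of _ "{t}"] exI[of _ "\<lambda>_. 1"]) auto
next
  case (add X Y)
  then obtain J c J' c' where
    J: "finite J" "J \<subseteq> {0..1}" "X = (\<lambda>\<omega>. \<Sum>t\<in>J. c t * B t \<omega>)" and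
    J': "finite J'" "J' \<subseteq> {0..1}" "Y = (\<lambda>\<omega>. \<Sum>t\<in>J'. c' t * B t \<omega>)" by auto
  let ?d = "\<lambda>t. (if t \<in> J then c t else 0) + (if t \<in> J' then c' t else 0)"
  have "(\<Sum>t\<in>J \<union> J'. ?d t * B t \<omega>) = X \<omega> + Y \<omega>" for \<omega>
  proof -
    have "(\<Sum>t\<in>J \<union> J'. ?d t * B t \<omega>) = (\<Sum>t\<in>J \<union> J'. if t \<in> J then c t * B t \<omega> else 0)
        + (\<Sum>t\<in>J \<union> J'. if t \<in> J' then c' t * B t \<omega> else 0)"
      unfolding sum.distrib[symmetric] by (intro sum.cong) (auto simp: distrib_right)
    also have "(\<Sum>t\<in>J \<union> J'. if t \<in> J then c t * B t \<omega> else 0) = X \<omega>"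
      unfolding J(3) using J(1) J'(1) by (intro sum.mono_neutral_cong_right) auto
    also have "(\<Sum>t\<in>J \<union> J'. if t \<in> J' then c' t * B t \<omega> else 0) = Y \<omega>"
      unfolding J'(3) using J(1) J'(1) by (intro sum.mono_neutral_cong_right) auto
    finally show ?thesis .
  qed
  then show ?case using J J' by (intro exI[of _ "J \<union> J'"] exI[of _ ?d]) auto
next
  case (scale X r)
  then obtain J c where "finite J" "J \<subseteq> {0..1}" "X = (\<lambda>\<omega>. \<Sum>t\<in>J. c t * B t \<omega>)" by auto
  then show ?case by (intro exI[of _ J] exI[of _ "\<lambda>t. r * c t"]) (auto simp: sum_distrib_left mult.assoc)
qed

lemma gaussian_span_centered_gaussian:
  assumes "X \<in> gaussian_span"
  shows "centered_gaussian M X (expectation (\<lambda>\<omega>. (X \<omega>)^2))"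
proof (rule centered_gaussianI)
  obtain J c where J: "finite J" "J \<subseteq> {0..1}" "X = (\<lambda>\<omega>. \<Sum>t\<in>J. c t * B t \<omega>)"
    using gaussian_span_sum[OF assms] by auto
  then show "gaussian_variable M X"
    using fbm by (auto simp: fractional_brownian_motion_def gaussian_process_def)
  have B: "integrable M (B t)" "integral\<^sup>L M (B t) = 0" if "t \<in> J" for t
    using that J(2) fbm by (auto simp: fractional_brownian_motion_def centered_process_def)
  show "integrable M X" "integral\<^sup>L M X = 0"
    unfolding J(3) using B by auto
qed

lemma gaussian_span_measurable: "X \<in> gaussian_span \<Longrightarrow> X \<in> borel_measurable M"
  using gaussian_span_centered_gaussian centered_gaussian_measurable by blast

lemma integrable_gaussian_span_mult:
  assumes "X \<in> gaussian_span" "Y \<in> gaussian_span"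
  shows "integrable M (\<lambda>\<omega>. X \<omega> * Y \<omega>)"
proof (rule Bochner_Integration.integrable_bound)
  have [measurable]: "X \<in> borel_measurable M" "Y \<in> borel_measurable M"
    using assms gaussian_span_measurable by auto
  show "integrable M (\<lambda>\<omega>. (X \<omega>)^2 + (Y \<omega>)^2)"
    using assms by (intro Bochner_Integration.integrable_add centered_gaussian_moments(1)[OF gaussian_span_centered_gaussian])
  have "norm (X \<omega> * Y \<omega>) \<le> norm ((X \<omega>)^2 + (Y \<omega>)^2)" for \<omega>
  proof -
    have "0 \<le> \<bar>X \<omega>\<bar> * \<bar>Y \<omega>\<bar>" by simp
    then have "\<bar>X \<omega>\<bar> * \<bar>Y \<omega>\<bar> \<le> \<bar>X \<omega>\<bar>^2 + \<bar>Y \<omega>\<bar>^2"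
      using sum_squares_bound[of "\<bar>X \<omega>\<bar>" "\<bar>Y \<omega>\<bar>"] by linarith
    then show ?thesis by (simp add: abs_mult)
  qed
  then show "AE \<omega> in M. norm (X \<omega> * Y \<omega>) \<le> norm ((X \<omega>)^2 + (Y \<omega>)^2)" by simp
  show "(\<lambda>\<omega>. X \<omega> * Y \<omega>) \<in> borel_measurable M" by simp
qed

definition increment :: "real \<Rightarrow> real \<Rightarrow> 'a \<Rightarrow> real" where
  "increment s t \<omega> = B t \<omega> - B s \<omega>"

lemma increment_span: "s \<in> {0..1} \<Longrightarrow> t \<in> {0..1} \<Longrightarrow> increment s t \<in> gaussian_span"
  unfolding increment_def by (intro gaussian_span_diff base)

text \<open>The terms of the covariance that depend on a single time cancel, so only differences of
  times remain.\<close>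

lemma expectation_increment_mult:
  assumes "s \<in> {0..1}" "t \<in> {0..1}" "s' \<in> {0..1}" "t' \<in> {0..1}"
  shows "expectation (\<lambda>\<omega>. increment s t \<omega> * increment s' t' \<omega>)
    = 1/2 * (\<bar>t - s'\<bar> powr (2*H) + \<bar>s - t'\<bar> powr (2*H) - \<bar>t - t'\<bar> powr (2*H) - \<bar>s - s'\<bar> powr (2*H))"
proof -
  have R: "integrable M (\<lambda>\<omega>. B x \<omega> * B y \<omega>)"
    "expectation (\<lambda>\<omega>. B x \<omega> * B y \<omega>) = 1/2 * (x powr (2*H) + y powr (2*H) - \<bar>x - y\<bar> powr (2*H))"
    if "x \<in> {0..1}" "y \<in> {0..1}" for x y
    using fbm that by (auto simp: fractional_brownian_motion_def add.commute)
  have "expectation (\<lambda>\<omega>. increment s t \<omega> * increment s' t' \<omega>)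
    = expectation (\<lambda>\<omega>. B t \<omega> * B t' \<omega> - B t \<omega> * B s' \<omega> - B s \<omega> * B t' \<omega> + B s \<omega> * B s' \<omega>)"
    by (intro Bochner_Integration.integral_cong refl) (simp add: increment_def algebra_simps)
  also have "\<dots> = expectation (\<lambda>\<omega>. B t \<omega> * B t' \<omega>) - expectation (\<lambda>\<omega>. B t \<omega> * B s' \<omega>)
     - expectation (\<lambda>\<omega>. B s \<omega> * B t' \<omega>) + expectation (\<lambda>\<omega>. B s \<omega> * B s' \<omega>)"
    using assms R(1)
    by (simp only: Bochner_Integration.integral_add Bochner_Integration.integral_diff
        Bochner_Integration.integrable_diff)
  also have "\<dots> = 1/2 * (\<bar>t - s'\<bar> powr (2*H) + \<bar>s - t'\<bar> powr (2*H) - \<bar>t - t'\<bar> powr (2*H) - \<bar>s - s'\<bar> powr (2*H))"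
    unfolding R(2)[OF assms(2,4)] R(2)[OF assms(2,3)] R(2)[OF assms(1,4)] R(2)[OF assms(1,3)]
    by (simp add: algebra_simps)
  finally show ?thesis .
qed

lemma increment_centered_gaussian:
  assumes "s \<in> {0..1}" "t \<in> {0..1}"
  shows "centered_gaussian M (increment s t) (\<bar>t - s\<bar> powr (2*H))"
proof -
  have "expectation (\<lambda>\<omega>. (increment s t \<omega>)^2) = \<bar>t - s\<bar> powr (2*H)"
    using expectation_increment_mult[OF assms assms] by (simp add: power2_eq_square abs_minus_commute)
  then show ?thesis
    using gaussian_span_centered_gaussian[OF increment_span[OF assms]] by simp
qed

text \<open>The covariance at time 0 forces variance 0, which gives the value only almost surely;
  later events are therefore compared almost everywhere.\<close>

lemma B_0: "AE \<omega> in M. B 0 \<omega> = 0"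
proof -
  have "expectation (\<lambda>\<omega>. (B 0 \<omega>)^2) = 0"
    using fbm unfolding fractional_brownian_motion_def power2_eq_square
    by (auto dest!: bspec[of _ _ 0])
  moreover have "integrable M (\<lambda>\<omega>. (B 0 \<omega>)^2)"
    by (intro centered_gaussian_moments(1)[OF gaussian_span_centered_gaussian] base) simp
  ultimately show ?thesis
    by (subst (asm) integral_nonneg_eq_0_iff_AE) auto
qed

lemma gaussian_triple_span:
  assumes "U \<in> gaussian_span" "X \<in> gaussian_span" "Y \<in> gaussian_span"
    and "expectation (\<lambda>\<omega>. (X \<omega>)^2) = v" "expectation (\<lambda>\<omega>. (Y \<omega>)^2) = v"
  shows "gaussian_triple M U X Y (expectation (\<lambda>\<omega>. (U \<omega>)^2)) v
    (expectation (\<lambda>\<omega>. U \<omega> * X \<omega>)) (expectation (\<lambda>\<omega>. U \<omega> * Y \<omega>)) (expectation (\<lambda>\<omega>. X \<omega> * Y \<omega>))"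
proof unfold_locales
  fix p q r
  let ?Z = "\<lambda>\<omega>. p * U \<omega> + q * X \<omega> + r * Y \<omega>"
  have "expectation (\<lambda>\<omega>. (?Z \<omega>)^2) = expectation (\<lambda>\<omega>. p^2 * (U \<omega> * U \<omega>) + q^2 * (X \<omega> * X \<omega>) + r^2 * (Y \<omega> * Y \<omega>)
     + 2*p*q * (U \<omega> * X \<omega>) + 2*p*r * (U \<omega> * Y \<omega>) + 2*q*r * (X \<omega> * Y \<omega>))"
    by (intro Bochner_Integration.integral_cong refl) (simp add: power2_eq_square algebra_simps)
  also have "\<dots> = p^2 * expectation (\<lambda>\<omega>. U \<omega> * U \<omega>) + q^2 * expectation (\<lambda>\<omega>. X \<omega> * X \<omega>) + r^2 * expectation (\<lambda>\<omega>. Y \<omega> * Y \<omega>)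
     + 2*p*q * expectation (\<lambda>\<omega>. U \<omega> * X \<omega>) + 2*p*r * expectation (\<lambda>\<omega>. U \<omega> * Y \<omega>) + 2*q*r * expectation (\<lambda>\<omega>. X \<omega> * Y \<omega>)"
    using assms(1-3)
    by (simp only: integral_mult_right_zero Bochner_Integration.integral_add
      Bochner_Integration.integrable_add integrable_mult_right integrable_gaussian_span_mult)
  finally have e: "expectation (\<lambda>\<omega>. (?Z \<omega>)^2) = \<dots>" .
  have "?Z \<in> gaussian_span" using assms(1-3) by (intro add scale)
  from gaussian_span_centered_gaussian[OF this]
  show "centered_gaussian M ?Z (p^2 * expectation (\<lambda>\<omega>. (U \<omega>)^2) + q^2 * v + r^2 * v
     + 2*p*q * expectation (\<lambda>\<omega>. U \<omega> * X \<omega>) + 2*p*r * expectation (\<lambda>\<omega>. U \<omega> * Y \<omega>) + 2*q*r * expectation (\<lambda>\<omega>. X \<omega> * Y \<omega>))"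
    unfolding e using assms(4,5) by (simp add: power2_eq_square)
qed

end

section \<open>Trapezoidal defects at a fixed frequency\<close>

text \<open>It comes from \<open>trapezoid_defect_cos\<close> and \<open>trapezoid_defect_sin\<close> below.\<close>

definition trapezoid_defect :: "real \<Rightarrow> real \<Rightarrow> real" where
  "trapezoid_defect l h = l * h * cos (l * h / 2) - 2 * sin (l * h / 2)"

lemma abs_mult_cos_minus_sin_le: "\<bar>z * cos z - sin z\<bar> \<le> \<bar>z\<bar>^3" for z :: real
proof -
  have *: "\<bar>z * cos z - sin z\<bar> \<le> z^3" if "0 \<le> z" for z :: real
  proof -
    have "(\<lambda>z. z^3 - s * (z * cos z - sin z)) 0 \<le> (\<lambda>z. z^3 - s * (z * cos z - sin z)) z"
      if s: "\<bar>s\<bar> = 1" for s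
    proof (rule DERIV_nonneg_imp_nondecreasing[OF \<open>0 \<le> z\<close>], intro exI conjI)
      fix t :: real assume t: "0 \<le> t"
      show "((\<lambda>z. z^3 - s * (z * cos z - sin z)) has_real_derivative 3 * t^2 + s * (t * sin t)) (at t)"
        by (rule derivative_eq_intros refl | simp add: algebra_simps)+
      have "\<bar>s * (t * sin t)\<bar> \<le> t * t"
        using abs_sin_x_le_abs_x[of t] t s by (simp add: abs_mult mult_left_mono)
      moreover have "0 \<le> t * t" by simp
      ultimately show "0 \<le> 3 * t^2 + s * (t * sin t)" by (simp add: power2_eq_square)
    qed
    from this[of 1] this[of "-1"] show ?thesis by auto
  qed
  show ?thesis using *[of z] *[of "-z"] by (cases "0 \<le> z") (auto simp: abs_if split: if_splits)
qed

lemma trapezoid_defect_eq: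
  "trapezoid_defect l h = 2 * (l/2 * h * cos (l/2 * h) - sin (l/2 * h))"
  by (simp add: trapezoid_defect_def)

lemma trapezoid_defect_square_le: "(trapezoid_defect l h)^2 \<le> l^6 / 16 * h^6"
proof -
  have "\<bar>trapezoid_defect l h\<bar> \<le> 2 * \<bar>l/2 * h\<bar>^3"
    using abs_mult_cos_minus_sin_le[of "l/2 * h"] by (simp add: trapezoid_defect_eq)
  then have "\<bar>trapezoid_defect l h\<bar>^2 \<le> (2 * \<bar>l/2 * h\<bar>^3)^2" by (intro power_mono) auto
  also have "\<dots> = l^6 / 16 * h^6"
    by (simp add: power_mult_distrib abs_mult power_divide flip: power_mult)
  finally show ?thesis by simp
qed

context fbm
begin

definition midpoint_value :: "nat \<Rightarrow> nat \<Rightarrow> 'a \<Rightarrow> real" where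
  "midpoint_value n k \<omega> = (B (real k / 2^n) \<omega> + B ((real k - 1) / 2^n) \<omega>) / 2"

definition step_var :: "nat \<Rightarrow> real" where
  "step_var n = 2 powr (- (2 * H * real n))"

lemma step_var_pos: "0 < step_var n" by (simp add: step_var_def)

lemma abs_dyadic_powr: "\<bar>r / 2^n - s / 2^n\<bar> powr (2*H) = \<bar>r - s\<bar> powr (2*H) * step_var n"
proof -
  have "\<bar>r / 2^n - s / 2^n\<bar> = \<bar>r - s\<bar> / 2 powr real n"
    by (simp add: powr_realpow flip: diff_divide_distrib)
  then show ?thesis
    by (simp add: powr_divide powr_powr step_var_def powr_minus_divide mult_ac)
qed

lemma dyadic_in_unit:
  assumes "k \<in> {1..2^n}"
  shows "real k / 2^n \<in> {0..1}" "(real k - 1) / 2^n \<in> {0..1}"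
proof -
  have "real k \<le> 2^n" using assms by (metis atLeastAtMost_iff of_nat_le_iff of_nat_numeral of_nat_power)
  then show "real k / 2^n \<in> {0..1}" "(real k - 1) / 2^n \<in> {0..1}"
    using assms by (auto simp: field_simps simp del: of_nat_le_numeral_power_cancel_iff)
qed

lemma dyadic_increment_eq: "dyadic_increment B n k = increment ((real k - 1) / 2^n) (real k / 2^n)"
  by (auto simp: dyadic_increment_def increment_def)

lemma dyadic_increment_span: "k \<in> {1..2^n} \<Longrightarrow> dyadic_increment B n k \<in> gaussian_span"
  unfolding dyadic_increment_eq by (intro increment_span dyadic_in_unit)

lemma dyadic_increment_gaussian:
  assumes "k \<in> {1..2^n}"
  shows "centered_gaussian M (dyadic_increment B n k) (step_var n)"
  using increment_centered_gaussian[OF dyadic_in_unit(2,1)[OF assms]] abs_dyadic_powr[of "real k" n "real k - 1"]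
  by (simp add: dyadic_increment_eq)

lemma midpoint_value_measurable [measurable]:
  "k \<in> {1..2^n} \<Longrightarrow> midpoint_value n k \<in> borel_measurable M"
  unfolding midpoint_value_def[abs_def]
  using dyadic_in_unit[THEN base, THEN gaussian_span_measurable] by measurable

lemma dyadic_increment_measurable [measurable]:
  "k \<in> {1..2^n} \<Longrightarrow> dyadic_increment B n k \<in> borel_measurable M"
  by (intro gaussian_span_measurable dyadic_increment_span)

text \<open>Differences of midpoints are averages of increments. Their covariances with increments
  thus depend on time differences only, which would fail for a single midpoint.\<close>

lemma midpoint_diff:
  "midpoint_value n j \<omega> - midpoint_value n k \<omega> =
    1/2 * increment (real k / 2^n) (real j / 2^n) \<omega> + 1/2 * increment ((real k - 1) / 2^n) ((real j - 1) / 2^n) \<omega>"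
  by (simp add: midpoint_value_def increment_def field_simps)

lemma expectation_midpoint_diff_mult:
  assumes j: "j \<in> {1..2^n}" and k: "k \<in> {1..2^n}" and s: "s \<in> {0..1}" and t: "t \<in> {0..1}"
  shows "expectation (\<lambda>\<omega>. (midpoint_value n j \<omega> - midpoint_value n k \<omega>) * increment s t \<omega>)
    = 1/2 * expectation (\<lambda>\<omega>. increment (real k / 2^n) (real j / 2^n) \<omega> * increment s t \<omega>)
      + 1/2 * expectation (\<lambda>\<omega>. increment ((real k - 1) / 2^n) ((real j - 1) / 2^n) \<omega> * increment s t \<omega>)"
proof -
  note [simp] = integrable_gaussian_span_mult[OF increment_span increment_span]
  show ?thesis
    unfolding midpoint_diff distrib_right mult.assoc
    using dyadic_in_unit[OF j] dyadic_in_unit[OF k] s t by simp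
qed

text \<open>In the average of the two increments between corresponding end points, the powers of the
  distance \<open>e\<close> itself cancel and the two neighbouring ones stay. The absolute values
  inside the powers let the same formulas cover \<open>e = 0\<close>.\<close>

lemma dyadic_covariances:
  assumes j: "j \<in> {1..2^n}" and k: "k \<in> {1..2^n}"
  defines "U \<equiv> \<lambda>\<omega>. midpoint_value n j \<omega> - midpoint_value n k \<omega>" and "e \<equiv> nat \<bar>int j - int k\<bar>"
  shows "\<bar>expectation (\<lambda>\<omega>. U \<omega> * dyadic_increment B n j \<omega>)\<bar>
      = step_var n / 4 * \<bar>\<bar>real e + 1\<bar> powr (2*H) - \<bar>real e - 1\<bar> powr (2*H)\<bar>"
    and "\<bar>expectation (\<lambda>\<omega>. U \<omega> * dyadic_increment B n k \<omega>)\<bar>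
      = step_var n / 4 * \<bar>\<bar>real e + 1\<bar> powr (2*H) - \<bar>real e - 1\<bar> powr (2*H)\<bar>"
    and "\<bar>expectation (\<lambda>\<omega>. dyadic_increment B n j \<omega> * dyadic_increment B n k \<omega>)\<bar>
      = step_var n / 2 * \<bar>\<bar>real e + 1\<bar> powr (2*H) + \<bar>real e - 1\<bar> powr (2*H) - 2 * real e powr (2*H)\<bar>"
proof -
  define d where "d = real j - real k"
  note t = dyadic_in_unit[OF j] dyadic_in_unit[OF k]
  have d: "d = real e \<or> d = - real e" by (auto simp: d_def e_def)
  have abs: "\<bar>d + 1\<bar> = \<bar>real e + 1\<bar> \<and> \<bar>d - 1\<bar> = \<bar>real e - 1\<bar> \<or> \<bar>d + 1\<bar> = \<bar>real e - 1\<bar> \<and> \<bar>d - 1\<bar> = \<bar>real e + 1\<bar>"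
    "\<bar>d\<bar> = real e"
    using d by auto
  have a: "expectation (\<lambda>\<omega>. U \<omega> * dyadic_increment B n j \<omega>) = step_var n / 4 * (\<bar>d + 1\<bar> powr (2*H) - \<bar>d - 1\<bar> powr (2*H))"
    unfolding U_def dyadic_increment_eq expectation_midpoint_diff_mult[OF j k t(2,1)]
      expectation_increment_mult[OF t(3,1,2,1)] expectation_increment_mult[OF t(4,2,2,1)] abs_dyadic_powr
    by (simp add: d_def algebra_simps abs_minus_commute)
  have b: "expectation (\<lambda>\<omega>. U \<omega> * dyadic_increment B n k \<omega>) = step_var n / 4 * (\<bar>d + 1\<bar> powr (2*H) - \<bar>d - 1\<bar> powr (2*H))"
    unfolding U_def dyadic_increment_eq expectation_midpoint_diff_mult[OF j k t(4,3)]
      expectation_increment_mult[OF t(3,1,4,3)] expectation_increment_mult[OF t(4,2,4,3)] abs_dyadic_powr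
    by (simp add: d_def algebra_simps abs_minus_commute)
  have c: "expectation (\<lambda>\<omega>. dyadic_increment B n j \<omega> * dyadic_increment B n k \<omega>)
      = step_var n / 2 * (\<bar>d + 1\<bar> powr (2*H) + \<bar>d - 1\<bar> powr (2*H) - 2 * \<bar>d\<bar> powr (2*H))"
    unfolding dyadic_increment_eq expectation_increment_mult[OF t(2,1,4,3)] abs_dyadic_powr
    by (simp add: d_def algebra_simps abs_minus_commute)
  have e1: "\<bar>\<bar>d + 1\<bar> powr (2*H) - \<bar>d - 1\<bar> powr (2*H)\<bar> = \<bar>\<bar>real e + 1\<bar> powr (2*H) - \<bar>real e - 1\<bar> powr (2*H)\<bar>"
    using abs(1) by (auto simp: abs_minus_commute)
  have e2: "\<bar>d + 1\<bar> powr (2*H) + \<bar>d - 1\<bar> powr (2*H) - 2 * \<bar>d\<bar> powr (2*H)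
     = \<bar>real e + 1\<bar> powr (2*H) + \<bar>real e - 1\<bar> powr (2*H) - 2 * real e powr (2*H)"
    using abs(1) unfolding abs(2) by (elim disjE conjE) (simp_all only: add.commute)
  show "\<bar>expectation (\<lambda>\<omega>. U \<omega> * dyadic_increment B n j \<omega>)\<bar>
      = step_var n / 4 * \<bar>\<bar>real e + 1\<bar> powr (2*H) - \<bar>real e - 1\<bar> powr (2*H)\<bar>"
    "\<bar>expectation (\<lambda>\<omega>. U \<omega> * dyadic_increment B n k \<omega>)\<bar>
      = step_var n / 4 * \<bar>\<bar>real e + 1\<bar> powr (2*H) - \<bar>real e - 1\<bar> powr (2*H)\<bar>"
    "\<bar>expectation (\<lambda>\<omega>. dyadic_increment B n j \<omega> * dyadic_increment B n k \<omega>)\<bar>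
      = step_var n / 2 * \<bar>\<bar>real e + 1\<bar> powr (2*H) + \<bar>real e - 1\<bar> powr (2*H) - 2 * real e powr (2*H)\<bar>"
    unfolding a b c abs_mult e1 e2 using step_var_pos[of n] by simp_all
qed

section \<open>Second moments of the trapezoidal error at one frequency\<close>

text \<open>For \<open>w = cos\<close> this is the total error for the function
  \<open>sin (l x)\<close>, for \<open>w = sin\<close> minus the total error for
  \<open>cos (l x)\<close>.\<close>

definition weighted_defect :: "(real \<Rightarrow> real) \<Rightarrow> real \<Rightarrow> nat \<Rightarrow> 'a \<Rightarrow> real" where
  "weighted_defect w l n \<omega> =
     (\<Sum>k=1..2^n. w (l * midpoint_value n k \<omega>) * trapezoid_defect l (dyadic_increment B n k \<omega>))"

definition defect_pair :: "real \<Rightarrow> nat \<Rightarrow> nat \<Rightarrow> nat \<Rightarrow> 'a \<Rightarrow> real" where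
  "defect_pair l n j k \<omega> = cos (l * (midpoint_value n j \<omega> - midpoint_value n k \<omega>))
     * trapezoid_defect l (dyadic_increment B n j \<omega>) * trapezoid_defect l (dyadic_increment B n k \<omega>)"

text \<open>The two errors are squared and added because the addition theorem then leaves the cosine
  of a difference of midpoints. Either square alone would also contain sums of midpoints, whose
  covariances are not stationary.\<close>

lemma weighted_defect_squares:
  "(weighted_defect cos l n \<omega>)^2 + (weighted_defect sin l n \<omega>)^2
    = (\<Sum>j=1..2^n. \<Sum>k=1..2^n. defect_pair l n j k \<omega>)"
  unfolding weighted_defect_def power2_eq_square sum_product defect_pair_def sum.distrib[symmetric]
  by (intro sum.cong refl) (simp add: right_diff_distrib cos_diff algebra_simps)

lemma trapezoid_defect_measurable [measurable]: "trapezoid_defect l \<in> borel_measurable borel"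
  unfolding trapezoid_defect_def[abs_def] by measurable

lemma weighted_defect_measurable [measurable]:
  assumes [measurable]: "w \<in> borel_measurable borel"
  shows "weighted_defect w l n \<in> borel_measurable M"
  unfolding weighted_defect_def[abs_def]
proof (intro borel_measurable_sum)
  fix k assume "k \<in> {1..2^n::nat}"
  then have [measurable]: "midpoint_value n k \<in> borel_measurable M" "dyadic_increment B n k \<in> borel_measurable M"
    by (auto intro: midpoint_value_measurable dyadic_increment_measurable simp del: atLeastAtMost_iff)
  show "(\<lambda>\<omega>. w (l * midpoint_value n k \<omega>) * trapezoid_defect l (dyadic_increment B n k \<omega>)) \<in> borel_measurable M"
    by measurable
qed

lemma defect_pair_le:
  "\<bar>defect_pair l n j k \<omega>\<bar> \<le> l^6 / 32 * (dyadic_increment B n j \<omega> ^ 6 + dyadic_increment B n k \<omega> ^ 6)"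
proof -
  let ?f = "\<lambda>k. trapezoid_defect l (dyadic_increment B n k \<omega>)"
  have "\<bar>defect_pair l n j k \<omega>\<bar> \<le> \<bar>?f j\<bar> * \<bar>?f k\<bar>"
    unfolding defect_pair_def abs_mult by (intro mult_right_mono mult_left_le_one_le) auto
  also have "\<dots> \<le> ((?f j)^2 + (?f k)^2) / 2"
    using sum_squares_bound[of "\<bar>?f j\<bar>" "\<bar>?f k\<bar>"] by simp
  also have "\<dots> \<le> l^6 / 32 * (dyadic_increment B n j \<omega> ^ 6 + dyadic_increment B n k \<omega> ^ 6)"
    using trapezoid_defect_square_le[of l "dyadic_increment B n j \<omega>"]
      trapezoid_defect_square_le[of l "dyadic_increment B n k \<omega>"] by (simp add: algebra_simps)
  finally show ?thesis .
qed

lemma expectation_increment_6: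
  assumes "k \<in> {1..2^n}"
  shows "integrable M (\<lambda>\<omega>. dyadic_increment B n k \<omega> ^ 6)"
    "expectation (\<lambda>\<omega>. dyadic_increment B n k \<omega> ^ 6) = 15 * step_var n ^ 3"
  using centered_gaussian_moments[OF dyadic_increment_gaussian[OF assms]]
  by (auto simp: fact_numeral dest: meta_spec[of _ 3])

lemma defect_pair_integrable:
  assumes jk: "j \<in> {1..2^n}" "k \<in> {1..2^n}"
  shows "integrable M (defect_pair l n j k)"
proof (rule Bochner_Integration.integrable_bound)
  show "integrable M (\<lambda>\<omega>. l^6 / 32 * (dyadic_increment B n j \<omega> ^ 6 + dyadic_increment B n k \<omega> ^ 6))"
    using jk by (intro integrable_mult_right Bochner_Integration.integrable_add expectation_increment_6)
  show "defect_pair l n j k \<in> borel_measurable M"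
    using jk unfolding defect_pair_def[abs_def] by measurable
  show "AE \<omega> in M. norm (defect_pair l n j k \<omega>) \<le> norm (l^6 / 32 * (dyadic_increment B n j \<omega> ^ 6 + dyadic_increment B n k \<omega> ^ 6))"
    using defect_pair_le[of l n j k] by (intro AE_I2) (auto intro: order_trans)
qed

lemma defect_pair_crude:
  assumes jk: "j \<in> {1..2^n}" "k \<in> {1..2^n}"
  shows "expectation (defect_pair l n j k) \<le> l^6 * step_var n ^ 3"
proof -
  have "expectation (defect_pair l n j k)
    \<le> expectation (\<lambda>\<omega>. l^6 / 32 * (dyadic_increment B n j \<omega> ^ 6 + dyadic_increment B n k \<omega> ^ 6))"
    using jk
    by (intro integral_mono defect_pair_integrable integrable_mult_right Bochner_Integration.integrable_add
        expectation_increment_6 defect_pair_le[THEN abs_le_D1])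
  \<comment> \<open>The two sixth moments are \<open>15 * step_var n ^ 3\<close> each, and 30/32 is
    at most 1.\<close>
  also have "\<dots> = l^6 / 32 * (30 * step_var n ^ 3)"
    using jk by (simp add: expectation_increment_6)
  also have "\<dots> \<le> l^6 * step_var n ^ 3"
    using step_var_pos[of n] by simp
  finally show ?thesis .
qed

lemma defect_pair_fine:
  assumes jk: "j \<in> {1..2^n}" "k \<in> {1..2^n}" and l: "l^2 * step_var n \<le> 1" and H2: "2 * H \<le> 1"
  defines "e \<equiv> nat \<bar>int j - int k\<bar>"
  shows "expectation (defect_pair l n j k) \<le> 4 * l^6 * step_var n ^ 3 *
     (1/2 * \<bar>\<bar>real e + 1\<bar> powr (2*H) + \<bar>real e - 1\<bar> powr (2*H) - 2 * real e powr (2*H)\<bar>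
      + l^2 * step_var n / 16 * (\<bar>real e + 1\<bar> powr (2*H) - \<bar>real e - 1\<bar> powr (2*H))^2)"
proof -
  define U where "U = (\<lambda>\<omega>. midpoint_value n j \<omega> - midpoint_value n k \<omega>)"
  let ?X = "dyadic_increment B n j" and ?Y = "dyadic_increment B n k"
  have U: "U \<in> gaussian_span"
    unfolding U_def midpoint_diff using jk by (intro add scale increment_span dyadic_in_unit)
  have var: "expectation (\<lambda>\<omega>. (dyadic_increment B n i \<omega>)^2) = step_var n" if "i \<in> {1..2^n}" for i
    using centered_gaussian_moments(2)[OF dyadic_increment_gaussian[OF that], of 1] by simp
  interpret T: gaussian_triple M U ?X ?Y "expectation (\<lambda>\<omega>. (U \<omega>)^2)" "step_var n"
    "expectation (\<lambda>\<omega>. U \<omega> * ?X \<omega>)" "expectation (\<lambda>\<omega>. U \<omega> * ?Y \<omega>)" "expectation (\<lambda>\<omega>. ?X \<omega> * ?Y \<omega>)"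
    using jk by (intro gaussian_triple_span U dyadic_increment_span var)
  let ?c = "\<bar>\<bar>real e + 1\<bar> powr (2*H) + \<bar>real e - 1\<bar> powr (2*H) - 2 * real e powr (2*H)\<bar>"
  let ?d = "\<bar>real e + 1\<bar> powr (2*H) - \<bar>real e - 1\<bar> powr (2*H)"
  have cov: "\<bar>expectation (\<lambda>\<omega>. U \<omega> * ?X \<omega>)\<bar> = step_var n / 4 * \<bar>?d\<bar>"
    "\<bar>expectation (\<lambda>\<omega>. U \<omega> * ?Y \<omega>)\<bar> = step_var n / 4 * \<bar>?d\<bar>"
    "\<bar>expectation (\<lambda>\<omega>. ?X \<omega> * ?Y \<omega>)\<bar> = step_var n / 2 * ?c"
    unfolding U_def e_def by (rule dyadic_covariances[OF jk])+
  have H': "0 < 2 * H" using H by simp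
  have gap: "0 \<le> powr_gap (2*H) (Suc e)" "powr_gap (2*H) (Suc e) \<le> 1"
     "e \<noteq> 0 \<Longrightarrow> 0 \<le> powr_gap (2*H) e" "e \<noteq> 0 \<Longrightarrow> powr_gap (2*H) e \<le> 1"
    using powr_gap_nonneg[OF H' H2] powr_gap_le_1[OF H' H2] by auto
  \<comment> \<open>A central difference is the sum of two gaps of size at most 1. After division by
    4 this is the bound \<open>step_var n / 2\<close> required of the mixed covariances.\<close>
  have c: "?c \<le> 2" and d: "\<bar>?d\<bar> \<le> 2"
    unfolding powr_second_difference[OF H' H2] powr_central_difference[OF H' H2] using gap by auto
  have scaling: "4 * (l^6 * s^2 * (s/2 * c + l^2 * (s/4 * d * (s/4 * d)))) = 4 * l^6 * s^3 * (1/2 * c + l^2 * s / 16 * d^2)"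
    for s c d :: real
    by (simp add: power2_eq_square power3_eq_cube algebra_simps)
  have mult_double_double: "z * (2 * p) * (2 * q) = 4 * (z * p * q)" for z p q :: real by simp
  have "expectation (defect_pair l n j k) = 4 * expectation (\<lambda>\<omega>. cos (l * U \<omega>)
      * (l/2 * ?X \<omega> * cos (l/2 * ?X \<omega>) - sin (l/2 * ?X \<omega>)) * (l/2 * ?Y \<omega> * cos (l/2 * ?Y \<omega>) - sin (l/2 * ?Y \<omega>)))"
    unfolding integral_mult_right_zero[symmetric]
    by (intro Bochner_Integration.integral_cong refl)
       (unfold defect_pair_def trapezoid_defect_eq U_def, rule mult_double_double)
  also have "\<dots> \<le> 4 * (l^6 * step_var n ^ 2 * (\<bar>expectation (\<lambda>\<omega>. ?X \<omega> * ?Y \<omega>)\<bar>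
      + l^2 * \<bar>expectation (\<lambda>\<omega>. U \<omega> * ?X \<omega>) * expectation (\<lambda>\<omega>. U \<omega> * ?Y \<omega>)\<bar>))"
  proof (rule mult_left_mono[OF abs_le_D1[OF T.trapezoid_pair_bound[OF l]]])
    show "\<bar>expectation (\<lambda>\<omega>. U \<omega> * ?X \<omega>)\<bar> \<le> step_var n / 2" "\<bar>expectation (\<lambda>\<omega>. U \<omega> * ?Y \<omega>)\<bar> \<le> step_var n / 2"
      unfolding cov using mult_left_mono[OF d, of "step_var n"] step_var_pos[of n] by auto
    show "\<bar>expectation (\<lambda>\<omega>. ?X \<omega> * ?Y \<omega>)\<bar> \<le> step_var n"
      unfolding cov using mult_left_mono[OF c, of "step_var n"] step_var_pos[of n] by auto
  qed simp
  also have "\<dots> = 4 * l^6 * step_var n ^ 3 * (1/2 * ?c + l^2 * step_var n / 16 * ?d^2)"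
    unfolding abs_mult cov power2_abs[symmetric, of ?d] by (rule scaling)
  finally show ?thesis .
qed

lemma weighted_defect_integrable_square:
  shows "integrable M (\<lambda>\<omega>. (weighted_defect cos l n \<omega>)^2 + (weighted_defect sin l n \<omega>)^2)"
    and "expectation (\<lambda>\<omega>. (weighted_defect cos l n \<omega>)^2 + (weighted_defect sin l n \<omega>)^2)
      = (\<Sum>j=1..2^n. \<Sum>k=1..2^n. expectation (defect_pair l n j k))"
proof -
  have i: "integrable M (\<lambda>\<omega>. \<Sum>k=1..2^n. defect_pair l n j k \<omega>)" if "j \<in> {1..2^n}" for j
    using that by (intro Bochner_Integration.integrable_sum defect_pair_integrable)
  show "integrable M (\<lambda>\<omega>. (weighted_defect cos l n \<omega>)^2 + (weighted_defect sin l n \<omega>)^2)"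
    unfolding weighted_defect_squares by (intro Bochner_Integration.integrable_sum i)
  show "expectation (\<lambda>\<omega>. (weighted_defect cos l n \<omega>)^2 + (weighted_defect sin l n \<omega>)^2)
      = (\<Sum>j=1..2^n. \<Sum>k=1..2^n. expectation (defect_pair l n j k))"
    unfolding weighted_defect_squares
    by (subst Bochner_Integration.integral_sum[OF i], assumption, intro sum.cong refl,
        subst Bochner_Integration.integral_sum, auto intro: defect_pair_integrable)
qed

lemma weighted_defect_crude:
  "expectation (\<lambda>\<omega>. (weighted_defect cos l n \<omega>)^2 + (weighted_defect sin l n \<omega>)^2)
    \<le> (2^n)^2 * (l^6 * step_var n ^ 3)"
proof -
  have "(\<Sum>j=1..2^n. \<Sum>k=1..2^n. expectation (defect_pair l n j k))
    \<le> (\<Sum>j::nat=1..2^n. \<Sum>k::nat=1..2^n. l^6 * step_var n ^ 3)"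
    by (intro sum_mono defect_pair_crude)
  then show ?thesis
    unfolding weighted_defect_integrable_square(2) by (simp add: power2_eq_square mult.assoc)
qed

text \<open>Row by row, the second differences sum to at most 2 + 2, and the squared central
  differences to at most \<open>16 / step_var n\<close>. The sum over \<open>j\<close> is thus
  bounded uniformly in \<open>k\<close>, and only one factor \<open>2^n\<close> is lost.\<close>

lemma weighted_defect_fine:
  assumes l: "l^2 * step_var n \<le> 1" and H2: "2 * H \<le> 1"
  shows "expectation (\<lambda>\<omega>. (weighted_defect cos l n \<omega>)^2 + (weighted_defect sin l n \<omega>)^2)
    \<le> 2^n * (8 * l^6 * (1 + l^2) * step_var n ^ 3)"
proof -
  let ?c = "\<lambda>e. \<bar>\<bar>real e + 1\<bar> powr (2*H) + \<bar>real e - 1\<bar> powr (2*H) - 2 * real e powr (2*H)\<bar>"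
  let ?d = "\<lambda>e. (\<bar>real e + 1\<bar> powr (2*H) - \<bar>real e - 1\<bar> powr (2*H))^2"
  have H': "0 < 2 * H" using H by simp
  have inner: "(\<Sum>j=1..2^n. expectation (defect_pair l n j k)) \<le> 8 * l^6 * (1 + l^2) * step_var n ^ 3"
    if k: "k \<in> {1..2^n}" for k
  proof -
    let ?e = "\<lambda>j. nat \<bar>int j - int k\<bar>"
    have c: "(\<Sum>j=1..2^n. ?c (?e j)) \<le> 4"
      using sum_distance_le[of ?c k "2^n"] sum_powr_second_difference_le[OF H' H2, of "2^n"] k by simp
    have "(\<Sum>j=1..2^n. ?d (?e j)) \<le> 16 * real (2^n) powr (2*H)"
      using sum_distance_le[of ?d k "2^n"] sum_powr_central_difference_square_le[OF H' H2, of "2^n"] k by simp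
    also have "real (2^n) powr (2*H) = inverse (step_var n)"
      by (simp add: step_var_def powr_minus powr_powr mult_ac flip: powr_realpow)
    finally have d: "step_var n * (\<Sum>j=1..2^n. ?d (?e j)) \<le> 16"
      using step_var_pos[of n] by (simp add: field_simps)
    have "(\<Sum>j=1..2^n. expectation (defect_pair l n j k)) \<le> (\<Sum>j=1..2^n. 4 * l^6 * step_var n ^ 3 *
       (1/2 * ?c (?e j) + l^2 * step_var n / 16 * ?d (?e j)))"
      by (intro sum_mono defect_pair_fine k l H2)
    also have "\<dots> = 4 * l^6 * step_var n ^ 3 *
       (1/2 * (\<Sum>j=1..2^n. ?c (?e j)) + l^2 / 16 * (step_var n * (\<Sum>j=1..2^n. ?d (?e j))))"
      by (simp only: sum_distrib_left sum.distrib distrib_left mult_ac times_divide_eq_right times_divide_eq_left)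
    also have "\<dots> \<le> 4 * l^6 * step_var n ^ 3 * (1/2 * 4 + l^2 / 16 * 16)"
      using c d step_var_pos[of n] by (intro mult_left_mono add_mono) auto
    also have "\<dots> \<le> 8 * l^6 * (1 + l^2) * step_var n ^ 3"
    proof -
      have "0 \<le> l^6 * step_var n ^ 3 * l^2" using step_var_pos[of n] by simp
      then show ?thesis by (simp add: algebra_simps)
    qed
    finally show ?thesis .
  qed
  have "(\<Sum>k=1..2^n. \<Sum>j=1..2^n. expectation (defect_pair l n j k))
     \<le> (\<Sum>k::nat=1..2^n. 8 * l^6 * (1 + l^2) * step_var n ^ 3)"
    by (intro sum_mono inner)
  then show ?thesis
    unfolding weighted_defect_integrable_square(2) by (subst sum.swap) simp
qed

end

section \<open>Chaining and convergence in probability\<close>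

context fbm
begin

lemma weighted_defect_L2_bound:
  assumes H6: "1/6 < H"
  shows "\<exists>r. 0 < r \<and> r < 1 \<and> (\<forall>l n. expectation (\<lambda>\<omega>. (weighted_defect cos l n \<omega>)^2 + (weighted_defect sin l n \<omega>)^2)
    \<le> 16 * (1 + \<bar>l\<bar>)^12 * r^n)"
proof (cases "1/3 < H")
  case True
  \<comment> \<open>The absolute bound has \<open>(2^n)^2\<close> pairs with
    \<open>step_var n ^ 3\<close> each.\<close>
  define r :: real where "r = 2 powr (2 - 6 * H)"
  have r: "0 < r" "r < 1" using True by (auto simp: r_def powr_less_one)
  have "(2^n)^2 * (l^6 * step_var n ^ 3) \<le> 16 * (1 + \<bar>l\<bar>)^12 * r^n" for l n
  proof -
    have "(2^n)^2 * step_var n ^ 3 = r^n"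
      by (simp add: step_var_def r_def powr_realpow[symmetric] powr_powr powr_add[symmetric] algebra_simps)
    then have "(2^n)^2 * (l^6 * step_var n ^ 3) = l^6 * r^n" by (simp add: mult.left_commute)
    also have "l^6 = \<bar>l\<bar>^6" by (simp add: power_even_abs)
    also have "\<bar>l\<bar>^6 \<le> (1 + \<bar>l\<bar>)^6" by (intro power_mono) auto
    also have "(1 + \<bar>l\<bar>)^6 \<le> (1 + \<bar>l\<bar>)^12" by (intro power_increasing) auto
    also have "(1 + \<bar>l\<bar>)^12 \<le> 16 * (1 + \<bar>l\<bar>)^12" by simp
    finally show ?thesis using r by (simp add: mult_right_mono)
  qed
  then have "expectation (\<lambda>\<omega>. (weighted_defect cos l n \<omega>)^2 + (weighted_defect sin l n \<omega>)^2)
    \<le> 16 * (1 + \<bar>l\<bar>)^12 * r^n" for l n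
    using weighted_defect_crude order_trans by blast
  then show ?thesis using r by blast
next
  case False
  \<comment> \<open>The fine bound has \<open>2^n\<close> rows with \<open>step_var n ^ 3\<close>
    each.\<close>
  define r :: real where "r = 2 powr (1 - 6 * H)"
  have r: "0 < r" "r < 1" using H6 by (auto simp: r_def powr_less_one)
  have rn: "2^n * step_var n ^ 3 = r^n" for n
    by (simp add: step_var_def r_def powr_realpow[symmetric] powr_powr powr_add[symmetric] algebra_simps)
  have "expectation (\<lambda>\<omega>. (weighted_defect cos l n \<omega>)^2 + (weighted_defect sin l n \<omega>)^2)
    \<le> 16 * (1 + \<bar>l\<bar>)^12 * r^n" for l n
  proof (cases "l^2 * step_var n \<le> 1")
    case True
    have "expectation (\<lambda>\<omega>. (weighted_defect cos l n \<omega>)^2 + (weighted_defect sin l n \<omega>)^2)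
      \<le> 2^n * (8 * l^6 * (1 + l^2) * step_var n ^ 3)"
      using True False by (intro weighted_defect_fine) auto
    also have "\<dots> = 8 * (\<bar>l\<bar>^6 * (1 + \<bar>l\<bar>^2)) * r^n"
      unfolding rn[symmetric] by (simp add: power_even_abs)
    also have "\<dots> \<le> 8 * ((1 + \<bar>l\<bar>)^6 * (2 * (1 + \<bar>l\<bar>)^6)) * r^n"
    proof (intro mult_right_mono mult_left_mono mult_mono)
      show "\<bar>l\<bar>^6 \<le> (1 + \<bar>l\<bar>)^6" by (intro power_mono) auto
      have "1 + \<bar>l\<bar>^2 \<le> (1 + \<bar>l\<bar>)^2" by (simp add: power2_eq_square algebra_simps)
      also have "\<dots> \<le> (1 + \<bar>l\<bar>)^6" by (intro power_increasing) auto
      also have "\<dots> \<le> 2 * (1 + \<bar>l\<bar>)^6" by simp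
      finally show "1 + \<bar>l\<bar>^2 \<le> 2 * (1 + \<bar>l\<bar>)^6" .
    qed (use r in auto)
    also have "\<dots> = 16 * (1 + \<bar>l\<bar>)^12 * r^n" by (simp add: mult.commute mult.left_commute flip: power_add)
    finally show ?thesis .
  next
    case l: False
    have "expectation (\<lambda>\<omega>. (weighted_defect cos l n \<omega>)^2 + (weighted_defect sin l n \<omega>)^2)
      \<le> (2^n)^2 * (l^6 * step_var n ^ 3)" by (rule weighted_defect_crude)
    \<comment> \<open>High frequency: inserting a factor that is at least 1 turns
      \<open>(2^n)^2 * step_var n ^ 3\<close> into \<open>(2^n * step_var n ^ 3)^2\<close>, at the
      cost of six more powers of \<open>l\<close>.\<close>
    also have "\<dots> \<le> (2^n)^2 * (l^6 * step_var n ^ 3) * (l^2 * step_var n) ^ 3"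
      using l step_var_pos[of n] mult_left_mono[OF one_le_power[of "l^2 * step_var n" 3], of "(2^n)^2 * (l^6 * step_var n ^ 3)"]
      by simp
    also have "\<dots> = (l^6 * (l^2)^3) * ((2^n * step_var n ^ 3) * (2^n * step_var n ^ 3))"
      by (simp only: power_mult_distrib power2_eq_square[of "2^n"] mult_ac)
    also have "l^6 * (l^2)^3 = \<bar>l\<bar>^12"
      by (simp add: power_even_abs flip: power_mult power_add)
    also have "\<bar>l\<bar>^12 * ((2^n * step_var n ^ 3) * (2^n * step_var n ^ 3)) = \<bar>l\<bar>^12 * (r^n * r^n)"
      by (simp only: rn)
    also have "\<dots> \<le> (16 * (1 + \<bar>l\<bar>)^12) * (r^n * 1)"
    proof (intro mult_mono)
      have "\<bar>l\<bar>^12 \<le> (1 + \<bar>l\<bar>)^12" "0 \<le> (1 + \<bar>l\<bar>)^12" by (intro power_mono) auto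
      then show "\<bar>l\<bar>^12 \<le> 16 * (1 + \<bar>l\<bar>)^12" by linarith
    qed (use r in \<open>auto simp: power_le_one\<close>)
    finally show ?thesis by simp
  qed
  then show ?thesis using r by (intro exI[of _ r]) auto
qed

text \<open>Taking first absolute moments halves the degree in \<open>l\<close>. The nonnegative
  integral is used so that infinitely many frequencies can be summed under it without integrability
  conditions.\<close>

lemma weighted_defect_L1_bound:
  assumes H6: "1/6 < H"
  shows "\<exists>s. 0 < s \<and> s < 1 \<and> (\<forall>l n. \<forall>w\<in>{cos, sin}.
    (\<integral>\<^sup>+\<omega>. ennreal \<bar>weighted_defect w l n \<omega>\<bar> \<partial>M) \<le> ennreal (9 * (1 + \<bar>l\<bar>)^6 * s^n))"
proof -
  obtain r where r: "0 < r" "r < 1" and bound: "\<And>l n. expectation (\<lambda>\<omega>. (weighted_defect cos l n \<omega>)^2 + (weighted_defect sin l n \<omega>)^2)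
    \<le> 16 * (1 + \<bar>l\<bar>)^12 * r^n"
    using weighted_defect_L2_bound[OF H6] by auto
  define s where "s = sqrt r"
  have s: "0 < s" "s < 1" using r by (auto simp: s_def)
  have "(\<integral>\<^sup>+\<omega>. ennreal \<bar>weighted_defect w l n \<omega>\<bar> \<partial>M) \<le> ennreal (9 * (1 + \<bar>l\<bar>)^6 * s^n)"
    if w: "w \<in> {cos, sin}" for l n w
  proof -
    \<comment> \<open>the optimal weight in \<open>2 \<bar>W\<bar> \<le> d + W\<^sup>2 / d\<close>\<close>
    define d where "d = (1 + \<bar>l\<bar>)^6 * s^n"
    have d: "0 < d" using s by (auto simp: d_def)
    have d2: "d * d = (1 + \<bar>l\<bar>)^12 * r^n"
    proof -
      have "r = s * s" using r by (simp add: s_def)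
      then show ?thesis by (simp add: d_def power_mult_distrib mult_ac flip: power_add)
    qed
    define V where "V = (\<lambda>\<omega>. (weighted_defect cos l n \<omega>)^2 + (weighted_defect sin l n \<omega>)^2)"
    have Vi: "integrable M V" and EV: "expectation V \<le> 16 * (d * d)"
      using weighted_defect_integrable_square(1)[of l n] bound[of l n] by (auto simp: V_def d2 mult.assoc)
    have "(\<integral>\<^sup>+\<omega>. ennreal \<bar>weighted_defect w l n \<omega>\<bar> \<partial>M) \<le> (\<integral>\<^sup>+\<omega>. ennreal (d / 2 + V \<omega> / (2 * d)) \<partial>M)"
    proof (intro nn_integral_mono ennreal_leI)
      fix \<omega>
      let ?W = "\<bar>weighted_defect w l n \<omega>\<bar>"
      have "2 * ?W * d \<le> d^2 + ?W^2" using sum_squares_bound[of ?W d] by simp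
      also have "?W^2 \<le> V \<omega>" using w by (auto simp: V_def)
      finally show "?W \<le> d / 2 + V \<omega> / (2 * d)"
        using d by (simp add: field_simps power2_eq_square)
    qed
    also have "\<dots> = ennreal (expectation (\<lambda>\<omega>. d / 2 + V \<omega> / (2 * d)))"
      using d by (intro nn_integral_eq_integral Bochner_Integration.integrable_add integrable_divide Vi)
        (auto simp: V_def)
    also have "expectation (\<lambda>\<omega>. d / 2 + V \<omega> / (2 * d)) = d / 2 + expectation V / (2 * d)"
      using Vi by (subst Bochner_Integration.integral_add) (auto simp: prob_space)
    also have "\<dots> \<le> d / 2 + 16 * (d * d) / (2 * d)"
      using EV d by (intro add_left_mono divide_right_mono) auto
    also have "\<dots> \<le> 9 * d" using d by simp
    finally show ?thesis by (simp add: d_def mult.assoc ennreal_leI)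
  qed
  then show ?thesis using s by blast
qed

section \<open>Uniform control of the values at dyadic points\<close>

text \<open>A point of level \<open>Suc m\<close> either belongs to level \<open>m\<close> already
  or is one increment of the new level to the right of such a point. Every value is therefore
  reached from time 0 with at most one increment per level.\<close>

lemma dyadic_values_bound:
  assumes "B 0 \<omega> = 0" and q: "0 < q" "q < 1" and C: "0 \<le> C"
    and inc: "\<And>m i. m \<le> n \<Longrightarrow> i \<in> {1..2^m} \<Longrightarrow> \<bar>dyadic_increment B m i \<omega>\<bar> \<le> C * q^m"
    and "m \<le> n" "k \<le> 2^m"
  shows "\<bar>B (real k / 2^m) \<omega>\<bar> \<le> C * (\<Sum>j\<le>m. q^j)"
  using assms(6,7)
proof (induction m arbitrary: k)
  case 0
  then have "k = 0 \<or> k = 1" by auto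
  then show ?case using inc[of 0 1] assms(1) C by (auto simp: dyadic_increment_def)
next
  case (Suc m)
  have even: "\<bar>B (real (2 * i) / 2^Suc m) \<omega>\<bar> \<le> C * (\<Sum>j\<le>m. q^j)" if "i \<le> 2^m" for i
    using Suc.IH[of i] that Suc.prems by simp
  show ?case
  proof (cases "even k")
    case True
    then obtain i where "k = 2 * i" by blast
    moreover have "0 \<le> C * q^Suc m" using C q by simp
    ultimately show ?thesis using even[of i] Suc.prems(2) by (simp add: distrib_left)
  next
    case False
    then obtain i where i: "k = 2 * i + 1" by (rule oddE)
    have "B (real k / 2^Suc m) \<omega> = B (real (2 * i) / 2^Suc m) \<omega> + dyadic_increment B (Suc m) k \<omega>"
      by (simp add: dyadic_increment_def i)
    moreover have "\<bar>dyadic_increment B (Suc m) k \<omega>\<bar> \<le> C * q^Suc m"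
      using Suc.prems i by (intro inc) auto
    moreover have "\<bar>B (real (2 * i) / 2^Suc m) \<omega>\<bar> \<le> C * (\<Sum>j\<le>m. q^j)"
      using Suc.prems i by (intro even) auto
    ultimately show ?thesis by (simp add: distrib_left)
  qed
qed

text \<open>Level \<open>m\<close> has \<open>2^m\<close> increments with eighth moment of order
  \<open>2 powr (- 8 * H * m)\<close>, so their sum over all levels converges for
  \<open>H > 1/8\<close>, with room for the geometric weights of the chaining. The bound
  \<open>K\<close> does not depend on \<open>n\<close>.\<close>

lemma dyadic_values_tight:
  assumes H8: "1/8 < H" and \<eta>: "0 < \<eta>"
  shows "\<exists>K. \<forall>n. prob {\<omega>\<in>space M. \<exists>k\<le>2^n. \<bar>B (real k / 2^n) \<omega>\<bar> > K} \<le> \<eta>"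
proof -
  \<comment> \<open>\<open>q^m\<close> decays more slowly than the increments of level \<open>m\<close>, yet \<open>q\<close> makes the expectation of \<open>Z\<close> below a
    geometric sum, since \<open>2 powr (1 - 8 * H) / q^8 = q^8\<close>\<close>
  define q :: real where "q = 2 powr (- ((8 * H - 1) / 16))"
  have q: "0 < q" "q < 1" using H8 by (auto simp: q_def powr_less_one)
  define A where "A = 105 / (1 - q^8)"
  have q8: "0 < 1 - q^8" using q by (simp add: power_less_one_iff)
  have A: "0 < A" using q8 by (simp add: A_def)
  \<comment> \<open>Chosen so that \<open>A / C \<le> \<eta>\<close> in Markov's inequality; the
    summand 1 gives \<open>C \<ge> 1\<close>, hence \<open>C \<le> C^8\<close>.\<close>
  define C where "C = 1 + A / \<eta>"
  have C: "1 \<le> C" using A \<eta> by (simp add: C_def)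
  define K where "K = C / (1 - q)"
  have geo: "(\<Sum>j\<le>m. x^j) \<le> 1 / (1 - x)" if "0 < x" "x < 1" for x :: real and m
    using sum_gp0[of x m] that by (simp add: divide_right_mono)
  have "prob {\<omega>\<in>space M. \<exists>k\<le>2^n. \<bar>B (real k / 2^n) \<omega>\<bar> > K} \<le> \<eta>" for n
  proof -
    define Z where "Z = (\<lambda>\<omega>. \<Sum>m\<le>n. \<Sum>i=1..2^m. (dyadic_increment B m i \<omega> / q^m)^8)"
    have mom: "integrable M (\<lambda>\<omega>. dyadic_increment B m i \<omega> ^ 8)"
      "expectation (\<lambda>\<omega>. dyadic_increment B m i \<omega> ^ 8) = 105 * step_var m ^ 4"
      if "i \<in> {1..2^m}" for m i
      using centered_gaussian_moments(1)[OF dyadic_increment_gaussian[OF that], of 8]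
        centered_gaussian_moments(2)[OF dyadic_increment_gaussian[OF that], of 4]
      by (auto simp: fact_numeral)
    have Zi: "integrable M Z"
      unfolding Z_def power_divide by (intro Bochner_Integration.integrable_sum integrable_divide mom)
    have "expectation Z = (\<Sum>m\<le>n. \<Sum>i::nat=1..2^m. 105 * step_var m ^ 4 / (q^m)^8)"
      unfolding Z_def power_divide
      by (subst Bochner_Integration.integral_sum, intro Bochner_Integration.integrable_sum integrable_divide mom, assumption,
          intro sum.cong refl, subst Bochner_Integration.integral_sum, intro integrable_divide mom, assumption,
          intro sum.cong refl, simp add: mom)
    also have "\<dots> = (\<Sum>m\<le>n. 105 * (q^8)^m)"
    proof (intro sum.cong refl)
      fix m
      have "2^m * step_var m ^ 4 = (q^8)^m * (q^m)^8"
        by (simp add: step_var_def q_def powr_realpow[symmetric] powr_powr powr_add[symmetric] algebra_simps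
            diff_divide_distrib)
      then show "(\<Sum>i::nat=1..2^m. 105 * step_var m ^ 4 / (q^m)^8) = 105 * (q^8)^m"
        using q by (simp add: field_simps)
    qed
    also have "\<dots> \<le> A"
      using geo[of "q^8" n] q by (simp add: A_def power_less_one_iff flip: sum_distrib_left)
    finally have EZ: "expectation Z \<le> A" .
    have Z0: "0 \<le> Z \<omega>" for \<omega> unfolding Z_def by (intro sum_nonneg zero_le_even_power) auto
    have "AE \<omega> in M. \<omega> \<in> {\<omega>\<in>space M. \<exists>k\<le>2^n. \<bar>B (real k / 2^n) \<omega>\<bar> > K} \<longrightarrow> \<omega> \<in> {\<omega>\<in>space M. C \<le> Z \<omega>}"
      using B_0
    proof eventually_elim
      case (elim \<omega>)
      have "C \<le> Z \<omega>" if k: "k \<le> 2^n" "\<bar>B (real k / 2^n) \<omega>\<bar> > K" for k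
      proof (rule ccontr)
        assume "\<not> C \<le> Z \<omega>"
        have "\<bar>dyadic_increment B m i \<omega>\<bar> \<le> C * q^m" if mi: "m \<le> n" "i \<in> {1..2^m}" for m i
        proof (rule ccontr)
          assume "\<not> ?thesis"
          then have "C < \<bar>dyadic_increment B m i \<omega>\<bar> / q^m" using q by (simp add: field_simps)
          then have "C^8 < (\<bar>dyadic_increment B m i \<omega>\<bar> / q^m)^8" using C by (intro power_strict_mono) auto
          moreover have "C \<le> C^8" using C by (intro self_le_power) auto
          moreover have "(\<bar>dyadic_increment B m i \<omega>\<bar> / q^m)^8 = (dyadic_increment B m i \<omega> / q^m)^8"
            by (simp add: power_divide power_even_abs)
          moreover have "(dyadic_increment B m i \<omega> / q^m)^8 \<le> (\<Sum>i=1..2^m. (dyadic_increment B m i \<omega> / q^m)^8)"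
            using mi by (intro member_le_sum) auto
          moreover have "\<dots> \<le> Z \<omega>"
            unfolding Z_def using mi by (intro member_le_sum) (auto intro: sum_nonneg)
          ultimately show False using \<open>\<not> C \<le> Z \<omega>\<close> by linarith
        qed
        then have "\<bar>B (real k / 2^n) \<omega>\<bar> \<le> C * (\<Sum>j\<le>n. q^j)"
          using C k by (intro dyadic_values_bound[OF elim q, of C n n k]) auto
        also have "\<dots> \<le> K" using mult_left_mono[OF geo[OF q], of C n] C by (simp add: K_def)
        finally show False using k by simp
      qed
      then show ?case by auto
    qed
    then have "prob {\<omega>\<in>space M. \<exists>k\<le>2^n. \<bar>B (real k / 2^n) \<omega>\<bar> > K} \<le> prob {\<omega>\<in>space M. C \<le> Z \<omega>}"
      using Zi by (intro finite_measure_mono_AE) auto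
    also have "\<dots> \<le> expectation Z / C"
      using integral_Markov_inequality_measure[of M Z "space M" C] Zi Z0 C by simp
    also have "\<dots> \<le> A / C" using EZ C by (intro divide_right_mono) auto
    also have "\<dots> \<le> \<eta>" using A \<eta> by (simp add: C_def field_simps)
    finally show ?thesis .
  qed
  then show ?thesis by blast
qed

end

section \<open>From trigonometric functions to general integrands\<close>

lemma trapezoid_defect_cos:
  "l / 2 * (cos (l * x) + cos (l * y)) * (y - x) - (sin (l * y) - sin (l * x))
    = cos (l * ((y + x) / 2)) * trapezoid_defect l (y - x)"
proof -
  define p q where "p = l * ((y + x) / 2)" and "q = l * (y - x) / 2"
  have pq: "l * x = p - q" "l * y = p + q" by (simp_all add: p_def q_def field_simps)
  have defect: "trapezoid_defect l (y - x) = l * (y - x) * cos q - 2 * sin q"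
    by (simp add: trapezoid_defect_def q_def)
  show ?thesis
    unfolding p_def[symmetric] pq defect by (simp add: cos_add cos_diff sin_add sin_diff algebra_simps)
qed

text \<open>The derivative of \<open>cos\<close> is \<open>- sin\<close>, so this is the negated
  error for \<open>cos (l x)\<close>; hence the plus sign here and the minus sign in front of
  \<open>a\<close> in the error series.\<close>

lemma trapezoid_defect_sin:
  "l / 2 * (sin (l * x) + sin (l * y)) * (y - x) + (cos (l * y) - cos (l * x))
    = sin (l * ((y + x) / 2)) * trapezoid_defect l (y - x)"
proof -
  define p q where "p = l * ((y + x) / 2)" and "q = l * (y - x) / 2"
  have pq: "l * x = p - q" "l * y = p + q" by (simp_all add: p_def q_def field_simps)
  have defect: "trapezoid_defect l (y - x) = l * (y - x) * cos q - 2 * sin q"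
    by (simp add: trapezoid_defect_def q_def)
  show ?thesis
    unfolding p_def[symmetric] pq defect by (simp add: cos_add cos_diff sin_add sin_diff algebra_simps)
qed

text \<open>In the extended nonnegative reals the majorant always exists, so absolute convergence of
  the series need not be settled path by path.\<close>

lemma sums_abs_le_suminf_ennreal:
  fixes u :: "nat \<Rightarrow> real"
  assumes "u sums s"
  shows "ennreal \<bar>s\<bar> \<le> (\<Sum>n. ennreal \<bar>u n\<bar>)"
proof (rule LIMSEQ_le_const2)
  have "(\<lambda>N. \<bar>\<Sum>n<N. u n\<bar>) \<longlonglongrightarrow> \<bar>s\<bar>"
    using assms unfolding sums_def by (rule tendsto_rabs)
  then show "(\<lambda>N. ennreal \<bar>\<Sum>n<N. u n\<bar>) \<longlonglongrightarrow> ennreal \<bar>s\<bar>"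
    by (rule tendsto_ennrealI)
  have "ennreal \<bar>\<Sum>n<N. u n\<bar> \<le> (\<Sum>n. ennreal \<bar>u n\<bar>)" for N
  proof -
    have "ennreal \<bar>\<Sum>n<N. u n\<bar> \<le> ennreal (\<Sum>n<N. \<bar>u n\<bar>)" by (intro ennreal_leI sum_abs)
    also have "\<dots> = (\<Sum>n<N. ennreal \<bar>u n\<bar>)" by (rule sum_ennreal[symmetric]) simp
    also have "\<dots> \<le> (\<Sum>n. ennreal \<bar>u n\<bar>)" by (rule sum_le_suminf) auto
    finally show ?thesis .
  qed
  then show "\<exists>N. \<forall>n\<ge>N. ennreal \<bar>\<Sum>k<n. u k\<bar> \<le> (\<Sum>n. ennreal \<bar>u n\<bar>)" by blast
qed

context fbm
begin

definition trapezoid_sum :: "(real \<Rightarrow> real) \<Rightarrow> nat \<Rightarrow> 'a \<Rightarrow> real" where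
  "trapezoid_sum f n \<omega> = 1/2 * (\<Sum>k=1..2^n.
     (deriv f (B (real k / 2^n) \<omega>) + deriv f (B ((real k - 1) / 2^n) \<omega>)) * dyadic_increment B n k \<omega>)"

lemma sum_dyadic_telescope:
  fixes f :: "real \<Rightarrow> real"
  shows "(\<Sum>k=1..2^n. f (B (real k / 2^n) \<omega>) - f (B ((real k - 1) / 2^n) \<omega>)) = f (B 1 \<omega>) - f (B 0 \<omega>)"
proof -
  have "(\<Sum>k=1..N. f (B (real k / 2^n) \<omega>) - f (B ((real k - 1) / 2^n) \<omega>)) = f (B (real N / 2^n) \<omega>) - f (B 0 \<omega>)" for N
    by (induction N) auto
  from this[of "2^n"] show ?thesis by simp
qed

text \<open>Pathwise linearity: on each step the convergent expansions at the two end points are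
  combined, and a finite sum of convergent series converges. The values of \<open>f\<close>
  telescope over the grid.\<close>

lemma trapezoid_error_sums:
  assumes f: "\<And>x. \<bar>x\<bar> < K \<Longrightarrow> (\<lambda>\<nu>. a \<nu> * cos (l \<nu> * x) + b \<nu> * sin (l \<nu> * x)) sums f x"
    and f': "\<And>x. \<bar>x\<bar> < K \<Longrightarrow> (\<lambda>\<nu>. l \<nu> * (b \<nu> * cos (l \<nu> * x) - a \<nu> * sin (l \<nu> * x))) sums deriv f x"
    and B: "\<And>k. k \<le> 2^n \<Longrightarrow> \<bar>B (real k / 2^n) \<omega>\<bar> < K"
  shows "(\<lambda>\<nu>. b \<nu> * weighted_defect cos (l \<nu>) n \<omega> - a \<nu> * weighted_defect sin (l \<nu>) n \<omega>)
    sums (trapezoid_sum f n \<omega> - (f (B 1 \<omega>) - f (B 0 \<omega>)))"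
proof -
  let ?y = "\<lambda>k. B (real k / 2^n) \<omega>" and ?x = "\<lambda>k. B ((real k - 1) / 2^n) \<omega>"
  have "(\<lambda>\<nu>. b \<nu> * (cos (l \<nu> * midpoint_value n k \<omega>) * trapezoid_defect (l \<nu>) (dyadic_increment B n k \<omega>))
      - a \<nu> * (sin (l \<nu> * midpoint_value n k \<omega>) * trapezoid_defect (l \<nu>) (dyadic_increment B n k \<omega>)))
    sums (1/2 * ((deriv f (?y k) + deriv f (?x k)) * dyadic_increment B n k \<omega>) - (f (?y k) - f (?x k)))"
    if k: "k \<in> {1..2^n}" for k
  proof -
    have y: "\<bar>?y k\<bar> < K" using B[of k] k by auto
    have x: "\<bar>?x k\<bar> < K" using B[of "k - 1"] k by (auto simp: of_nat_diff)
    have "(\<lambda>\<nu>. 1/2 * ((l \<nu> * (b \<nu> * cos (l \<nu> * ?y k) - a \<nu> * sin (l \<nu> * ?y k))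
        + l \<nu> * (b \<nu> * cos (l \<nu> * ?x k) - a \<nu> * sin (l \<nu> * ?x k))) * (?y k - ?x k))
        - ((a \<nu> * cos (l \<nu> * ?y k) + b \<nu> * sin (l \<nu> * ?y k)) - (a \<nu> * cos (l \<nu> * ?x k) + b \<nu> * sin (l \<nu> * ?x k))))
      sums (1/2 * ((deriv f (?y k) + deriv f (?x k)) * (?y k - ?x k)) - (f (?y k) - f (?x k)))"
      by (intro sums_diff sums_mult sums_mult2 sums_add f f' x y)
    moreover have "b \<nu> * (cos (l \<nu> * midpoint_value n k \<omega>) * trapezoid_defect (l \<nu>) (dyadic_increment B n k \<omega>))
        - a \<nu> * (sin (l \<nu> * midpoint_value n k \<omega>) * trapezoid_defect (l \<nu>) (dyadic_increment B n k \<omega>))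
      = 1/2 * ((l \<nu> * (b \<nu> * cos (l \<nu> * ?y k) - a \<nu> * sin (l \<nu> * ?y k))
        + l \<nu> * (b \<nu> * cos (l \<nu> * ?x k) - a \<nu> * sin (l \<nu> * ?x k))) * (?y k - ?x k))
        - ((a \<nu> * cos (l \<nu> * ?y k) + b \<nu> * sin (l \<nu> * ?y k)) - (a \<nu> * cos (l \<nu> * ?x k) + b \<nu> * sin (l \<nu> * ?x k)))" for \<nu>
    proof -
      have "b * (l / 2 * (cx + cy) * h - (sy - sx)) - a * (l / 2 * (sx + sy) * h + (cy - cx))
        = 1/2 * ((l * (b * cy - a * sy) + l * (b * cx - a * sx)) * h) - ((a * cy + b * sy) - (a * cx + b * sx))"
        for a b l h cx cy sx sy :: real
        by (simp add: field_simps)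
      then show ?thesis
        unfolding midpoint_value_def dyadic_increment_def trapezoid_defect_cos[symmetric] trapezoid_defect_sin[symmetric] .
    qed
    ultimately show ?thesis by (simp add: dyadic_increment_def)
  qed
  then have "(\<lambda>\<nu>. \<Sum>k=1..2^n. b \<nu> * (cos (l \<nu> * midpoint_value n k \<omega>) * trapezoid_defect (l \<nu>) (dyadic_increment B n k \<omega>))
      - a \<nu> * (sin (l \<nu> * midpoint_value n k \<omega>) * trapezoid_defect (l \<nu>) (dyadic_increment B n k \<omega>)))
    sums (\<Sum>k=1..2^n. 1/2 * ((deriv f (?y k) + deriv f (?x k)) * dyadic_increment B n k \<omega>) - (f (?y k) - f (?x k)))"
    by (rule sums_sum)
  then show ?thesis
    unfolding sum_subtractf[of _ _ "{1..2^n}"] sum_distrib_left[symmetric] sum_subtractf[symmetric, of f]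
    by (simp only: sum_subtractf sum_distrib_left[symmetric] weighted_defect_def[symmetric]
        trapezoid_sum_def sum_dyadic_telescope[unfolded sum_subtractf])
qed

text \<open>The majorant \<open>Y\<close> is defined on the whole space, while the expansion holds
  only on paths whose grid values stay below \<open>K\<close>. Hence the tail estimate is made for a
  measurable set \<open>S\<close> that merely contains the bad paths of this kind. Coefficients of
  order -8 against first moments of degree 6 give the summable weights
  \<open>1 / (1 + real \<nu>)^2\<close>.\<close>

lemma trapezoid_sum_tail:
  assumes H6: "1/6 < H" and f: "Ck 8 f" and K: "1 \<le> K" and \<epsilon>: "0 < \<epsilon>"
  shows "\<exists>G s. 0 < s \<and> s < 1 \<and> (\<forall>n. \<exists>S\<in>sets M. prob S \<le> G * s^n \<and>
    (\<forall>\<omega>\<in>space M. (\<forall>k\<le>2^n. \<bar>B (real k / 2^n) \<omega>\<bar> < K) \<longrightarrow>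
       \<epsilon> < \<bar>trapezoid_sum f n \<omega> - (f (B 1 \<omega>) - f (B 0 \<omega>))\<bar> \<longrightarrow> \<omega> \<in> S))"
proof -
  obtain s where s: "0 < s" "s < 1" and L1: "\<And>l n w. w \<in> {cos, sin} \<Longrightarrow>
      (\<integral>\<^sup>+\<omega>. ennreal \<bar>weighted_defect w l n \<omega>\<bar> \<partial>M) \<le> ennreal (9 * (1 + \<bar>l\<bar>)^6 * s^n)"
    using weighted_defect_L1_bound[OF H6] by blast
  have K': "0 < K" and two_le: "2 \<le> (8::nat)" using K by auto
  obtain a b C where C: "\<And>\<nu>. real \<nu> ^ 8 * \<bar>a \<nu>\<bar> \<le> C" "\<And>\<nu>. real \<nu> ^ 8 * \<bar>b \<nu>\<bar> \<le> C" and
    exp: "\<And>x. \<bar>x\<bar> < K \<Longrightarrow> (\<lambda>\<nu>. a \<nu> * cos (real \<nu> / K * x) + b \<nu> * sin (real \<nu> / K * x)) sums f x"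
      "\<And>x. \<bar>x\<bar> < K \<Longrightarrow> (\<lambda>\<nu>. real \<nu> / K * (b \<nu> * cos (real \<nu> / K * x) - a \<nu> * sin (real \<nu> / K * x))) sums deriv f x"
    using local_trigonometric_expansion[OF f two_le K'] by blast
  \<comment> \<open>Since \<open>1 + \<nu> \<le> 2 * \<nu>\<close> for positive
    \<open>\<nu>\<close>, passing to powers of \<open>1 + \<nu>\<close> costs
    \<open>2^8 = 256\<close>; the last two summands cover frequency 0.\<close>
  define A where "A = 256 * C + \<bar>a 0\<bar> + \<bar>b 0\<bar>"
  have C0: "0 \<le> C" by (rule order_trans[OF _ C(1)[of 1]]) simp
  have A0: "0 \<le> A" using C0 by (simp add: A_def)
  have decay: "\<bar>c \<nu>\<bar> * (1 + real \<nu>)^8 \<le> A" if c: "c = a \<or> c = b" for c \<nu>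
  proof (cases "\<nu> = 0")
    case True
    then show ?thesis using c C0 by (auto simp: A_def)
  next
    case False
    have "\<bar>c \<nu>\<bar> * (1 + real \<nu>)^8 \<le> \<bar>c \<nu>\<bar> * (2 * real \<nu>)^8"
      using False by (intro mult_left_mono power_mono) auto
    also have "\<dots> = 256 * (real \<nu> ^ 8 * \<bar>c \<nu>\<bar>)" by (simp add: power_mult_distrib)
    also have "\<dots> \<le> 256 * C" using c C[of \<nu>] by auto
    also have "\<dots> \<le> A" by (simp add: A_def)
    finally show ?thesis .
  qed
  define D where "D = (\<Sum>\<nu>. 1 / (1 + real \<nu>)^2)"
  have D: "summable (\<lambda>\<nu>. 1 / (1 + real \<nu>)^2)"
    using inverse_squares_sums by (simp add: sums_iff add.commute)
  let ?l = "\<lambda>\<nu>. real \<nu> / K"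
  define Y where "Y = (\<lambda>n \<omega>. \<Sum>\<nu>. ennreal (\<bar>b \<nu>\<bar> * \<bar>weighted_defect cos (?l \<nu>) n \<omega>\<bar> + \<bar>a \<nu>\<bar> * \<bar>weighted_defect sin (?l \<nu>) n \<omega>\<bar>))"
  have Ym [measurable]: "Y n \<in> borel_measurable M" for n
    unfolding Y_def by measurable
  have one: "ennreal \<bar>c \<nu>\<bar> * (\<integral>\<^sup>+\<omega>. ennreal \<bar>weighted_defect w (?l \<nu>) n \<omega>\<bar> \<partial>M) \<le> ennreal (9 * A * s^n * (1 / (1 + real \<nu>)^2))"
    if c: "c = a \<or> c = b" and w: "w \<in> {cos, sin}" for c w \<nu> n
  proof -
    have "ennreal \<bar>c \<nu>\<bar> * (\<integral>\<^sup>+\<omega>. ennreal \<bar>weighted_defect w (?l \<nu>) n \<omega>\<bar> \<partial>M)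
      \<le> ennreal \<bar>c \<nu>\<bar> * ennreal (9 * (1 + \<bar>?l \<nu>\<bar>)^6 * s^n)"
      by (intro mult_left_mono L1 w) auto
    also have "\<dots> = ennreal (\<bar>c \<nu>\<bar> * (9 * (1 + \<bar>?l \<nu>\<bar>)^6 * s^n))"
      using s by (intro ennreal_mult[symmetric]) auto
    also have "\<dots> \<le> ennreal (9 * A * s^n * (1 / (1 + real \<nu>)^2))"
    proof (rule ennreal_leI)
      \<comment> \<open>Here \<open>K \<ge> 1\<close> enters: rescaling only lowers the
        frequencies.\<close>
      have "\<bar>?l \<nu>\<bar> \<le> real \<nu>" using K mult_left_mono[OF K, of "real \<nu>"] by (simp add: divide_le_eq)
      then have "(1 + \<bar>?l \<nu>\<bar>)^6 \<le> (1 + real \<nu>)^6" by (intro power_mono) auto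
      then have "\<bar>c \<nu>\<bar> * (9 * (1 + \<bar>?l \<nu>\<bar>)^6 * s^n) \<le> \<bar>c \<nu>\<bar> * (9 * (1 + real \<nu>)^6 * s^n)"
        using s by (intro mult_left_mono mult_right_mono) auto
      also have "\<dots> = 9 * s^n * ((\<bar>c \<nu>\<bar> * (1 + real \<nu>)^8) / (1 + real \<nu>)^2)"
      proof -
        have e: "(1 + real \<nu>)^8 = (1 + real \<nu>)^6 * (1 + real \<nu>)^2" by (simp flip: power_add)
        have cancel: "x * (9 * p * t) = 9 * t * (x * (p * d) / d)" if "d \<noteq> 0" for x p t d :: real
          using that by simp
        have "(1 + real \<nu>)^2 \<noteq> 0" by (simp add: add_nonneg_eq_0_iff)
        then show ?thesis unfolding e by (rule cancel)
      qed
      also have "\<dots> \<le> 9 * s^n * (A / (1 + real \<nu>)^2)"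
        using s decay[OF c] by (intro mult_left_mono divide_right_mono) auto
      finally show "\<bar>c \<nu>\<bar> * (9 * (1 + \<bar>?l \<nu>\<bar>)^6 * s^n) \<le> 9 * A * s^n * (1 / (1 + real \<nu>)^2)" by (simp add: mult_ac)
    qed
    finally show ?thesis .
  qed
  have EY: "(\<integral>\<^sup>+\<omega>. Y n \<omega> \<partial>M) \<le> ennreal (18 * A * D * s^n)" for n
  proof -
    have "(\<integral>\<^sup>+\<omega>. Y n \<omega> \<partial>M) = (\<Sum>\<nu>. \<integral>\<^sup>+\<omega>. ennreal (\<bar>b \<nu>\<bar> * \<bar>weighted_defect cos (?l \<nu>) n \<omega>\<bar> + \<bar>a \<nu>\<bar> * \<bar>weighted_defect sin (?l \<nu>) n \<omega>\<bar>) \<partial>M)"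
      unfolding Y_def by (intro nn_integral_suminf) measurable
    also have "\<dots> = (\<Sum>\<nu>. ennreal \<bar>b \<nu>\<bar> * (\<integral>\<^sup>+\<omega>. ennreal \<bar>weighted_defect cos (?l \<nu>) n \<omega>\<bar> \<partial>M)
       + ennreal \<bar>a \<nu>\<bar> * (\<integral>\<^sup>+\<omega>. ennreal \<bar>weighted_defect sin (?l \<nu>) n \<omega>\<bar> \<partial>M))"
      by (simp add: ennreal_plus ennreal_mult nn_integral_add nn_integral_cmult)
    also have "\<dots> \<le> (\<Sum>\<nu>. ennreal (18 * A * s^n * (1 / (1 + real \<nu>)^2)))"
    proof (intro suminf_le allI)
      fix \<nu>
      have "ennreal \<bar>b \<nu>\<bar> * (\<integral>\<^sup>+\<omega>. ennreal \<bar>weighted_defect cos (?l \<nu>) n \<omega>\<bar> \<partial>M)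
       + ennreal \<bar>a \<nu>\<bar> * (\<integral>\<^sup>+\<omega>. ennreal \<bar>weighted_defect sin (?l \<nu>) n \<omega>\<bar> \<partial>M)
       \<le> ennreal (9 * A * s^n * (1 / (1 + real \<nu>)^2)) + ennreal (9 * A * s^n * (1 / (1 + real \<nu>)^2))"
        by (intro add_mono one) auto
      also have "\<dots> = ennreal (18 * A * s^n * (1 / (1 + real \<nu>)^2))"
        using A0 s by (simp flip: ennreal_plus)
      finally show "ennreal \<bar>b \<nu>\<bar> * (\<integral>\<^sup>+\<omega>. ennreal \<bar>weighted_defect cos (?l \<nu>) n \<omega>\<bar> \<partial>M)
       + ennreal \<bar>a \<nu>\<bar> * (\<integral>\<^sup>+\<omega>. ennreal \<bar>weighted_defect sin (?l \<nu>) n \<omega>\<bar> \<partial>M)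
       \<le> ennreal (18 * A * s^n * (1 / (1 + real \<nu>)^2))" .
    qed auto
    also have "\<dots> = ennreal (\<Sum>\<nu>. 18 * A * s^n * (1 / (1 + real \<nu>)^2))"
      using D A0 s by (intro suminf_ennreal2 summable_mult) auto
    also have "(\<Sum>\<nu>. 18 * A * s^n * (1 / (1 + real \<nu>)^2)) = 18 * A * D * s^n"
      using suminf_mult[OF D, of "18 * A * s^n"] by (simp add: D_def mult_ac)
    finally show ?thesis .
  qed
  have "\<exists>S\<in>sets M. prob S \<le> (18 * A * D / \<epsilon>) * s^n \<and>
    (\<forall>\<omega>\<in>space M. (\<forall>k\<le>2^n. \<bar>B (real k / 2^n) \<omega>\<bar> < K) \<longrightarrow>
       \<epsilon> < \<bar>trapezoid_sum f n \<omega> - (f (B 1 \<omega>) - f (B 0 \<omega>))\<bar> \<longrightarrow> \<omega> \<in> S)" for n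
  proof (intro bexI conjI ballI impI)
    define S where "S = {\<omega>\<in>space M. 1 \<le> ennreal (1 / \<epsilon>) * Y n \<omega>}"
    show S: "S \<in> sets M" unfolding S_def by measurable
    have "emeasure M S \<le> ennreal (1 / \<epsilon>) * (\<integral>\<^sup>+\<omega>. Y n \<omega> * indicator (space M) \<omega> \<partial>M)"
      unfolding S_def by (rule nn_integral_Markov_inequality) auto
    also have "(\<integral>\<^sup>+\<omega>. Y n \<omega> * indicator (space M) \<omega> \<partial>M) = (\<integral>\<^sup>+\<omega>. Y n \<omega> \<partial>M)"
      by (intro nn_integral_cong) auto
    also have "ennreal (1 / \<epsilon>) * \<dots> \<le> ennreal (1 / \<epsilon>) * ennreal (18 * A * D * s^n)"
      by (intro mult_left_mono EY) auto
    also have "\<dots> = ennreal ((18 * A * D / \<epsilon>) * s^n)"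
      using \<epsilon> by (simp flip: ennreal_mult')
    finally have "ennreal (prob S) \<le> ennreal ((18 * A * D / \<epsilon>) * s^n)"
      by (simp add: emeasure_eq_measure)
    moreover have "0 \<le> (18 * A * D / \<epsilon>) * s^n"
      using A0 s \<epsilon> D by (auto simp: D_def intro!: mult_nonneg_nonneg divide_nonneg_nonneg suminf_nonneg)
    ultimately show "prob S \<le> (18 * A * D / \<epsilon>) * s^n" by (simp add: ennreal_le_iff)
    fix \<omega> assume \<omega>: "\<omega> \<in> space M" and small: "\<forall>k\<le>2^n. \<bar>B (real k / 2^n) \<omega>\<bar> < K"
      and big: "\<epsilon> < \<bar>trapezoid_sum f n \<omega> - (f (B 1 \<omega>) - f (B 0 \<omega>))\<bar>"
    have "(\<lambda>\<nu>. b \<nu> * weighted_defect cos (?l \<nu>) n \<omega> - a \<nu> * weighted_defect sin (?l \<nu>) n \<omega>)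
      sums (trapezoid_sum f n \<omega> - (f (B 1 \<omega>) - f (B 0 \<omega>)))"
      by (rule trapezoid_error_sums[OF exp]) (use small in auto)
    then have "ennreal \<bar>trapezoid_sum f n \<omega> - (f (B 1 \<omega>) - f (B 0 \<omega>))\<bar>
       \<le> (\<Sum>\<nu>. ennreal \<bar>b \<nu> * weighted_defect cos (?l \<nu>) n \<omega> - a \<nu> * weighted_defect sin (?l \<nu>) n \<omega>\<bar>)"
      by (rule sums_abs_le_suminf_ennreal)
    also have "\<dots> \<le> Y n \<omega>"
      unfolding Y_def
      by (intro suminf_le allI ennreal_leI order_trans[OF abs_triangle_ineq4]) (auto simp: abs_mult)
    finally have "ennreal \<epsilon> \<le> Y n \<omega>"
      using big by (meson ennreal_leI less_imp_le order_trans)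
    then have "ennreal (1 / \<epsilon>) * ennreal \<epsilon> \<le> ennreal (1 / \<epsilon>) * Y n \<omega>" by (intro mult_left_mono) auto
    then show "\<omega> \<in> S" using \<omega> \<epsilon> by (simp add: S_def flip: ennreal_mult')
  qed
  then show ?thesis using s by blast
qed

lemma trapezoid_sum_measurable:
  assumes "Ck 8 f"
  shows "trapezoid_sum f n \<in> borel_measurable M" "(\<lambda>\<omega>. f (B 1 \<omega>) - f 0) \<in> borel_measurable M"
proof -
  have "Ck (Suc 7) f" using assms by (simp del: Ck.simps)
  then obtain g where g: "\<And>x. (f has_real_derivative g x) (at x)" "Ck 7 g"
    unfolding Ck.simps(2) by blast
  have "deriv f = g" using g(1) by (auto intro: DERIV_imp_deriv)
  then have [measurable]: "f \<in> borel_measurable borel" "deriv f \<in> borel_measurable borel"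
    using Ck_continuous[OF assms] Ck_continuous[OF g(2)] by (auto intro: borel_measurable_continuous_onI)
  have [measurable]: "B 1 \<in> borel_measurable M" by (intro gaussian_span_measurable base) simp
  show "(\<lambda>\<omega>. f (B 1 \<omega>) - f 0) \<in> borel_measurable M" by measurable
  show "trapezoid_sum f n \<in> borel_measurable M"
    unfolding trapezoid_sum_def[abs_def]
  proof (intro borel_measurable_times borel_measurable_const borel_measurable_sum)
    fix k assume k: "k \<in> {1..2^n::nat}"
    have [measurable]: "B (real k / 2^n) \<in> borel_measurable M" "B ((real k - 1) / 2^n) \<in> borel_measurable M"
      "dyadic_increment B n k \<in> borel_measurable M"
      using dyadic_in_unit[OF k, THEN base, THEN gaussian_span_measurable] dyadic_increment_measurable[OF k] by auto
    show "(\<lambda>\<omega>. deriv f (B (real k / 2^n) \<omega>) + deriv f (B ((real k - 1) / 2^n) \<omega>)) \<in> borel_measurable M"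
      by measurable
    show "dyadic_increment B n k \<in> borel_measurable M" by measurable
  qed
qed

lemma trapezoid_sum_tendsto:
  assumes H6: "1/6 < H" and f: "Ck 8 f"
  shows "tendsto_in_probability M (trapezoid_sum f) (\<lambda>\<omega>. f (B 1 \<omega>) - f 0)"
  unfolding tendsto_in_probability_def
proof (intro conjI allI impI)
  note meas [measurable] = trapezoid_sum_measurable[OF f]
  show "trapezoid_sum f n \<in> borel_measurable M" for n by measurable
  show "(\<lambda>\<omega>. f (B 1 \<omega>) - f 0) \<in> borel_measurable M" by measurable
  fix \<epsilon> :: real assume \<epsilon>: "0 < \<epsilon>"
  let ?P = "\<lambda>n. prob {\<omega>\<in>space M. \<epsilon> < \<bar>trapezoid_sum f n \<omega> - (f (B 1 \<omega>) - f 0)\<bar>}"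
  show "?P \<longlonglongrightarrow> 0"
  proof (rule LIMSEQ_I)
    fix \<eta> :: real assume \<eta>: "0 < \<eta>"
    obtain K0 where K0: "\<And>n. prob {\<omega>\<in>space M. \<exists>k\<le>2^n. \<bar>B (real k / 2^n) \<omega>\<bar> > K0} \<le> \<eta> / 2"
      using dyadic_values_tight[of "\<eta> / 2"] H6 \<eta> by auto
    \<comment> \<open>Both \<open>1 \<le> K\<close> and \<open>K0 < K\<close> are wanted; the latter
      turns the weak bound by \<open>K0\<close> into the strict one under which the expansion is
      valid.\<close>
    define K where "K = \<bar>K0\<bar> + 1"
    have K: "1 \<le> K" "K0 < K" by (auto simp: K_def)
    obtain G s where s: "0 < s" "s < 1" and S: "\<And>n. \<exists>S\<in>sets M. prob S \<le> G * s^n \<and>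
      (\<forall>\<omega>\<in>space M. (\<forall>k\<le>2^n. \<bar>B (real k / 2^n) \<omega>\<bar> < K) \<longrightarrow>
       \<epsilon> < \<bar>trapezoid_sum f n \<omega> - (f (B 1 \<omega>) - f (B 0 \<omega>))\<bar> \<longrightarrow> \<omega> \<in> S)"
      using trapezoid_sum_tail[OF H6 f K(1) \<epsilon>] by auto
    have bound: "?P n \<le> \<eta> / 2 + G * s^n" for n
    proof -
      obtain S where S_sets: "S \<in> sets M" and PS: "prob S \<le> G * s^n" and
        S': "\<And>\<omega>. \<omega> \<in> space M \<Longrightarrow> (\<And>k. k \<le> 2^n \<Longrightarrow> \<bar>B (real k / 2^n) \<omega>\<bar> < K) \<Longrightarrow>
          \<epsilon> < \<bar>trapezoid_sum f n \<omega> - (f (B 1 \<omega>) - f (B 0 \<omega>))\<bar> \<Longrightarrow> \<omega> \<in> S"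
        using S[of n] by blast
      let ?T = "{\<omega>\<in>space M. \<exists>k\<le>2^n. \<bar>B (real k / 2^n) \<omega>\<bar> > K0}"
      have "(\<lambda>\<omega>. B (real k / 2^n) \<omega>) \<in> borel_measurable M" if "k \<le> 2^n" for k
      proof -
        have "real k \<le> 2^n" using that by (metis of_nat_le_iff of_nat_numeral of_nat_power)
        then show ?thesis
          by (intro gaussian_span_measurable base) (simp del: of_nat_le_numeral_power_cancel_iff)
      qed
      then have "{\<omega>\<in>space M. \<bar>B (real k / 2^n) \<omega>\<bar> > K0} \<in> sets M" if "k \<le> 2^n" for k
        using that by measurable
      then have "(\<Union>k\<in>{..2^n}. {\<omega>\<in>space M. \<bar>B (real k / 2^n) \<omega>\<bar> > K0}) \<in> sets M"
        by (intro sets.finite_UN) auto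
      also have "(\<Union>k\<in>{..2^n}. {\<omega>\<in>space M. \<bar>B (real k / 2^n) \<omega>\<bar> > K0}) = ?T" by auto
      finally have T: "?T \<in> sets M" .
      \<comment> \<open>Only almost everywhere, because the limit contains \<open>f 0\<close> while
        the telescoped sum contains \<open>f (B 0 \<omega>)\<close>.\<close>
      have "AE \<omega> in M. \<omega> \<in> {\<omega>\<in>space M. \<epsilon> < \<bar>trapezoid_sum f n \<omega> - (f (B 1 \<omega>) - f 0)\<bar>} \<longrightarrow> \<omega> \<in> ?T \<union> S"
        using B_0
      proof eventually_elim
        case (elim \<omega>)
        show ?case
        proof (intro impI)
          assume *: "\<omega> \<in> {\<omega>\<in>space M. \<epsilon> < \<bar>trapezoid_sum f n \<omega> - (f (B 1 \<omega>) - f 0)\<bar>}"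
          show "\<omega> \<in> ?T \<union> S"
          proof (cases "\<omega> \<in> ?T")
            case False
            then have "\<bar>B (real k / 2^n) \<omega>\<bar> < K" if "k \<le> 2^n" for k
              using * that K(2) by force
            then show ?thesis using S'[of \<omega>] * elim by auto
          qed simp
        qed
      qed
      then have "?P n \<le> prob (?T \<union> S)" by (rule finite_measure_mono_AE) (rule sets.Un[OF T S_sets])
      also have "\<dots> \<le> prob ?T + prob S" by (rule measure_Un_le[OF T S_sets])
      also have "\<dots> \<le> \<eta> / 2 + G * s^n" using K0 PS by (intro add_mono) auto
      finally show ?thesis .
    qed
    have "(\<lambda>n. G * s^n) \<longlonglongrightarrow> G * 0"
      using s by (intro tendsto_intros LIMSEQ_realpow_zero) auto
    then have "eventually (\<lambda>n. G * s^n < \<eta> / 2) sequentially"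
      using \<eta> by (intro order_tendstoD) auto
    then obtain N where "\<And>n. N \<le> n \<Longrightarrow> G * s^n < \<eta> / 2"
      by (auto simp: eventually_sequentially)
    then have "norm (?P n - 0) < \<eta>" if "N \<le> n" for n
      using bound[of n] that by (fastforce simp: measure_nonneg)
    then show "\<exists>N. \<forall>n\<ge>N. norm (?P n - 0) < \<eta>" by blast
  qed
qed

end

theorem theorem4:
  fixes M :: "'a measure" and H :: real
    and B :: "real \<Rightarrow> 'a \<Rightarrow> real" and f :: "real \<Rightarrow> real"
  assumes "prob_space M"
    and "0 < H" and "H < 1" and "H > 1/6"
    and "fractional_brownian_motion M H B"
    and "continuously_differentiable 12 f"
    and "\<And>(p::real) (i::nat). 0 < p \<Longrightarrow> i \<le> 12 \<Longrightarrow>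
           (SUP t\<in>{0..1}. \<integral>\<^sup>+\<omega>. ennreal (\<bar>(deriv ^^ i) f (B t \<omega>)\<bar> powr p) \<partial>M) < \<infinity>"
  shows "tendsto_in_probability M
           (\<lambda>n \<omega>. 1/2 * (\<Sum>k=1..2^n.
              (deriv f (B (real k / 2^n) \<omega>) + deriv f (B ((real k - 1) / 2^n) \<omega>))
                * dyadic_increment B n k \<omega>))
           (\<lambda>\<omega>. f (B 1 \<omega>) - f 0)"
proof -
  interpret fbm M H B
    using assms by (intro fbm.intro fbm_axioms.intro)
  have "Ck 8 f" using continuously_differentiable_Ck[OF assms(6)] by (rule Ck_mono) simp
  from trapezoid_sum_tendsto[OF assms(4) this] show ?thesis
    unfolding trapezoid_sum_def[abs_def] .
qed

end
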